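(* Let $\mathcal VM$ be a relative tractor bundle on a parabolic geometry $(p:\mathcal G\to M,\omega)$ of type $(G,Q)$ and let $\varphi\in\Omega^{k-1}_\rho(M,\mathcal VM)\subset\Gamma(\Lambda^{k-1}\mathcal A^*_\rho M\otimes\mathcal VM)$. Then $d^{\mathcal V}(d^{\mathcal V}\varphi)$ is induced by the section of $\Lambda^{k+1}\mathcal A^*_\rho M\otimes\mathcal VM$ which maps $s_0,\dots,s_k\in\Gamma(\mathcal A_\rho M)$ to $$\sum_{i<j}(-1)^{i+j}\bigl(D_{\kappa(\Pi_\rho(s_i),\Pi_\rho(s_j))}\varphi\bigr)(s_0,\dots,\widehat{s_i},\dots,\widehat{s_j},\dots,s_k),$$ where $\kappa\in\Omega^2(M,\mathcal AM)$ is the curvature of the geometry and $D$ is the fundamental derivative.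
   Context: $G$ is a real or complex semisimple Lie group with Lie algebra $\mathfrak g$; $\mathfrak q\subset\mathfrak p\subset\mathfrak g$ are nested parabolic subalgebras ($\mathfrak p=\mathfrak g$ allowed); $P\subset G$ is a parabolic subgroup with Lie algebra $\mathfrak p$, $Q\subset P$ the normalizer of $\mathfrak q$ in $P$. Nilradicals: $\mathfrak p_+\subset\mathfrak q_+\subset\mathfrak q\subset\mathfrak p$; $P_+=\exp(\mathfrak p_+)$. A parabolic geometry of type $(G,Q)$ is a principal $Q$-bundle $\mathcal G\to M$ with a Cartan connection $\omega\in\Omega^1(\mathcal G,\mathfrak g)$. A relative natural bundle is $\mathcal G\times_Q\mathbb W$ with $\mathbb W$ a $Q$-representation on which $P_+$ acts trivially; a relative tractor bundle is $\mathcal VM=\mathcal G\times_Q\mathbb V$ for a finite dimensional representation $\mathbb V$ of $P$ on which $P_+$ acts trivially. $T_\rho M=\mathcal G\times_Q(\mathfrak p/\mathfrak q)\subset TM=\mathcal G\times_Q(\mathfrak g/\mathfrak q)$; $\Omega^k_\rho(M,\mathcal VM)=\Gamma(\Lambda^kT^*_\rho M\otimes\mathcal VM)$. $\mathcal AM=\mathcal G\times_Q\mathfrak g$, $\mathcal A_\rho M=\mathcal G\times_Q(\mathfrak p/\mathfrak p_+)$, $\mathcal A^0_\rho M=\mathcal G\times_Q(\mathfrak q/\mathfrak p_+)$, and $\Pi_\rho:\mathcal A_\rho M\to\mathcal A_\rho M/\mathcal A^0_\rho M=T_\rho M$ is the projection. Via $\Pi_\rho$, $\Omega^k_\rho(M,\mathcal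 VM)$ is the subspace of $\Gamma(\Lambda^k\mathcal A^*_\rho M\otimes\mathcal VM)$ of elements vanishing upon insertion of one section of $\mathcal A^0_\rho M$. The bracket of $\mathfrak p/\mathfrak p_+$ and its action on $\mathbb V$ induce $\{\ ,\ \}$ on $\mathcal A_\rho M$ and $\bullet:\mathcal A_\rho M\times\mathcal VM\to\mathcal VM$. Fundamental derivative: via $\omega$, sections of $\mathcal AM$ are $Q$-invariant vector fields on $\mathcal G$ and sections of a natural bundle $E$ are $Q$-equivariant functions on $\mathcal G$; $D_s\sigma$ is the derivative of the function of $\sigma$ along the vector field of $s\in\Gamma(\mathcal AM)$. For relative natural $E$ and $s\in\Gamma(\mathcal A_\rho M)$, $D^\rho_s\sigma:=D_{\tilde s}\sigma$ for any $\tilde s\in\Gamma(\mathcal G\times_Q\mathfrak p)$ projecting to $s$. The curvature $\kappa\in\Omega^2(M,\mathcal AM)$ corresponds to the horizontal, equivariant form $(\xi,\eta)\mapsto d\omega(\xi,\eta)+[\omega(\xi),\omega(\eta)]$ on $\mathcal G$. The relative twisted exterior derivative $d^{\mathcal V}:\Omega^k_\rho(M,\mathcal VM)\to\Omega^{k+1}_\rho(M,\mathcal VM)$ is the restriction of the operator on $\Gamma(\Lambda^k\mathcal A^*_\rho M\otimes\mathcal VM)$ given by $$\tilde d^{\mathcal V}\varphi(s_0,\dots,s_k)=\sum_{i}(-1)^i(D^\rho_{s_i}\varphi)(s_0,\dots,\widehat{s_i},\dots,s_k)+\sum_i(-1)^is_i\bullet\varphi(s_0,\dots,\widehat{s_i},\dots,s_k)+\sum_{i<j}(-1)^{i+j}\varphi(\{s_i,s_j\},s_0,\dots,\widehat{s_i},\dots,\widehat{s_j},\dots,s_k).$$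 *)

theory Defs
  imports "HOL-Analysis.Analysis" "HOL-Algebra.Group"
begin

section \<open>Smooth manifolds\<close>

text \<open>Differentiability classes on an open subset of a finite-dimensional normed space.\<close>

primrec Ck_on :: "nat \<Rightarrow> 'a::real_normed_vector set \<Rightarrow> ('a \<Rightarrow> 'b::real_normed_vector) \<Rightarrow> bool" where
  "Ck_on 0 S f \<longleftrightarrow> continuous_on S f"
| "Ck_on (Suc n) S f \<longleftrightarrow> (\<forall>x\<in>S. f differentiable (at x)) \<and>
     (\<forall>v. Ck_on n S (\<lambda>x. frechet_derivative f (at x) v))"

definition smooth_on :: "'a::real_normed_vector set \<Rightarrow> ('a \<Rightarrow> 'b::real_normed_vector) \<Rightarrow> bool" where
  "smooth_on S f \<longleftrightarrow> (\<forall>n. Ck_on n S f)"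

definition fin_dim :: "'a::real_vector set \<Rightarrow> bool" where
  "fin_dim S \<longleftrightarrow> (\<exists>B. finite B \<and> S \<subseteq> span B)"

text \<open>
  A manifold is the whole of a Hausdorff, second countable type with an atlas, i.e. a set of pairs
  \<open>(U, \<phi>)\<close> of a chart domain and a chart map. The atlas need not be maximal. The model space
  is only required to be normed, so that zero-dimensional manifolds are included.
\<close>

type_synonym ('a, 'm) atlas = "('a set \<times> ('a \<Rightarrow> 'm)) set"

definition smooth_manifold ::
  "('a::{t2_space,second_countable_topology}, 'm::real_normed_vector) atlas \<Rightarrow> bool" where
  "smooth_manifold A \<longleftrightarrow> fin_dim (UNIV :: 'm set) \<and> (\<Union>(U,\<phi>)\<in>A. U) = UNIV \<and>
     (\<forall>(U,\<phi>)\<in>A. open U \<and> open (\<phi> ` U) \<and> homeomorphism U (\<phi> ` U) \<phi> (inv_into U \<phi>)) \<and>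
     (\<forall>(U,\<phi>)\<in>A. \<forall>(V,\<psi>)\<in>A. smooth_on (\<phi> ` (U \<inter> V)) (\<psi> \<circ> inv_into U \<phi>))"

definition prod_atlas ::
  "('a, 'm) atlas \<Rightarrow> ('b, 'n) atlas \<Rightarrow> ('a \<times> 'b, 'm \<times> 'n) atlas" where
  "prod_atlas A B = (\<lambda>((U,\<phi>),(V,\<psi>)). (U \<times> V, map_prod \<phi> \<psi>)) ` (A \<times> B)"

definition real_atlas :: "(real, real) atlas" where
  "real_atlas = {(UNIV, id)}"

text \<open>Smooth maps and smooth real functions on an open set \<open>W\<close>.\<close>

definition smooth_map ::
  "('a::topological_space, 'm::real_normed_vector) atlas \<Rightarrow>
   ('b::topological_space, 'n::real_normed_vector) atlas \<Rightarrow> 'a set \<Rightarrow> ('a \<Rightarrow> 'b) \<Rightarrow> bool" where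
  "smooth_map A B W F \<longleftrightarrow> continuous_on W F \<and>
     (\<forall>(U,\<phi>)\<in>A. \<forall>(V,\<psi>)\<in>B. smooth_on (\<phi> ` (U \<inter> W \<inter> F -` V)) (\<psi> \<circ> F \<circ> inv_into U \<phi>))"

definition smooth_fun_on ::
  "('a::topological_space, 'm::real_normed_vector) atlas \<Rightarrow> 'a set \<Rightarrow> ('a \<Rightarrow> real) \<Rightarrow> bool" where
  "smooth_fun_on A W f \<longleftrightarrow> (\<forall>(U,\<phi>)\<in>A. smooth_on (\<phi> ` (U \<inter> W)) (f \<circ> inv_into U \<phi>))"

text \<open>
  Smoothness on an arbitrary subset: local extendability to smooth maps on open sets. It is used for
  closed subgroups of a Lie group (and products with them), which are embedded submanifolds, so that
  it agrees with smoothness for the submanifold structure.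
\<close>

definition smooth_map_on ::
  "('a::topological_space, 'm::real_normed_vector) atlas \<Rightarrow>
   ('b::topological_space, 'n::real_normed_vector) atlas \<Rightarrow> 'a set \<Rightarrow> ('a \<Rightarrow> 'b) \<Rightarrow> bool" where
  "smooth_map_on A B S F \<longleftrightarrow>
     (\<forall>x\<in>S. \<exists>W F'. open W \<and> x \<in> W \<and> smooth_map A B W F' \<and> (\<forall>y\<in>W \<inter> S. F' y = F y))"

text \<open>
  Tangent vectors at \<open>u\<close> are the derivations at \<open>u\<close> of the functions that are smooth near
  \<open>u\<close>; the Leibniz rule for indicator functions of neighbourhoods makes them factor through germs.
  They are set to 0 on all other functions, so that equality of tangent vectors is equality in HOL.
\<close>

definition smooth_near ::
  "('a::topological_space, 'm::real_normed_vector) atlas \<Rightarrow> 'a \<Rightarrow> ('a \<Rightarrow> real) \<Rightarrow> bool" where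
  "smooth_near A u f \<longleftrightarrow> (\<exists>W. open W \<and> u \<in> W \<and> smooth_fun_on A W f)"

type_synonym 'a tangent = "('a \<Rightarrow> real) \<Rightarrow> real"

definition tangent_space ::
  "('a::topological_space, 'm::real_normed_vector) atlas \<Rightarrow> 'a \<Rightarrow> 'a tangent set" where
  "tangent_space A u = {D.
     (\<forall>f. \<not> smooth_near A u f \<longrightarrow> D f = 0) \<and>
     (\<forall>f c. smooth_near A u f \<longrightarrow> D (\<lambda>x. c * f x) = c * D f) \<and>
     (\<forall>f g. smooth_near A u f \<longrightarrow> smooth_near A u g \<longrightarrow>
        D (\<lambda>x. f x + g x) = D f + D g \<and>
        D (\<lambda>x. f x * g x) = f u * D g + g u * D f)}"

definition velocity ::
  "('a::topological_space, 'm::real_normed_vector) atlas \<Rightarrow> (real \<Rightarrow> 'a) \<Rightarrow> 'a tangent" where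
  "velocity A c = (\<lambda>f. if smooth_near A (c 0) f then deriv (f \<circ> c) 0 else 0)"

definition smooth_vector_field ::
  "('a::topological_space, 'm::real_normed_vector) atlas \<Rightarrow> 'a set \<Rightarrow> ('a \<Rightarrow> 'a tangent) \<Rightarrow> bool" where
  "smooth_vector_field A W X \<longleftrightarrow> (\<forall>u\<in>W. X u \<in> tangent_space A u) \<and>
     (\<forall>V f. open V \<and> V \<subseteq> W \<and> smooth_fun_on A V f \<longrightarrow> smooth_fun_on A V (\<lambda>u. X u f))"

definition vf_bracket ::
  "('a::topological_space, 'm::real_normed_vector) atlas \<Rightarrow>
   ('a \<Rightarrow> 'a tangent) \<Rightarrow> ('a \<Rightarrow> 'a tangent) \<Rightarrow> 'a \<Rightarrow> 'a tangent" where
  "vf_bracket A X Y u =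
     (\<lambda>f. if smooth_near A u f then X u (\<lambda>v. Y v f) - Y u (\<lambda>v. X v f) else 0)"

text \<open>
  Functions with values in a finite-dimensional vector space are treated through linear functionals;
  \<open>vderiv \<xi> \<sigma>\<close> is the derivative of the vector valued function \<open>\<sigma>\<close> along \<open>\<xi>\<close>.
\<close>

definition vsmooth_on ::
  "('a::topological_space, 'm::real_normed_vector) atlas \<Rightarrow> 'a set \<Rightarrow> ('a \<Rightarrow> 'w::real_vector) \<Rightarrow> bool" where
  "vsmooth_on A W \<sigma> \<longleftrightarrow> (\<forall>l :: 'w \<Rightarrow> real. linear l \<longrightarrow> smooth_fun_on A W (l \<circ> \<sigma>))"

definition vderiv :: "'a tangent \<Rightarrow> ('a \<Rightarrow> 'w::real_vector) \<Rightarrow> 'w" where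
  "vderiv \<xi> \<sigma> = (THE w. \<forall>l :: 'w \<Rightarrow> real. linear l \<longrightarrow> l w = \<xi> (l \<circ> \<sigma>))"

text \<open>
  A vector valued one-form assigns to a point a linear map on the tangent space there.
  Its exterior derivative is given by
  \<open>d\<omega>(X,Y) = X(\<omega>(Y)) - Y(\<omega>(X)) - \<omega>([X,Y])\<close> for vector fields \<open>X, Y\<close>
  extending the given tangent vectors.
\<close>

definition smooth_one_form ::
  "('a::topological_space, 'm::real_normed_vector) atlas \<Rightarrow> ('a \<Rightarrow> 'a tangent \<Rightarrow> 'w::real_vector) \<Rightarrow> bool" where
  "smooth_one_form A \<omega> \<longleftrightarrow>
     (\<forall>u. \<forall>\<xi>\<in>tangent_space A u. \<forall>\<eta>\<in>tangent_space A u. \<forall>a b.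
        \<omega> u (\<lambda>f. a * \<xi> f + b * \<eta> f) = a *\<^sub>R \<omega> u \<xi> + b *\<^sub>R \<omega> u \<eta>) \<and>
     (\<forall>W X. open W \<and> smooth_vector_field A W X \<longrightarrow> vsmooth_on A W (\<lambda>u. \<omega> u (X u)))"

definition ext_deriv ::
  "('a::topological_space, 'm::real_normed_vector) atlas \<Rightarrow> ('a \<Rightarrow> 'a tangent \<Rightarrow> 'w::real_vector) \<Rightarrow>
   'a \<Rightarrow> 'a tangent \<Rightarrow> 'a tangent \<Rightarrow> 'w" where
  "ext_deriv A \<omega> u \<xi> \<eta> = (THE w. \<forall>X Y.
     smooth_vector_field A UNIV X \<and> smooth_vector_field A UNIV Y \<and> X u = \<xi> \<and> Y u = \<eta> \<longrightarrow>
     w = vderiv \<xi> (\<lambda>v. \<omega> v (Y v)) - vderiv \<eta> (\<lambda>v. \<omega> v (X v)) - \<omega> u (vf_bracket A X Y u))"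


section \<open>Lie algebras\<close>

definition lie_algebra :: "('l::real_vector \<Rightarrow> 'l \<Rightarrow> 'l) \<Rightarrow> bool" where
  "lie_algebra br \<longleftrightarrow> bilinear br \<and> (\<forall>x. br x x = 0) \<and>
     (\<forall>x y z. br x (br y z) + br y (br z x) + br z (br x y) = 0)"

definition lie_subalgebra :: "('l::real_vector \<Rightarrow> 'l \<Rightarrow> 'l) \<Rightarrow> 'l set \<Rightarrow> bool" where
  "lie_subalgebra br S \<longleftrightarrow> subspace S \<and> (\<forall>x\<in>S. \<forall>y\<in>S. br x y \<in> S)"

definition lie_ideal :: "('l::real_vector \<Rightarrow> 'l \<Rightarrow> 'l) \<Rightarrow> 'l set \<Rightarrow> 'l set \<Rightarrow> bool" where
  "lie_ideal br I S \<longleftrightarrow> subspace I \<and> I \<subseteq> S \<and> (\<forall>x\<in>S. \<forall>y\<in>I. br x y \<in> I)"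

definition bracket_span :: "('l::real_vector \<Rightarrow> 'l \<Rightarrow> 'l) \<Rightarrow> 'l set \<Rightarrow> 'l set \<Rightarrow> 'l set" where
  "bracket_span br S T = span {br x y | x y. x \<in> S \<and> y \<in> T}"

definition lie_solvable :: "('l::real_vector \<Rightarrow> 'l \<Rightarrow> 'l) \<Rightarrow> 'l set \<Rightarrow> bool" where
  "lie_solvable br S \<longleftrightarrow> (\<exists>n. ((\<lambda>T. bracket_span br T T) ^^ n) S = {0})"

definition lie_nilpotent :: "('l::real_vector \<Rightarrow> 'l \<Rightarrow> 'l) \<Rightarrow> 'l set \<Rightarrow> bool" where
  "lie_nilpotent br S \<longleftrightarrow> (\<exists>n. ((\<lambda>T. bracket_span br S T) ^^ n) S = {0})"

definition lie_semisimple :: "('l::real_vector \<Rightarrow> 'l \<Rightarrow> 'l) \<Rightarrow> bool" where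
  "lie_semisimple br \<longleftrightarrow> lie_algebra br \<and>
     (\<forall>I. lie_ideal br I UNIV \<and> lie_solvable br I \<longrightarrow> I = {0})"

text \<open>The sum of all nilpotent ideals of \<open>S\<close>, i.e. its largest nilpotent ideal.\<close>

definition nilradical :: "('l::real_vector \<Rightarrow> 'l \<Rightarrow> 'l) \<Rightarrow> 'l set \<Rightarrow> 'l set" where
  "nilradical br S = span (\<Union>{I. lie_ideal br I S \<and> lie_nilpotent br I})"

text \<open>
  The complexification, on pairs \<open>(x, y)\<close> standing for \<open>x + i y\<close>. Real and complex span
  of a set stable under multiplication by \<open>i\<close> coincide, so solvability of complex subalgebras is
  captured by \<^const>\<open>lie_solvable\<close>.
\<close>

definition cplx_bracket ::
  "('l::real_vector \<Rightarrow> 'l \<Rightarrow> 'l) \<Rightarrow> 'l \<times> 'l \<Rightarrow> 'l \<times> 'l \<Rightarrow> 'l \<times> 'l" where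
  "cplx_bracket br = (\<lambda>(x,y) (x',y'). (br x x' - br y y', br x y' + br y x'))"

definition cplx_subalgebra :: "('l::real_vector \<Rightarrow> 'l \<Rightarrow> 'l) \<Rightarrow> ('l \<times> 'l) set \<Rightarrow> bool" where
  "cplx_subalgebra br S \<longleftrightarrow> lie_subalgebra (cplx_bracket br) S \<and> (\<forall>(x,y)\<in>S. (-y, x) \<in> S)"

definition borel_subalgebra :: "('l::real_vector \<Rightarrow> 'l \<Rightarrow> 'l) \<Rightarrow> ('l \<times> 'l) set \<Rightarrow> bool" where
  "borel_subalgebra br b \<longleftrightarrow> cplx_subalgebra br b \<and> lie_solvable (cplx_bracket br) b \<and>
     (\<forall>S. cplx_subalgebra br S \<and> lie_solvable (cplx_bracket br) S \<and> b \<subseteq> S \<longrightarrow> S = b)"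

text \<open>
  A subalgebra of a real semisimple Lie algebra is parabolic if its complexification contains a Borel
  subalgebra. If the Lie algebra is complex and regarded as a real one, these are exactly its
  complex parabolic subalgebras, so both cases are covered.
\<close>

definition parabolic_subalgebra :: "('l::real_vector \<Rightarrow> 'l \<Rightarrow> 'l) \<Rightarrow> 'l set \<Rightarrow> bool" where
  "parabolic_subalgebra br p \<longleftrightarrow> lie_subalgebra br p \<and> (\<exists>b. borel_subalgebra br b \<and> b \<subseteq> p \<times> p)"


section \<open>Lie groups\<close>

text \<open>
  The Lie algebra of the group is a vector space \<open>'l\<close> with a bracket, together with an
  isomorphism \<^term>\<open>left_inv_vf\<close> onto the Lie algebra of left invariant vector fields. The group
  has the dimension of its Lie algebra, so its charts may be taken with values in \<open>'l\<close>.
\<close>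

record ('g, 'l) lie_grp = "'g monoid" +
  grp_atlas :: "('g, 'l) atlas"
  lie_br :: "'l \<Rightarrow> 'l \<Rightarrow> 'l"
  left_inv_vf :: "'l \<Rightarrow> 'g \<Rightarrow> 'g tangent"

definition left_invariant ::
  "('g::topological_space, 'l::euclidean_space, 'z) lie_grp_scheme \<Rightarrow> ('g \<Rightarrow> 'g tangent) \<Rightarrow> bool" where
  "left_invariant G X \<longleftrightarrow> smooth_vector_field (grp_atlas G) UNIV X \<and>
     (\<forall>g h f. X (g \<otimes>\<^bsub>G\<^esub> h) f = X h (\<lambda>x. f (g \<otimes>\<^bsub>G\<^esub> x)))"

definition lie_group ::
  "('g::{t2_space,second_countable_topology}, 'l::euclidean_space, 'z) lie_grp_scheme \<Rightarrow> bool" where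
  "lie_group G \<longleftrightarrow> group G \<and> carrier G = UNIV \<and> smooth_manifold (grp_atlas G) \<and>
     smooth_map (prod_atlas (grp_atlas G) (grp_atlas G)) (grp_atlas G) UNIV (\<lambda>(g,h). g \<otimes>\<^bsub>G\<^esub> h) \<and>
     smooth_map (grp_atlas G) (grp_atlas G) UNIV (\<lambda>g. inv\<^bsub>G\<^esub> g) \<and>
     lie_algebra (lie_br G) \<and>
     bij_betw (left_inv_vf G) UNIV {X. left_invariant G X} \<and>
     (\<forall>x y a b g f. left_inv_vf G (a *\<^sub>R x + b *\<^sub>R y) g f =
        a * left_inv_vf G x g f + b * left_inv_vf G y g f) \<and>
     (\<forall>x y. left_inv_vf G (lie_br G x y) =
        vf_bracket (grp_atlas G) (left_inv_vf G x) (left_inv_vf G y))"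

text \<open>\<open>one_param G c X\<close> says that \<open>c t = exp (t X)\<close>.\<close>

definition one_param ::
  "('g::topological_space, 'l::euclidean_space, 'z) lie_grp_scheme \<Rightarrow> (real \<Rightarrow> 'g) \<Rightarrow> 'l \<Rightarrow> bool" where
  "one_param G c X \<longleftrightarrow> smooth_map real_atlas (grp_atlas G) UNIV c \<and>
     (\<forall>s t. c (s + t) = c s \<otimes>\<^bsub>G\<^esub> c t) \<and>
     velocity (grp_atlas G) c = left_inv_vf G X \<one>\<^bsub>G\<^esub>"

definition exp_image ::
  "('g::topological_space, 'l::euclidean_space, 'z) lie_grp_scheme \<Rightarrow> 'l set \<Rightarrow> 'g set" where
  "exp_image G S = {c 1 | c X. X \<in> S \<and> one_param G c X}"

definition lie_alg_of ::
  "('g::topological_space, 'l::euclidean_space, 'z) lie_grp_scheme \<Rightarrow> 'g set \<Rightarrow> 'l set" where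
  "lie_alg_of G H = {X. \<exists>c. one_param G c X \<and> range c \<subseteq> H}"

definition Ad ::
  "('g::topological_space, 'l::euclidean_space, 'z) lie_grp_scheme \<Rightarrow> 'g \<Rightarrow> 'l \<Rightarrow> 'l" where
  "Ad G g X = (THE Y. \<forall>f. left_inv_vf G Y \<one>\<^bsub>G\<^esub> f =
     left_inv_vf G X \<one>\<^bsub>G\<^esub> (\<lambda>h. f (g \<otimes>\<^bsub>G\<^esub> h \<otimes>\<^bsub>G\<^esub> inv\<^bsub>G\<^esub> g)))"


section \<open>Nested parabolics and their representations\<close>

text \<open>
  \<^term>\<open>big_par\<close>, \<^term>\<open>small_par\<close> and \<^term>\<open>par_grp\<close> are \<open>\<pp>\<close>, \<open>\<qq>\<close> and \<open>P\<close>.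
  The quotient of \<open>\<pp>\<close> by its nilradical is represented by an arbitrary vector space \<open>'r\<close>
  with a linear map \<^term>\<open>quot\<close> that restricts to a surjection on \<open>\<pp>\<close> whose kernel is the
  nilradical (the values outside \<open>\<pp>\<close> are irrelevant).
\<close>

record ('g, 'l, 'r) nested_type = "('g, 'l) lie_grp" +
  big_par :: "'l set"
  small_par :: "'l set"
  par_grp :: "'g set"
  quot :: "'l \<Rightarrow> 'r"

definition big_nil :: "('g, 'l::euclidean_space, 'r) nested_type \<Rightarrow> 'l set" where
  "big_nil T = nilradical (lie_br T) (big_par T)"

definition nested_parabolic_type ::
  "('g::{t2_space,second_countable_topology}, 'l::euclidean_space, 'r::real_vector) nested_type \<Rightarrow> bool" where
  "nested_parabolic_type T \<longleftrightarrow> lie_group T \<and> lie_semisimple (lie_br T) \<and>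
     parabolic_subalgebra (lie_br T) (big_par T) \<and>
     parabolic_subalgebra (lie_br T) (small_par T) \<and> small_par T \<subseteq> big_par T \<and>
     subgroup (par_grp T) T \<and> closed (par_grp T) \<and> lie_alg_of T (par_grp T) = big_par T \<and>
     linear (quot T) \<and> quot T ` big_par T = UNIV \<and>
     (\<forall>x\<in>big_par T. quot T x = 0 \<longleftrightarrow> x \<in> big_nil T)"

text \<open>The structure group \<open>Q\<close>.\<close>

definition sub_grp :: "('g::topological_space, 'l::euclidean_space, 'r) nested_type \<Rightarrow> 'g set" where
  "sub_grp T = {g \<in> par_grp T. Ad T g ` small_par T = small_par T}"

text \<open>The map on the quotient that is induced by a function \<open>F\<close> on \<open>\<pp>\<close>.\<close>

definition descend :: "('g, 'l, 'r) nested_type \<Rightarrow> ('l \<Rightarrow> 'w) \<Rightarrow> 'r \<Rightarrow> 'w" where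
  "descend T F a = (THE w. \<forall>x\<in>big_par T. quot T x = a \<longrightarrow> w = F x)"

definition Ad_quot ::
  "('g::topological_space, 'l::euclidean_space, 'r) nested_type \<Rightarrow> 'g \<Rightarrow> 'r \<Rightarrow> 'r" where
  "Ad_quot T g = descend T (\<lambda>x. quot T (Ad T g x))"

definition br_quot :: "('g, 'l, 'r) nested_type \<Rightarrow> 'r \<Rightarrow> 'r \<Rightarrow> 'r" where
  "br_quot T a b = descend T (\<lambda>x. descend T (\<lambda>y. quot T (lie_br T x y)) b) a"

text \<open>The projection \<open>\<Pi>\<^sub>\<rho>\<close> to \<open>\<pp>/\<qq>\<close>, whose elements are cosets of \<open>\<qq>\<close>.\<close>

definition Pi_rho :: "('g, 'l::real_vector, 'r) nested_type \<Rightarrow> 'r \<Rightarrow> 'l set" where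
  "Pi_rho T a = {x + y | x y. x \<in> big_par T \<and> quot T x = a \<and> y \<in> small_par T}"

text \<open>A finite-dimensional representation of \<open>P\<close> on which \<open>exp(\<pp>\<^sub>+)\<close> acts trivially.\<close>

definition rel_tractor_rep ::
  "('g::topological_space, 'l::euclidean_space, 'r) nested_type \<Rightarrow>
   ('g \<Rightarrow> 'v::real_vector \<Rightarrow> 'v) \<Rightarrow> bool" where
  "rel_tractor_rep T R \<longleftrightarrow> fin_dim (UNIV :: 'v set) \<and>
     (\<forall>g\<in>par_grp T. linear (R g)) \<and> R \<one>\<^bsub>T\<^esub> = id \<and>
     (\<forall>g\<in>par_grp T. \<forall>h\<in>par_grp T. R (g \<otimes>\<^bsub>T\<^esub> h) = R g \<circ> R h) \<and>
     (\<forall>v. \<forall>l :: 'v \<Rightarrow> real. linear l \<longrightarrow>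
        smooth_map_on (grp_atlas T) real_atlas (par_grp T) (\<lambda>g. l (R g v))) \<and>
     (\<forall>g\<in>exp_image T (big_nil T). R g = id)"

text \<open>The derivative of the representation, and the induced action of \<open>\<pp>/\<pp>\<^sub>+\<close>.\<close>

definition inf_act ::
  "('g::topological_space, 'l::euclidean_space, 'r) nested_type \<Rightarrow>
   ('g \<Rightarrow> 'v::real_vector \<Rightarrow> 'v) \<Rightarrow> 'l \<Rightarrow> 'v \<Rightarrow> 'v" where
  "inf_act T R X v = (THE w. \<forall>c. one_param T c X \<and> range c \<subseteq> par_grp T \<longrightarrow>
     (\<forall>l :: 'v \<Rightarrow> real. linear l \<longrightarrow> ((\<lambda>t. l (R (c t) v)) has_real_derivative l w) (at 0)))"

definition act_quot ::
  "('g::topological_space, 'l::euclidean_space, 'r) nested_type \<Rightarrow>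
   ('g \<Rightarrow> 'v::real_vector \<Rightarrow> 'v) \<Rightarrow> 'r \<Rightarrow> 'v \<Rightarrow> 'v" where
  "act_quot T R a v = descend T (\<lambda>x. inf_act T R x v) a"


section \<open>Parabolic geometries\<close>

record ('u, 'x, 'g, 'l, 'b) geometry =
  tot_atlas :: "('u, 'l) atlas"
  base_atlas :: "('x, 'b) atlas"
  proj :: "'u \<Rightarrow> 'x"
  act :: "'u \<Rightarrow> 'g \<Rightarrow> 'u"
  conn :: "'u \<Rightarrow> 'u tangent \<Rightarrow> 'l"

definition principal_bundle ::
  "('g::{t2_space,second_countable_topology}, 'l::euclidean_space, 'z) lie_grp_scheme \<Rightarrow> 'g set \<Rightarrow>
   ('u::{t2_space,second_countable_topology}, 'x::{t2_space,second_countable_topology},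
    'g, 'l, 'b::real_normed_vector) geometry \<Rightarrow> bool" where
  "principal_bundle G Q E \<longleftrightarrow>
     smooth_manifold (tot_atlas E) \<and> smooth_manifold (base_atlas E) \<and>
     smooth_map (tot_atlas E) (base_atlas E) UNIV (proj E) \<and> surj (proj E) \<and>
     (\<forall>u. act E u \<one>\<^bsub>G\<^esub> = u) \<and>
     (\<forall>u. \<forall>g\<in>Q. \<forall>h\<in>Q. act E u (g \<otimes>\<^bsub>G\<^esub> h) = act E (act E u g) h) \<and>
     smooth_map_on (prod_atlas (tot_atlas E) (grp_atlas G)) (tot_atlas E) (UNIV \<times> Q)
       (\<lambda>(u,g). act E u g) \<and>
     (\<forall>u. \<forall>g\<in>Q. proj E (act E u g) = proj E u) \<and>
     (\<forall>x. \<exists>U \<tau>. open U \<and> x \<in> U \<and>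
        smooth_map (tot_atlas E) (grp_atlas G) (proj E -` U) \<tau> \<and>
        (\<forall>u\<in>proj E -` U. \<forall>g\<in>Q. \<tau> (act E u g) = \<tau> u \<otimes>\<^bsub>G\<^esub> g) \<and>
        bij_betw (\<lambda>u. (proj E u, \<tau> u)) (proj E -` U) (U \<times> Q) \<and>
        smooth_map_on (prod_atlas (base_atlas E) (grp_atlas G)) (tot_atlas E) (U \<times> Q)
          (inv_into (proj E -` U) (\<lambda>u. (proj E u, \<tau> u))))"

text \<open>
  A Cartan connection trivialises the tangent bundle, is equivariant for the principal right action
  (\<open>\<lambda>f. \<xi> (\<lambda>v. f (v \<cdot> g))\<close> is the image of \<open>\<xi>\<close> under the right translation by \<open>g\<close>),
  and reproduces the generators of fundamental vector fields.
\<close>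

definition cartan_connection ::
  "('g::topological_space, 'l::euclidean_space, 'z) lie_grp_scheme \<Rightarrow> 'g set \<Rightarrow> 'l set \<Rightarrow>
   ('u::topological_space, 'x, 'g, 'l, 'b) geometry \<Rightarrow> bool" where
  "cartan_connection G Q q E \<longleftrightarrow>
     smooth_one_form (tot_atlas E) (conn E) \<and>
     (\<forall>u. bij_betw (conn E u) (tangent_space (tot_atlas E) u) UNIV) \<and>
     (\<forall>u. \<forall>g\<in>Q. \<forall>\<xi>\<in>tangent_space (tot_atlas E) u.
        conn E (act E u g) (\<lambda>f. \<xi> (\<lambda>v. f (act E v g))) = Ad G (inv\<^bsub>G\<^esub> g) (conn E u \<xi>)) \<and>
     (\<forall>X\<in>q. \<forall>c. one_param G c X \<and> range c \<subseteq> Q \<longrightarrow>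
        (\<forall>u. conn E u (velocity (tot_atlas E) (\<lambda>t. act E u (c t))) = X))"

definition parabolic_geometry ::
  "('g::{t2_space,second_countable_topology}, 'l::euclidean_space, 'r::real_vector) nested_type \<Rightarrow>
   ('u::{t2_space,second_countable_topology}, 'x::{t2_space,second_countable_topology},
    'g, 'l, 'b::real_normed_vector) geometry \<Rightarrow> bool" where
  "parabolic_geometry T E \<longleftrightarrow>
     principal_bundle T (sub_grp T) E \<and> cartan_connection T (sub_grp T) (small_par T) E"

definition conn_inv :: "('u::topological_space, 'x, 'g, 'l::euclidean_space, 'b) geometry \<Rightarrow>
    'u \<Rightarrow> 'l \<Rightarrow> 'u tangent" where
  "conn_inv E u = inv_into (tangent_space (tot_atlas E) u) (conn E u)"

text \<open>
  The curvature, first as a two-form on the total space, then as the corresponding function with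
  values in alternating maps on \<open>\<gg>/\<qq>\<close>: a tangent vector at \<open>u\<close> represents the coset of
  its value under the Cartan connection.
\<close>

definition curv_form ::
  "('g, 'l, 'r) nested_type \<Rightarrow> ('u::topological_space, 'x, 'g, 'l::euclidean_space, 'b) geometry \<Rightarrow>
   'u \<Rightarrow> 'u tangent \<Rightarrow> 'u tangent \<Rightarrow> 'l" where
  "curv_form T E u \<xi> \<eta> =
     ext_deriv (tot_atlas E) (conn E) u \<xi> \<eta> + lie_br T (conn E u \<xi>) (conn E u \<eta>)"

definition kappa ::
  "('g, 'l, 'r) nested_type \<Rightarrow> ('u::topological_space, 'x, 'g, 'l::euclidean_space, 'b) geometry \<Rightarrow>
   'u \<Rightarrow> 'l set \<Rightarrow> 'l set \<Rightarrow> 'l" where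
  "kappa T E u C C' = (THE w. \<forall>\<xi>\<in>tangent_space (tot_atlas E) u. \<forall>\<eta>\<in>tangent_space (tot_atlas E) u.
     conn E u \<xi> \<in> C \<and> conn E u \<eta> \<in> C' \<longrightarrow> w = curv_form T E u \<xi> \<eta>)"


section \<open>Relative forms and the relative twisted exterior derivative\<close>

text \<open>
  Sections of the bundle associated to a representation are equivariant functions on the total space.
  The argument tuple \<open>(a\<^sub>0, \<dots>)\<close> of a form is a function on the naturals, of which a
  \<open>k\<close>-form only sees the first \<open>k\<close> entries.
\<close>

definition sections_A_rho ::
  "('g::topological_space, 'l::euclidean_space, 'r::real_vector) nested_type \<Rightarrow>
   ('u::topological_space, 'x, 'g, 'l, 'b) geometry \<Rightarrow> ('u \<Rightarrow> 'r) set" where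
  "sections_A_rho T E = {s. vsmooth_on (tot_atlas E) UNIV s \<and>
     (\<forall>u. \<forall>g\<in>sub_grp T. s (act E u g) = Ad_quot T (inv\<^bsub>T\<^esub> g) (s u))}"

definition alternating_multilinear ::
  "nat \<Rightarrow> ((nat \<Rightarrow> 'r::real_vector) \<Rightarrow> 'v::real_vector) \<Rightarrow> bool" where
  "alternating_multilinear k \<alpha> \<longleftrightarrow>
     (\<forall>a b. (\<forall>i<k. a i = b i) \<longrightarrow> \<alpha> a = \<alpha> b) \<and>
     (\<forall>a. \<forall>i<k. linear (\<lambda>x. \<alpha> (a(i := x)))) \<and>
     (\<forall>a. \<forall>i<k. \<forall>j<k. i \<noteq> j \<and> a i = a j \<longrightarrow> \<alpha> a = 0)"

type_synonym ('u, 'r, 'v) rel_form = "'u \<Rightarrow> (nat \<Rightarrow> 'r) \<Rightarrow> 'v"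

text \<open>Sections of the \<open>k\<close>-th exterior power of the dual of \<open>A\<^sub>\<rho>M\<close>, with values in the tractor bundle.\<close>

definition form_sections ::
  "('g::topological_space, 'l::euclidean_space, 'r::real_vector) nested_type \<Rightarrow>
   ('u::topological_space, 'x, 'g, 'l, 'b) geometry \<Rightarrow> ('g \<Rightarrow> 'v::real_vector \<Rightarrow> 'v) \<Rightarrow> nat \<Rightarrow>
   ('u, 'r, 'v) rel_form set" where
  "form_sections T E R k = {\<phi>.
     (\<forall>u. alternating_multilinear k (\<phi> u)) \<and>
     (\<forall>a. vsmooth_on (tot_atlas E) UNIV (\<lambda>u. \<phi> u a)) \<and>
     (\<forall>u a. \<forall>g\<in>sub_grp T. \<phi> (act E u g) a = R (inv\<^bsub>T\<^esub> g) (\<phi> u (\<lambda>i. Ad_quot T g (a i))))}"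

definition Omega_rho ::
  "('g::topological_space, 'l::euclidean_space, 'r::real_vector) nested_type \<Rightarrow>
   ('u::topological_space, 'x, 'g, 'l, 'b) geometry \<Rightarrow> ('g \<Rightarrow> 'v::real_vector \<Rightarrow> 'v) \<Rightarrow> nat \<Rightarrow>
   ('u, 'r, 'v) rel_form set" where
  "Omega_rho T E R k = {\<phi> \<in> form_sections T E R k.
     \<forall>u a. (\<exists>i<k. a i \<in> quot T ` small_par T) \<longrightarrow> \<phi> u a = 0}"

text \<open>
  The fundamental derivative \<open>D\<^sub>s\<phi>\<close> along a function \<open>s\<close> into \<open>\<gg>\<close>, i.e. along the
  vector field on the total space that the Cartan connection maps to \<open>s\<close>, and its relative version,
  using any lift of \<open>s(u)\<close> to \<open>\<pp>\<close>. Functions with values in multilinear maps are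
  differentiated by evaluating them on a fixed tuple first.
\<close>

definition fund_deriv ::
  "('u::topological_space, 'x, 'g, 'l::euclidean_space, 'b) geometry \<Rightarrow>
   ('u \<Rightarrow> 'l) \<Rightarrow> ('u, 'r, 'v::real_vector) rel_form \<Rightarrow> ('u, 'r, 'v) rel_form" where
  "fund_deriv E s \<phi> = (\<lambda>u a. vderiv (conn_inv E u (s u)) (\<lambda>v. \<phi> v a))"

definition rel_fund_deriv ::
  "('g, 'l, 'r) nested_type \<Rightarrow> ('u::topological_space, 'x, 'g, 'l::euclidean_space, 'b) geometry \<Rightarrow>
   ('u \<Rightarrow> 'r) \<Rightarrow> ('u, 'r, 'v::real_vector) rel_form \<Rightarrow> ('u, 'r, 'v) rel_form" where
  "rel_fund_deriv T E s \<phi> = (\<lambda>u a. descend T (\<lambda>x. fund_deriv E (\<lambda>_. x) \<phi> u a) (s u))"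

definition omit :: "nat \<Rightarrow> (nat \<Rightarrow> 'a) \<Rightarrow> nat \<Rightarrow> 'a" where
  "omit i a = (\<lambda>m. if m < i then a m else a (Suc m))"

text \<open>
  The defining formula of the relative twisted exterior derivative of a \<open>k\<close>-form \<open>\<phi>\<close>, for
  sections \<open>s\<^sub>0, \<dots>, s\<^sub>k\<close>. For \<open>i < j\<close> the tuple \<open>omit i (omit j s)\<close> lacks the
  entries \<open>i\<close> and \<open>j\<close> of \<open>s\<close>; \<open>case_nat b a\<close> is the tuple \<open>(b, a\<^sub>0, a\<^sub>1, \<dots>)\<close>.
\<close>

definition twisted_d_formula ::
  "('g::topological_space, 'l::euclidean_space, 'r) nested_type \<Rightarrow>
   ('u::topological_space, 'x, 'g, 'l, 'b) geometry \<Rightarrow> ('g \<Rightarrow> 'v::real_vector \<Rightarrow> 'v) \<Rightarrow> nat \<Rightarrow>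
   ('u, 'r, 'v) rel_form \<Rightarrow> (nat \<Rightarrow> 'u \<Rightarrow> 'r) \<Rightarrow> 'u \<Rightarrow> 'v" where
  "twisted_d_formula T E R k \<phi> s u =
     (\<Sum>i\<le>k. (-1) ^ i *\<^sub>R rel_fund_deriv T E (s i) \<phi> u (\<lambda>m. omit i s m u)) +
     (\<Sum>i\<le>k. (-1) ^ i *\<^sub>R act_quot T R (s i u) (\<phi> u (\<lambda>m. omit i s m u))) +
     (\<Sum>j\<le>k. \<Sum>i<j. (-1) ^ (i + j) *\<^sub>R
        \<phi> u (case_nat (br_quot T (s i u) (s j u)) (\<lambda>m. omit i (omit j s) m u)))"

text \<open>
  The formula at \<open>u\<close> only involves the values of the sections at \<open>u\<close>, so the form it defines can
  be evaluated on a tuple in \<open>\<pp>/\<pp>\<^sub>+\<close> by inserting functions that are constant on the total space.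
\<close>

definition twisted_d ::
  "('g::topological_space, 'l::euclidean_space, 'r) nested_type \<Rightarrow>
   ('u::topological_space, 'x, 'g, 'l, 'b) geometry \<Rightarrow> ('g \<Rightarrow> 'v::real_vector \<Rightarrow> 'v) \<Rightarrow> nat \<Rightarrow>
   ('u, 'r, 'v) rel_form \<Rightarrow> ('u, 'r, 'v) rel_form" where
  "twisted_d T E R k \<phi> = (\<lambda>u a. twisted_d_formula T E R k \<phi> (\<lambda>i _. a i) u)"

lemma twisted_d_on_sections:
  fixes s :: "nat \<Rightarrow> 'u::topological_space \<Rightarrow> 'r"
  shows "twisted_d T E R k \<phi> u (\<lambda>i. s i u) = twisted_d_formula T E R k \<phi> s u"
proof -
  have "omit i (\<lambda>m (_::'u). s m u) m u = omit i s m u" for i m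
    by (simp add: omit_def)
  moreover have "omit i (omit j (\<lambda>m (_::'u). s m u)) m u = omit i (omit j s) m u" for i j m
    by (simp add: omit_def)
  ultimately show ?thesis
    by (simp add: twisted_d_def twisted_d_formula_def rel_fund_deriv_def)
qed

end

theory Submission
  imports Defs "HOL-Library.Function_Algebras"
begin

text \<open>
  Evaluated on constant arguments, the twisted exterior derivative is the Chevalley--Eilenberg
  differential for the operators \<open>\<nabla>\<^sub>a = D\<^sub>a + a \<bullet>\<close> on smooth functions
  \<open>\<G> \<rightarrow> V\<close>, where \<open>a \<in> \<pp>/\<pp>\<^sub>+\<close> is lifted to \<open>\<pp>\<close> and
  differentiates along the field on which \<open>\<omega>\<close> is constant. These operators need not represent
  the Lie algebra: by Cartan's formula the square of the differential is given by the defect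
  \<open>F(a,b) = [\<nabla>\<^sub>a, \<nabla>\<^sub>b] - \<nabla>\<^bsub>[a,b]\<^esub>\<close>. The algebraic parts cancel since
  \<open>V\<close> is a representation, and \<open>\<omega>([X,Y]) = [\<omega>(X),\<omega>(Y)] - \<kappa>(X,Y)\<close> for constant fields leaves
  \<open>F(a,b) = - D\<^bsub>\<kappa>(a,b)\<^esub>\<close>. That \<open>\<kappa>\<close> is horizontal, and that \<open>\<pp>\<^sub>+\<close> acts
  trivially on forms, follows by differentiating the equivariance along one-parameter subgroups; these
  lie in \<open>Q\<close> because \<open>\<pp>\<^sub>+\<close> is contained in \<open>\<qq>\<close>.
\<close>

section \<open>Chevalley--Eilenberg differential of a connection\<close>

text \<open>Two obstacles shape the argument. A form evaluated on a fixed tuple is a smooth function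
  on the total space that need not be equivariant. So the algebraic calculus runs on all smooth
  functions, and equivariance is recovered only for a form as a whole. Moreover, exponentials enter
  only as one-parameter subgroups, and these are at hand just for elements of \<pp>, which by
  hypothesis is the set of generators of such subgroups inside P. Hence neither flows nor Ad(exp x)
  = exp(ad x) is used. Derivatives of Ad and of constant fields are read off from mixed partial
  derivatives of products of such curves, and invariance of a subspace under Ad comes from
  uniqueness for a linear differential equation. The inclusion of the nilradical of \<pp> in \<qq>
  comes from maximality of a Borel subalgebra inside the complexification of \<qq>. Quotients,
  derivatives and curvature are all definite descriptions, so each needs a proof of existence and
  uniqueness before it can be computed.\<close>

lemma case_nat_upd: "case_nat x (a(i := y)) = (case_nat x a)(Suc i := y)"
  by (auto simp: fun_eq_iff split: nat.split)

lemma case_nat_upd0: "(case_nat x a)(0 := y) = case_nat y a"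
  by (auto simp: fun_eq_iff split: nat.split)

lemma case_nat_surj: "case_nat (a 0) (\<lambda>m. a (Suc m)) = a"
  by (auto simp: fun_eq_iff split: nat.split)

lemma omit_0_case_nat: "omit 0 (case_nat x a) = a"
  by (auto simp: omit_def fun_eq_iff)

lemma omit_Suc_case_nat: "omit (Suc i) (case_nat x a) = case_nat x (omit i a)"
  by (auto simp: omit_def fun_eq_iff split: nat.split)

lemmas case_nat_omit = omit_0_case_nat omit_Suc_case_nat

section \<open>Alternating multilinear maps on tuples\<close>

lemma alternating_multilinear_cong:
  "alternating_multilinear k \<alpha> \<Longrightarrow> (\<And>i. i < k \<Longrightarrow> a i = b i) \<Longrightarrow> \<alpha> a = \<alpha> b"
  by (auto simp: alternating_multilinear_def)

lemma alternating_multilinear_linear: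
  "alternating_multilinear k \<alpha> \<Longrightarrow> i < k \<Longrightarrow> linear (\<lambda>x. \<alpha> (a(i := x)))"
  by (auto simp: alternating_multilinear_def)

lemma alternating_multilinear_zero:
  "alternating_multilinear k \<alpha> \<Longrightarrow> i < k \<Longrightarrow> j < k \<Longrightarrow> i \<noteq> j \<Longrightarrow> a i = a j \<Longrightarrow> \<alpha> a = 0"
  by (auto simp: alternating_multilinear_def)

text \<open>Polarisation: with \<open>x + y\<close> in both slots the value is 0, and so are the two
  diagonal terms of its expansion.\<close>

lemma alternating_multilinear_swap:
  assumes \<alpha>: "alternating_multilinear k \<alpha>" and "i < k" "j < k" "i \<noteq> j"
  shows "\<alpha> (a(i := y, j := x)) = - \<alpha> (a(i := x, j := y))"
proof -
  have j: "\<alpha> (b(j := u + v)) = \<alpha> (b(j := u)) + \<alpha> (b(j := v))" for b u v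
    using linear_add[OF alternating_multilinear_linear[OF \<alpha> \<open>j < k\<close>]] by blast
  have i: "\<alpha> (a(i := u + v, j := w)) = \<alpha> (a(i := u, j := w)) + \<alpha> (a(i := v, j := w))" for u v w
    using linear_add[OF alternating_multilinear_linear[OF \<alpha> \<open>i < k\<close>, of "a(j := w)"]] \<open>i \<noteq> j\<close>
    by (simp add: fun_upd_twist)
  have z: "\<alpha> (a(i := u, j := u)) = 0" for u
    using alternating_multilinear_zero[OF \<alpha> assms(2-4)] \<open>i \<noteq> j\<close> by simp
  have "\<alpha> (a(i := x + y, j := x + y)) = \<alpha> (a(i := x, j := y)) + \<alpha> (a(i := y, j := x))"
    unfolding i j z by simp
  then show ?thesis
    unfolding z by (simp add: eq_neg_iff_add_eq_0 add.commute)
qed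

text \<open>Moving the front entry to slot \<open>j\<close> passes \<open>j\<close> other entries.
  In the induction \<open>y\<close> is first moved to slot \<open>j\<close> of the tuple whose entry
  \<open>a j\<close> has been copied to slot \<open>Suc j\<close>, and one transposition finishes.
  This is what turns the bracket terms of the differential into those of a Lie derivative.\<close>

lemma alternating_multilinear_move:
  fixes \<alpha> :: "(nat \<Rightarrow> 'a::real_vector) \<Rightarrow> 'b::real_vector"
  assumes \<alpha>: "alternating_multilinear k \<alpha>" and "j < k"
  shows "\<alpha> (case_nat y (omit j a)) = (-1) ^ j *\<^sub>R \<alpha> (a(j := y))"
  using \<open>j < k\<close>
proof (induction j arbitrary: a)
  case 0
  have "case_nat y (omit 0 a) = a(0 := y)"
    by (auto simp: omit_def fun_eq_iff split: nat.split)
  then show ?case by simp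
next
  case (Suc j)
  have sgn: "(-1) ^ j *\<^sub>R (- x) = (-1) ^ Suc j *\<^sub>R x" for x :: 'b
    by simp
  have eq: "case_nat y (omit (Suc j) a) = case_nat y (omit j (a(Suc j := a j)))"
    by (auto simp: omit_def fun_eq_iff less_Suc_eq split: nat.split)
  have "\<alpha> (case_nat y (omit (Suc j) a)) = (-1) ^ j *\<^sub>R \<alpha> (a(Suc j := a j, j := y))"
    unfolding eq using Suc.prems by (intro Suc.IH) simp
  also have "a(Suc j := a j, j := y) = a(j := y, Suc j := a j)"
    by (rule fun_upd_twist) simp
  also have "\<alpha> (a(j := y, Suc j := a j)) = - \<alpha> (a(j := a j, Suc j := y))"
    using Suc.prems by (intro alternating_multilinear_swap[OF \<alpha>]) auto
  finally show ?case
    unfolding fun_upd_triv sgn .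
qed

lemma alternating_multilinear_case_nat_swap:
  assumes \<alpha>: "alternating_multilinear (Suc (Suc k)) \<alpha>"
  shows "\<alpha> (case_nat x (case_nat y a)) = - \<alpha> (case_nat y (case_nat x a))"
proof -
  have eq: "case_nat u (case_nat v a) = (case_nat x (case_nat y a))(0 := u, Suc 0 := v)" for u v
    by (auto simp: fun_eq_iff split: nat.split)
  show ?thesis
    using alternating_multilinear_swap[OF \<alpha>, of 0 "Suc 0" "case_nat x (case_nat y a)" x y]
    unfolding eq[symmetric] by simp
qed

section \<open>Interior products and the Cartan calculus of a connection\<close>

definition contr :: "'r \<Rightarrow> ((nat \<Rightarrow> 'r) \<Rightarrow> 'w) \<Rightarrow> (nat \<Rightarrow> 'r) \<Rightarrow> 'w" where
  "contr x \<phi> a = \<phi> (case_nat x a)"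

lemma alternating_multilinear_contr:
  assumes "alternating_multilinear (Suc k) \<phi>"
  shows "alternating_multilinear k (contr x \<phi>)"
  unfolding alternating_multilinear_def contr_def
proof (intro conjI allI impI)
  show "\<phi> (case_nat x a) = \<phi> (case_nat x b)" if "\<forall>i<k. a i = b i" for a b
    using that by (intro alternating_multilinear_cong[OF assms]) (auto split: nat.split)
  show "linear (\<lambda>y. \<phi> (case_nat x (a(i := y))))" if "i < k" for a i
    using that alternating_multilinear_linear[OF assms, of "Suc i"] by (simp add: case_nat_upd)
  show "\<phi> (case_nat x a) = 0" if "i < k" "j < k" "i \<noteq> j \<and> a i = a j" for a i j
    using that by (intro alternating_multilinear_zero[OF assms, of "Suc i" "Suc j"]) auto
qed

text \<open>Contractions see every slot but the first. Since they are alternating, any later entry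
  that equals \<open>a 0\<close> can be brought next to it, so a repetition in the two leading slots
  is the only new case. This is the form in which alternation of the differential can be proved by
  induction on the degree.\<close>

lemma alternating_multilinear_SucI:
  assumes cong: "\<And>a b. (\<And>i. i < Suc k \<Longrightarrow> a i = b i) \<Longrightarrow> \<alpha> a = \<alpha> b"
    and lin: "\<And>a. linear (\<lambda>x. \<alpha> (case_nat x a))"
    and contr: "\<And>x. alternating_multilinear k (contr x \<alpha>)"
    and zero: "\<And>x a. 0 < k \<Longrightarrow> \<alpha> (case_nat x (case_nat x a)) = 0"
  shows "alternating_multilinear (Suc k) \<alpha>"
  unfolding alternating_multilinear_def
proof (intro conjI allI impI)
  show "\<alpha> a = \<alpha> b" if "\<forall>i<Suc k. a i = b i" for a b
    using that cong by blast
  show "linear (\<lambda>x. \<alpha> (a(i := x)))" if "i < Suc k" for a i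
  proof (cases i)
    case 0
    then show ?thesis
      using lin[of "\<lambda>m. a (Suc m)"] by (metis (no_types, lifting) case_nat_surj case_nat_upd0 ext)
  next
    case (Suc i')
    then have "(\<lambda>x. \<alpha> (a(i := x))) = (\<lambda>x. contr (a 0) \<alpha> ((\<lambda>m. a (Suc m))(i' := x)))"
      by (simp add: contr_def case_nat_upd case_nat_surj)
    then show ?thesis
      using alternating_multilinear_linear[OF contr] that Suc by simp
  qed
  have z0: "\<alpha> a = 0" if "j < k" "a 0 = a (Suc j)" for a j
  proof -
    define b where "b = (\<lambda>m. a (Suc m))"
    have a: "a = case_nat (a 0) b"
      by (simp add: b_def case_nat_surj)
    have "0 < k" using that by simp
    have "contr (a 0) \<alpha> c = 0" if "c 0 = a 0" for c
      using zero[OF \<open>0 < k\<close>, of "a 0" "\<lambda>m. c (Suc m)"] case_nat_surj[of c] that by (simp add: contr_def)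
    then have "contr (a 0) \<alpha> (b(0 := b j, j := b 0)) = 0"
      using that by (simp add: b_def)
    \<comment> \<open>Exchanging slots 0 and \<open>j\<close> is the identity if
      \<open>j = 0\<close> and a transposition otherwise, hence the two signs.\<close>
    moreover have "contr (a 0) \<alpha> (b(0 := b j, j := b 0)) = (if j = 0 then 1 else -1) *\<^sub>R contr (a 0) \<alpha> b"
      using alternating_multilinear_swap[OF contr \<open>0 < k\<close> \<open>j < k\<close>, of "a 0" b "b j" "b 0"]
      by (auto simp: fun_upd_idem)
    ultimately show ?thesis
      by (subst a) (simp add: contr_def split: if_splits)
  qed
  show "\<alpha> a = 0" if "i < Suc k" "j < Suc k" "i \<noteq> j \<and> a i = a j" for a i j
  proof (cases "i = 0 \<or> j = 0")
    case True
    then show ?thesis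
      using that z0[of "i - 1" a] z0[of "j - 1" a] by (cases i; cases j) auto
  next
    case False
    then obtain i' j' where ij: "i = Suc i'" "j = Suc j'"
      by (meson not0_implies_Suc)
    have "contr (a 0) \<alpha> (\<lambda>m. a (Suc m)) = 0"
      using that ij by (intro alternating_multilinear_zero[OF contr, of i' j']) auto
    then show ?thesis
      by (simp add: contr_def case_nat_surj)
  qed
qed

lemma alternating_bilinear_minus:
  assumes "bilinear br" "\<And>x. br x x = 0"
  shows "br x y = - br y x"
proof -
  have "br x y + br y x = 0"
    using assms(2)[of "x + y"]
    by (simp add: bilinear_ladd[OF assms(1)] bilinear_radd[OF assms(1)] assms(2)[of x] assms(2)[of y] add.commute)
  then show ?thesis
    by (simp only: eq_neg_iff_add_eq_0)
qed

text \<open>\<open>nab\<close> is not assumed to respect \<open>br\<close>; its failure to do so is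
  \<open>curv\<close>. The subspace \<open>W\<close> is needed because differentiation is linear
  only on differentiable functions, while \<open>'w\<close> will be the type of all functions on the
  total space.\<close>

locale ce_connection =
  fixes br :: "'r::real_vector \<Rightarrow> 'r \<Rightarrow> 'r" and W :: "'w::real_vector set" and nab :: "'r \<Rightarrow> 'w \<Rightarrow> 'w"
  assumes bilinear_br: "bilinear br" and br_self: "br x x = 0"
    and jacobi: "br x (br y z) + br y (br z x) + br z (br x y) = 0"
    and subspace_W: "subspace W" and nab_W: "f \<in> W \<Longrightarrow> nab x f \<in> W"
    and nab_add: "f \<in> W \<Longrightarrow> g \<in> W \<Longrightarrow> nab x (f + g) = nab x f + nab x g"
    and nab_scale: "f \<in> W \<Longrightarrow> nab x (c *\<^sub>R f) = c *\<^sub>R nab x f"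
    and linear_nab: "f \<in> W \<Longrightarrow> linear (\<lambda>x. nab x f)"
begin

lemma br_minus: "br x y = - br y x"
  by (rule alternating_bilinear_minus[OF bilinear_br br_self])

lemma linear_br: "linear (br x)" "linear (\<lambda>x. br x y)"
  using bilinear_br by (auto simp: bilinear_def)

definition form :: "nat \<Rightarrow> ((nat \<Rightarrow> 'r) \<Rightarrow> 'w) \<Rightarrow> bool" where
  "form k \<phi> \<longleftrightarrow> alternating_multilinear k \<phi> \<and> (\<forall>a. \<phi> a \<in> W)"

lemma formD: "form k \<phi> \<Longrightarrow> alternating_multilinear k \<phi>" "form k \<phi> \<Longrightarrow> \<phi> a \<in> W"
  by (auto simp: form_def)

lemma form_contr: "form (Suc k) \<phi> \<Longrightarrow> form k (contr x \<phi>)"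
  by (simp add: form_def alternating_multilinear_contr) (simp add: contr_def)

lemma nab_0: "nab x 0 = 0"
  using nab_scale[of 0 x 0] subspace_0[OF subspace_W] by simp

lemma nab_diff: "f \<in> W \<Longrightarrow> g \<in> W \<Longrightarrow> nab x (f - g) = nab x f - nab x g"
  using nab_add[of f "- g" x] nab_scale[of g x "-1"] subspace_neg[OF subspace_W] by simp

lemma linear_nab_comp:
  assumes "linear f" "\<And>y. f y \<in> W"
  shows "linear (\<lambda>y. nab x (f y))"
  using assms by (intro linearI) (auto simp: linear_add linear_scale nab_add nab_scale)

definition d :: "nat \<Rightarrow> ((nat \<Rightarrow> 'r) \<Rightarrow> 'w) \<Rightarrow> (nat \<Rightarrow> 'r) \<Rightarrow> 'w" where
  "d k \<phi> a = (\<Sum>i\<le>k. (-1) ^ i *\<^sub>R nab (a i) (\<phi> (omit i a))) +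
     (\<Sum>j\<le>k. \<Sum>i<j. (-1) ^ (i + j) *\<^sub>R \<phi> (case_nat (br (a i) (a j)) (omit i (omit j a))))"

text \<open>The Lie derivative of the Cartan calculus. On a representation it would be the natural
  action of \<open>x\<close> on cochains.\<close>

definition lie :: "nat \<Rightarrow> 'r \<Rightarrow> ((nat \<Rightarrow> 'r) \<Rightarrow> 'w) \<Rightarrow> (nat \<Rightarrow> 'r) \<Rightarrow> 'w" where
  "lie k x \<phi> a = nab x (\<phi> a) - (\<Sum>j<k. \<phi> (a(j := br x (a j))))"

definition curv :: "'r \<Rightarrow> 'r \<Rightarrow> 'w \<Rightarrow> 'w" where
  "curv x y f = nab x (nab y f) - nab y (nab x f) - nab (br x y) f"

lemma d_W: "form k \<phi> \<Longrightarrow> d k \<phi> a \<in> W"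
  unfolding d_def using formD(2)
  by (intro subspace_add[OF subspace_W] subspace_sum[OF subspace_W] subspace_scale[OF subspace_W] nab_W) auto

lemma lie_W: "form k \<phi> \<Longrightarrow> lie k x \<phi> a \<in> W"
  unfolding lie_def using formD(2)
  by (intro subspace_diff[OF subspace_W] subspace_sum[OF subspace_W] nab_W) auto

lemma d_0: "d 0 \<phi> (case_nat x a) = nab x (\<phi> a)"
  by (simp add: d_def case_nat_omit)

lemma lie_0: "lie 0 x \<phi> a = nab x (\<phi> a)"
  by (simp add: lie_def)

text \<open>Cartan's formula: the contraction of the differential is the Lie derivative minus the
  differential of the contraction. Splitting off index 0 isolates \<open>nab x\<close> and the
  brackets with \<open>x\<close>, which make up the Lie derivative after
  \<open>alternating_multilinear_move\<close>. In the remaining double sum \<open>x\<close> stands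
  behind a bracket, and exchanging the two gives the minus sign.\<close>

lemma d_contr:
  assumes \<phi>: "form (Suc k) \<phi>"
  shows "d (Suc k) \<phi> (case_nat x a) = lie (Suc k) x \<phi> a - d k (contr x \<phi>) a"
proof -
  have "(\<Sum>i\<le>Suc k. (-1) ^ i *\<^sub>R nab (case_nat x a i) (\<phi> (omit i (case_nat x a)))) =
      nab x (\<phi> a) - (\<Sum>i\<le>k. (-1) ^ i *\<^sub>R nab (a i) (contr x \<phi> (omit i a)))"
    by (simp add: sum.atMost_Suc_shift case_nat_omit contr_def sum_negf del: sum.atMost_Suc)
  moreover have "(\<Sum>j\<le>Suc k. \<Sum>i<j. (-1) ^ (i + j) *\<^sub>R \<phi> (case_nat (br (case_nat x a i) (case_nat x a j))
        (omit i (omit j (case_nat x a))))) =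
      (\<Sum>j\<le>k. (-1) ^ Suc j *\<^sub>R \<phi> (case_nat (br x (a j)) (omit j a))) +
      (\<Sum>j\<le>k. \<Sum>i<j. (-1) ^ (i + j) *\<^sub>R \<phi> (case_nat (br (a i) (a j)) (case_nat x (omit i (omit j a)))))"
    by (simp add: sum.atMost_Suc_shift sum.lessThan_Suc_shift case_nat_omit sum.distrib
        sum_subtractf sum_negf del: sum.atMost_Suc sum.lessThan_Suc)
  moreover have "(\<Sum>j\<le>k. (-1) ^ Suc j *\<^sub>R \<phi> (case_nat (br x (a j)) (omit j a))) =
      - (\<Sum>j<Suc k. \<phi> (a(j := br x (a j))))"
    unfolding lessThan_Suc_atMost sum_negf[symmetric]
    using alternating_multilinear_move[OF formD(1)[OF \<phi>]]
    by (intro sum.cong) (auto simp flip: power_add mult_2)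
  moreover have "(\<Sum>j\<le>k. \<Sum>i<j. (-1) ^ (i + j) *\<^sub>R
        \<phi> (case_nat (br (a i) (a j)) (case_nat x (omit i (omit j a))))) =
      - (\<Sum>j\<le>k. \<Sum>i<j. (-1) ^ (i + j) *\<^sub>R contr x \<phi> (case_nat (br (a i) (a j)) (omit i (omit j a))))"
  \<comment> \<open>The exchange of the two leading entries needs degree at least 2; for
    \<open>k = 0\<close> the double sum is empty.\<close>
  proof (cases k)
    case (Suc k')
    then have "\<phi> (case_nat y (case_nat x b)) = - contr x \<phi> (case_nat y b)" for y b
      unfolding contr_def using alternating_multilinear_case_nat_swap formD(1)[OF \<phi>] by blast
    then show ?thesis
      by (simp add: sum_negf)
  qed auto
  ultimately show ?thesis
    by (simp add: d_def lie_def)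
qed

text \<open>The commutator of a Lie derivative with a contraction is the contraction with the
  bracket: it is the term of the sum in which the bracket hits the contracted slot.\<close>

lemma contr_lie:
  assumes \<phi>: "form (Suc k) \<phi>"
  shows "lie (Suc k) x \<phi> (case_nat y a) = lie k x (contr y \<phi>) a - \<phi> (case_nat (br x y) a)"
  by (simp add: lie_def contr_def sum.lessThan_Suc_shift case_nat_upd case_nat_upd0 del: sum.lessThan_Suc)

lemma form_lie:
  assumes \<phi>: "form k \<phi>"
  shows "form k (lie k x \<phi>)"
proof -
  note alt = formD(1)[OF \<phi>] and W = formD(2)[OF \<phi>]
  have "alternating_multilinear k (lie k x \<phi>)"
    unfolding alternating_multilinear_def
  proof (intro conjI allI impI)
    show "lie k x \<phi> a = lie k x \<phi> b" if "\<forall>i<k. a i = b i" for a b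
    proof -
      have "\<phi> (a(j := br x (a j))) = \<phi> (b(j := br x (b j)))" if "j < k" for j
        using that \<open>\<forall>i<k. a i = b i\<close> by (intro alternating_multilinear_cong[OF alt]) auto
      then show ?thesis
        using alternating_multilinear_cong[OF alt, of a b] that by (simp add: lie_def)
    qed
    show "linear (\<lambda>y. lie k x \<phi> (a(i := y)))" if "i < k" for a i
      unfolding lie_def
    proof (intro linear_compose_sub linear_compose_sum ballI linear_nab_comp)
      show "linear (\<lambda>y. \<phi> (a(i := y)))"
        by (rule alternating_multilinear_linear[OF alt that])
      show "linear (\<lambda>y. \<phi> (a(i := y, j := br x ((a(i := y)) j))))" if "j \<in> {..<k}" for j
      proof (cases "j = i")
        case True
        then show ?thesis
          using linear_compose[OF linear_br(1) alternating_multilinear_linear[OF alt \<open>i < k\<close>]]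
          by (simp add: o_def)
      next
        case False
        then show ?thesis
          using alternating_multilinear_linear[OF alt \<open>i < k\<close>, of "a(j := br x (a j))"]
          by (simp add: fun_upd_twist)
      qed
    qed (use W in auto)
    show "lie k x \<phi> a = 0" if ij: "i < k" "j < k" "i \<noteq> j \<and> a i = a j" for a i j
    proof -
      \<comment> \<open>All terms with \<open>m\<close> different from \<open>i\<close> and
        \<open>j\<close> still have two equal entries. The two that survive differ by a
        transposition and cancel.\<close>
      have "(\<Sum>m<k. \<phi> (a(m := br x (a m)))) = (\<Sum>m\<in>{i,j}. \<phi> (a(m := br x (a m))))"
        using ij by (intro sum.mono_neutral_right)
          (auto intro!: alternating_multilinear_zero[OF alt, of i j])
      also have "\<dots> = \<phi> (a(i := br x (a i), j := a i)) + \<phi> (a(i := a i, j := br x (a i)))"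
      proof -
        have "a(i := br x (a i), j := a i) = a(i := br x (a i))" "a(i := a i, j := br x (a i)) = a(j := br x (a j))"
          using ij by (auto simp: fun_eq_iff)
        with ij show ?thesis by simp
      qed
      also have "\<dots> = 0"
        using alternating_multilinear_swap[OF alt, of i j a "br x (a i)" "a i"] ij by simp
      finally show ?thesis
        using alternating_multilinear_zero[OF alt, of i j a] ij by (simp add: lie_def nab_0)
    qed
  qed
  with lie_W[OF \<phi>] show ?thesis
    by (simp add: form_def)
qed

lemma d_linear:
  assumes "\<And>x. form k (\<phi> x)" "\<And>a. linear (\<lambda>x. \<phi> x a)"
  shows "linear (\<lambda>x. d k (\<phi> x) a)"
  unfolding d_def using assms
  by (intro linear_compose_add linear_compose_sum ballI linear_compose_scale_right linear_nab_comp)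
    (auto dest: formD)

lemma d_diff:
  assumes "form k \<phi>" "form k \<psi>"
  shows "d k (\<lambda>a. \<phi> a - \<psi> a) a = d k \<phi> a - d k \<psi> a"
  using formD(2)[OF assms(1)] formD(2)[OF assms(2)]
  by (simp add: d_def nab_diff scaleR_diff_right sum_subtractf)

lemma d_eq_0: "(\<And>b. \<phi> b = 0) \<Longrightarrow> d k \<phi> a = 0"
  by (simp add: d_def nab_0)

lemma linear_case_nat:
  assumes \<phi>: "alternating_multilinear (Suc k) \<phi>"
  shows "linear (\<lambda>x. \<phi> (case_nat x a))"
  using alternating_multilinear_linear[OF \<phi>, of 0 "case_nat undefined a"] by (simp add: case_nat_upd0)

lemma d_cong:
  assumes \<phi>: "form k \<phi>" and eq: "\<And>i. i < Suc k \<Longrightarrow> a i = b i"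
  shows "d k \<phi> a = d k \<phi> b"
proof -
  have "\<phi> (omit i a) = \<phi> (omit i b)" if "i \<le> k" for i
    using that eq by (intro alternating_multilinear_cong[OF formD(1)[OF \<phi>]]) (auto simp: omit_def)
  moreover have "\<phi> (case_nat (br (a i) (a j)) (omit i (omit j a))) =
      \<phi> (case_nat (br (b i) (b j)) (omit i (omit j b)))" if "j \<le> k" "i < j" for i j
    using that eq by (intro alternating_multilinear_cong[OF formD(1)[OF \<phi>]]) (auto simp: omit_def split: nat.split)
  ultimately show ?thesis
    unfolding d_def using eq by (intro arg_cong2[where f = "(+)"] sum.cong) auto
qed

text \<open>By \<open>d_contr\<close> a contraction of the differential is a difference of two
  forms, alternating by \<open>form_lie\<close> and by the induction hypothesis. What remains is the
  repetition of the first argument, which amounts to the double contraction of the differential with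
  \<open>x\<close> being 0.\<close>

lemma form_d: "form k \<phi> \<Longrightarrow> form (Suc k) (d k \<phi>)"
proof (induction k arbitrary: \<phi>)
  case 0
  have const: "\<phi> a = \<phi> b" for a b
    using alternating_multilinear_cong[OF formD(1)[OF 0]] by blast
  have "alternating_multilinear (Suc 0) (d 0 \<phi>)"
  proof (rule alternating_multilinear_SucI)
    show "alternating_multilinear 0 (contr x (d 0 \<phi>))" for x
    proof -
      have "nab x (\<phi> a) = nab x (\<phi> b)" for a b
        by (rule arg_cong[OF const])
      then show ?thesis
        by (simp add: alternating_multilinear_def contr_def d_0)
    qed
    show "linear (\<lambda>x. d 0 \<phi> (case_nat x a))" for a
      unfolding d_0 by (rule linear_nab[OF formD(2)[OF 0]])
  qed (rule d_cong[OF 0], simp_all)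
  with d_W[OF 0] show ?case
    by (simp add: form_def)
next
  case (Suc k)
  note \<phi> = Suc.prems
  have c: "contr x (d (Suc k) \<phi>) = (\<lambda>a. lie (Suc k) x \<phi> a - d k (contr x \<phi>) a)" for x
    by (simp add: contr_def[of x "d _ _"] d_contr[OF \<phi>] fun_eq_iff)
  have "alternating_multilinear (Suc (Suc k)) (d (Suc k) \<phi>)"
  proof (rule alternating_multilinear_SucI)
    show "linear (\<lambda>x. d (Suc k) \<phi> (case_nat x a))" for a
      unfolding d_contr[OF \<phi>]
    proof (intro linear_compose_sub d_linear)
      show "linear (\<lambda>x. lie (Suc k) x \<phi> a)"
        unfolding lie_def
      proof (intro linear_compose_sub linear_nab linear_compose_sum ballI)
        show "linear (\<lambda>x. \<phi> (a(j := br x (a j))))" if "j \<in> {..<Suc k}" for j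
          using linear_compose[OF linear_br(2) alternating_multilinear_linear[OF formD(1)[OF \<phi>]]] that
          unfolding o_def by blast
      qed (use formD(2)[OF \<phi>] in auto)
      show "linear (\<lambda>x. contr x \<phi> b)" for b
        unfolding contr_def by (rule linear_case_nat[OF formD(1)[OF \<phi>]])
    qed (rule form_contr[OF \<phi>])
    show "alternating_multilinear (Suc k) (contr x (d (Suc k) \<phi>))" for x
    proof -
      have "alternating_multilinear (Suc k) (lie (Suc k) x \<phi>)" "alternating_multilinear (Suc k) (d k (contr x \<phi>))"
        using form_lie[OF \<phi>] Suc.IH[OF form_contr[OF \<phi>]] formD by blast+
      then show ?thesis
        unfolding c alternating_multilinear_def
        by (intro conjI allI impI linear_compose_sub arg_cong2[where f = "(-)"])
          (simp_all only: simp_thms diff_self)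
    qed
    \<comment> \<open>Contracting \<open>d k (contr x \<phi>)\<close> with \<open>x\<close> leaves
      only the Lie derivative of \<open>contr x \<phi>\<close>, since the double contraction of
      \<open>\<phi>\<close> vanishes. By \<open>contr_lie\<close> and \<open>br x x = 0\<close> the
      contraction of the Lie derivative of \<open>\<phi>\<close> is the same term.\<close>
    show "d (Suc k) \<phi> (case_nat x (case_nat x a)) = 0" for x a
    proof -
      have "d k (contr x \<phi>) (case_nat x a) = lie k x (contr x \<phi>) a"
      proof (cases k)
        case 0
        then show ?thesis by (simp add: d_0 lie_0)
      next
        case (Suc k')
        have "contr x (contr x \<phi>) b = 0" for b
          unfolding contr_def
          by (rule alternating_multilinear_zero[OF formD(1)[OF \<phi>], of 0 1]) (use Suc in auto)
        then have "d k' (contr x (contr x \<phi>)) a = 0"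
          by (rule d_eq_0)
        then show ?thesis
          using d_contr form_contr[OF \<phi>, of x] Suc by simp
      qed
      moreover have "\<phi> (case_nat (br x x) a) = 0"
        using linear_0[OF linear_case_nat[OF formD(1)[OF \<phi>]]] by (simp add: br_self)
      ultimately show ?thesis
        using d_contr[OF \<phi>] contr_lie[OF \<phi>] by simp
    qed
  qed (rule d_cong[OF \<phi>])
  with d_W[OF \<phi>] show ?case
    by (simp add: form_def)
qed

lemma lie_diff:
  assumes "form k \<phi>" "form k \<psi>"
  shows "lie k x (\<lambda>a. \<phi> a - \<psi> a) a = lie k x \<phi> a - lie k x \<psi> a"
  using formD(2)[OF assms(1)] formD(2)[OF assms(2)]
  by (simp add: lie_def nab_diff sum_subtractf)

text \<open>On 0-forms this is the definition of \<open>curv\<close>. Contraction with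
  \<open>z\<close> lowers the degree, and the terms with a bracket in the first slot that it leaves
  behind cancel by the Jacobi identity. So the curvature acts on the values alone.\<close>

lemma lie_commutator:
  "form k \<phi> \<Longrightarrow> lie k x (lie k y \<phi>) a - lie k y (lie k x \<phi>) a - lie k (br x y) \<phi> a = curv x y (\<phi> a)"
proof (induction k arbitrary: \<phi> a)
  case 0
  then show ?case by (simp add: lie_0 curv_def)
next
  case (Suc k)
  note \<phi> = Suc.prems
  obtain z b where a: "a = case_nat z b"
    using case_nat_surj by metis
  have *: "lie (Suc k) x (lie (Suc k) y \<phi>) (case_nat z b) = lie k x (lie k y (contr z \<phi>)) b
      - lie k x (contr (br y z) \<phi>) b - (lie k y (contr (br x z) \<phi>) b - \<phi> (case_nat (br y (br x z)) b))" for x y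
  proof -
    have "contr z (lie (Suc k) y \<phi>) = (\<lambda>b. lie k y (contr z \<phi>) b - contr (br y z) \<phi> b)"
      by (simp add: contr_def[of z "lie _ _ _"] contr_lie[OF \<phi>] fun_eq_iff) (simp add: contr_def)
    then show ?thesis
      using contr_lie[OF form_lie[OF \<phi>]] contr_lie[OF \<phi>] lie_diff form_lie form_contr[OF \<phi>]
      by (simp add: contr_lie[OF form_lie[OF \<phi>]])
  qed
  have lin: "linear (\<lambda>x. \<phi> (case_nat x b))"
    by (rule linear_case_nat[OF formD(1)[OF \<phi>]])
  have "br y (br x z) - br x (br y z) + br (br x y) z = 0"
    using jacobi[of x y z] br_minus[of z "br x y"] br_minus[of x z] linear_neg[OF linear_br(1), of y "br z x"]
    by (simp add: algebra_simps)
  then have "\<phi> (case_nat (br y (br x z)) b) - \<phi> (case_nat (br x (br y z)) b) + \<phi> (case_nat (br (br x y) z) b) = 0"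
    using linear_0[OF lin] by (simp flip: linear_add[OF lin] linear_diff[OF lin])
  moreover have "lie k x (lie k y (contr z \<phi>)) b - lie k y (lie k x (contr z \<phi>)) b - lie k (br x y) (contr z \<phi>) b
      = curv x y (contr z \<phi> b)"
    by (rule Suc.IH[OF form_contr[OF \<phi>]])
  ultimately show ?case
    unfolding a * contr_lie[OF \<phi>] contr_def[of z \<phi> b] by (simp add: algebra_simps)
qed

text \<open>Were \<open>nab\<close> a representation, Lie derivatives would commute with the
  differential. Contracting the commutator with \<open>z\<close> gives the commutator of two Lie
  derivatives, which is a curvature term, minus the same expression for
  \<open>contr z \<phi>\<close> in one degree less.\<close>

lemma lie_d_commutator:
  "form k \<phi> \<Longrightarrow> lie (Suc k) x (d k \<phi>) a - d k (lie k x \<phi>) a =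
     (\<Sum>j\<le>k. (-1) ^ j *\<^sub>R curv x (a j) (\<phi> (omit j a)))"
proof (induction k arbitrary: \<phi> a)
  case 0
  obtain z b where a: "a = case_nat z b"
    using case_nat_surj by metis
  show ?case
    unfolding a using contr_lie[OF form_d[OF 0]]
    by (simp add: d_0 lie_0 curv_def case_nat_omit contr_def)
next
  case (Suc k)
  note \<phi> = Suc.prems
  obtain z b where a: "a = case_nat z b"
    using case_nat_surj by metis
  have "contr z (d (Suc k) \<phi>) = (\<lambda>b. lie (Suc k) z \<phi> b - d k (contr z \<phi>) b)"
    by (simp add: contr_def[of z "d _ _"] d_contr[OF \<phi>] fun_eq_iff)
  then have 1: "lie (Suc (Suc k)) x (d (Suc k) \<phi>) (case_nat z b) =
      lie (Suc k) x (lie (Suc k) z \<phi>) b - lie (Suc k) x (d k (contr z \<phi>)) b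
      - (lie (Suc k) (br x z) \<phi> b - d k (contr (br x z) \<phi>) b)"
    using contr_lie[OF form_d[OF \<phi>]] lie_diff form_lie[OF \<phi>] form_d[OF form_contr[OF \<phi>]] d_contr[OF \<phi>]
    by simp
  have "contr z (lie (Suc k) x \<phi>) = (\<lambda>b. lie k x (contr z \<phi>) b - contr (br x z) \<phi> b)"
    by (simp add: contr_def[of z "lie _ _ _"] contr_lie[OF \<phi>] fun_eq_iff) (simp add: contr_def)
  then have 2: "d (Suc k) (lie (Suc k) x \<phi>) (case_nat z b) =
      lie (Suc k) z (lie (Suc k) x \<phi>) b - (d k (lie k x (contr z \<phi>)) b - d k (contr (br x z) \<phi>) b)"
    using d_contr[OF form_lie[OF \<phi>]] d_diff form_lie form_contr[OF \<phi>] by simp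
  \<comment> \<open>\<open>m\<close> stands for \<open>d k (contr (br x z) \<phi>) b\<close>, which
    occurs in both 1 and 2 and cancels.\<close>
  have alg: "p - l - (r - m) - (q - (l' - m)) = (p - q - r) - (l - l')" for p q r l l' m :: 'w
    by simp
  have 3: "(\<Sum>j\<le>Suc k. (-1) ^ j *\<^sub>R curv x (case_nat z b j) (\<phi> (omit j (case_nat z b)))) =
      curv x z (\<phi> b) - (\<Sum>j\<le>k. (-1) ^ j *\<^sub>R curv x (b j) (contr z \<phi> (omit j b)))"
    by (simp add: sum.atMost_Suc_shift case_nat_omit contr_def sum_negf del: sum.atMost_Suc)
  show ?case
    unfolding a 1 2 3 unfolding alg unfolding Suc.IH[OF form_contr[OF \<phi>]] lie_commutator[OF \<phi>]
    by (rule refl)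
qed

text \<open>Two applications of \<open>d_contr\<close> show that contracting the squared
  differential with \<open>x\<close> gives the commutator of the Lie derivative with the
  differential plus the squared differential of \<open>contr x \<phi>\<close>. The commutator
  supplies the pairs with \<open>i = 0\<close>, the induction hypothesis all others. The extra
  \<open>Suc\<close> in the exponent is the sign with which \<open>curv x\<close> enters the
  commutator: the pair (0, \<open>Suc j\<close>) carries the sign of \<open>j\<close>.\<close>

lemma d_d:
  "form k \<phi> \<Longrightarrow> d (Suc k) (d k \<phi>) a =
     (\<Sum>j\<le>Suc k. \<Sum>i<j. (-1) ^ Suc (i + j) *\<^sub>R curv (a i) (a j) (\<phi> (omit i (omit j a))))"
proof (induction k arbitrary: \<phi> a)
  case 0
  obtain x b where a: "a = case_nat x b"
    using case_nat_surj by metis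
  have "contr x (d 0 \<phi>) = lie 0 x \<phi>"
    by (simp add: fun_eq_iff contr_def d_0 lie_0)
  then show ?case
    unfolding a using d_contr[OF form_d[OF 0]] lie_d_commutator[OF 0, of x b]
    by (simp add: case_nat_omit)
next
  case (Suc k)
  note \<phi> = Suc.prems
  obtain x b where a: "a = case_nat x b"
    using case_nat_surj by metis
  have "contr x (d (Suc k) \<phi>) = (\<lambda>b. lie (Suc k) x \<phi> b - d k (contr x \<phi>) b)"
    by (simp add: contr_def[of x "d _ _"] d_contr[OF \<phi>] fun_eq_iff)
  then have "d (Suc (Suc k)) (d (Suc k) \<phi>) (case_nat x b) =
      lie (Suc (Suc k)) x (d (Suc k) \<phi>) b - (d (Suc k) (lie (Suc k) x \<phi>) b - d (Suc k) (d k (contr x \<phi>)) b)"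
    using d_contr[OF form_d[OF \<phi>]] d_diff form_lie[OF \<phi>] form_d[OF form_contr[OF \<phi>]] by simp
  also have "\<dots> = (\<Sum>j\<le>Suc k. (-1) ^ j *\<^sub>R curv x (b j) (\<phi> (omit j b))) + d (Suc k) (d k (contr x \<phi>)) b"
    using lie_d_commutator[OF \<phi>, of x b] by (simp add: algebra_simps)
  also have "\<dots> = (\<Sum>j\<le>Suc (Suc k). \<Sum>i<j. (-1) ^ Suc (i + j) *\<^sub>R
      curv (case_nat x b i) (case_nat x b j) (\<phi> (omit i (omit j (case_nat x b)))))"
    unfolding Suc.IH[OF form_contr[OF \<phi>]]
    by (simp add: sum.atMost_Suc_shift sum.lessThan_Suc_shift case_nat_omit sum.distrib contr_def
        del: sum.atMost_Suc sum.lessThan_Suc)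
  finally show ?case
    unfolding a .
qed

end


section \<open>Smooth functions on normed spaces\<close>

text \<open>\<open>frechet_derivative\<close> is a Hilbert choice, so it is determined by the set of
  derivatives. Functions with the same germ share that set, even if it is empty.\<close>

lemma frechet_derivative_cong_open:
  assumes "open S" "x \<in> S" "\<And>y. y \<in> S \<Longrightarrow> f y = g y"
  shows "frechet_derivative f (at x) = frechet_derivative g (at x)"
proof -
  have "(f has_derivative D) (at x) = (g has_derivative D) (at x)" for D
    using assms has_derivative_transform_within_open[of _ D x UNIV S] by metis
  then show ?thesis
    by (simp add: frechet_derivative_def)
qed

lemma Ck_on_subset: "Ck_on n S f \<Longrightarrow> T \<subseteq> S \<Longrightarrow> Ck_on n T f"
  by (induction n arbitrary: f) (auto intro: continuous_on_subset)

lemma Ck_on_Suc_imp: "Ck_on (Suc n) S f \<Longrightarrow> Ck_on n S f"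
proof (induction n arbitrary: f)
  case 0
  then show ?case
    by (auto intro!: continuous_at_imp_continuous_on differentiable_imp_continuous_within)
next
  case (Suc n)
  then show ?case by (metis Ck_on.simps(2))
qed

lemma Ck_on_cong:
  assumes "Ck_on n S f" "open S" "\<And>x. x \<in> S \<Longrightarrow> f x = g x"
  shows "Ck_on n S g"
  using assms(1,3)
proof (induction n arbitrary: f g)
  case 0
  then show ?case by (simp cong: continuous_on_cong)
next
  case (Suc n)
  show ?case
    unfolding Ck_on.simps
  proof (intro conjI ballI allI)
    fix x assume x: "x \<in> S"
    with Suc.prems obtain D where "(f has_derivative D) (at x)"
      by (auto simp: differentiable_def)
    then have "(g has_derivative D) (at x)"
      using has_derivative_transform_within_open[of f D x UNIV S g] x assms(2) Suc.prems by auto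
    then show "g differentiable (at x)"
      by (auto simp: differentiable_def)
  next
    fix v
    show "Ck_on n S (\<lambda>x. frechet_derivative g (at x) v)"
    proof (rule Suc.IH)
      show "Ck_on n S (\<lambda>x. frechet_derivative f (at x) v)"
        using Suc.prems(1) by simp
      show "frechet_derivative f (at x) v = frechet_derivative g (at x) v" if "x \<in> S" for x
        using frechet_derivative_cong_open[OF assms(2) that Suc.prems(2)] by simp
    qed
  qed
qed

text \<open>Replaces the chosen derivative by an explicit formula, so that regularity proofs become
  inductions over derivative formulas.\<close>

lemma Ck_on_SucI:
  assumes "open S" "\<And>x. x \<in> S \<Longrightarrow> (f has_derivative f' x) (at x)" "\<And>v. Ck_on n S (\<lambda>x. f' x v)"
  shows "Ck_on (Suc n) S f"
  unfolding Ck_on.simps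
proof (intro conjI ballI allI)
  show "Ck_on n S (\<lambda>x. frechet_derivative f (at x) v)" for v
    by (rule Ck_on_cong[OF assms(3)[of v] assms(1)]) (simp add: frechet_derivative_at[OF assms(2), symmetric])
qed (use assms(2) in \<open>auto simp: differentiable_def\<close>)

lemma Ck_on_SucD:
  assumes "Ck_on (Suc n) S f"
  shows "x \<in> S \<Longrightarrow> (f has_derivative frechet_derivative f (at x)) (at x)"
    and "Ck_on n S (\<lambda>x. frechet_derivative f (at x) v)"
  using assms by (auto simp flip: frechet_derivative_works)

lemma Ck_on_local:
  assumes "\<And>x. x \<in> S \<Longrightarrow> \<exists>T. open T \<and> x \<in> T \<and> Ck_on n T f"
  shows "Ck_on n S f"
  using assms
proof (induction n arbitrary: f)
  case 0
  show ?case
    unfolding Ck_on.simps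
  proof (intro continuous_at_imp_continuous_on ballI)
    fix x assume "x \<in> S"
    with 0 obtain T where "open T" "x \<in> T" "Ck_on 0 T f" by blast
    then show "isCont f x"
      using continuous_on_eq_continuous_at by auto
  qed
next
  case (Suc n)
  have "\<exists>T. open T \<and> x \<in> T \<and> Ck_on n T (\<lambda>x. frechet_derivative f (at x) v)" if "x \<in> S" for x v
    using Suc.prems[OF that] by auto
  then show ?case
    using Suc.prems Suc.IH by fastforce
qed

lemma Ck_on_const: "open S \<Longrightarrow> Ck_on n S (\<lambda>x. c)"
  by (induction n arbitrary: c) (auto intro!: Ck_on_SucI[where f' = "\<lambda>_ _. 0"] simp del: Ck_on.simps(2))

lemma Ck_on_bounded_linear_comp:
  assumes L: "bounded_linear L" and "open S"
  shows "Ck_on n S f \<Longrightarrow> Ck_on n S (\<lambda>x. L (f x))"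
proof (induction n arbitrary: f)
  case 0
  then show ?case
    using bounded_linear.continuous_on[OF L] by simp
next
  case (Suc n)
  show ?case
    using bounded_linear.has_derivative[OF L Ck_on_SucD(1)[OF Suc.prems]] Suc.IH[OF Ck_on_SucD(2)[OF Suc.prems]]
    by (rule Ck_on_SucI[OF \<open>open S\<close>])
qed

lemma Ck_on_id: "open S \<Longrightarrow> Ck_on n S (\<lambda>x. x)"
  by (cases n) (auto intro!: Ck_on_SucI[where f' = "\<lambda>_ v. v"] Ck_on_const simp del: Ck_on.simps(2))

lemma Ck_on_add:
  assumes "open S"
  shows "Ck_on n S f \<Longrightarrow> Ck_on n S g \<Longrightarrow> Ck_on n S (\<lambda>x. f x + g x)"
proof (induction n arbitrary: f g)
  case 0
  then show ?case by (auto intro: continuous_on_add)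
next
  case (Suc n)
  note f = Ck_on_SucD[OF Suc.prems(1)] and g = Ck_on_SucD[OF Suc.prems(2)]
  show ?case
    by (rule Ck_on_SucI[OF assms has_derivative_add[OF f(1) g(1)] Suc.IH[OF f(2) g(2)]])
qed

lemma Ck_on_scaleR:
  fixes f :: "_ \<Rightarrow> real"
  assumes "open S"
  shows "Ck_on n S f \<Longrightarrow> Ck_on n S g \<Longrightarrow> Ck_on n S (\<lambda>x. f x *\<^sub>R g x)"
proof (induction n arbitrary: f g)
  case 0
  then show ?case by (auto intro: continuous_on_scaleR)
next
  case (Suc n)
  note f = Ck_on_SucD[OF Suc.prems(1)] and g = Ck_on_SucD[OF Suc.prems(2)]
  show ?case
    by (rule Ck_on_SucI[OF assms has_derivative_scaleR[OF f(1) g(1)]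
        Ck_on_add[OF assms Suc.IH[OF Ck_on_Suc_imp[OF Suc.prems(1)] g(2)]
          Suc.IH[OF f(2) Ck_on_Suc_imp[OF Suc.prems(2)]]]])
qed

lemma Ck_on_sum:
  assumes "open S" "\<And>i. i \<in> I \<Longrightarrow> Ck_on n S (f i)"
  shows "Ck_on n S (\<lambda>x. \<Sum>i\<in>I. f i x)"
  using assms(2) by (induction I rule: infinite_finite_induct) (auto intro: Ck_on_const Ck_on_add assms(1))

lemma Ck_on_componentwise:
  fixes f :: "_ \<Rightarrow> 'b::euclidean_space"
  assumes "open S" "\<And>b. b \<in> Basis \<Longrightarrow> Ck_on n S (\<lambda>x. f x \<bullet> b)"
  shows "Ck_on n S f"
proof -
  have "Ck_on n S (\<lambda>x. \<Sum>b\<in>Basis. (f x \<bullet> b) *\<^sub>R b)"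
    using assms by (intro Ck_on_sum Ck_on_scaleR Ck_on_const)
  then show ?thesis
    by (simp add: euclidean_representation)
qed

lemma linear_euclidean_expansion:
  fixes f :: "'a::euclidean_space \<Rightarrow> 'b::real_vector"
  assumes "linear f"
  shows "f w = (\<Sum>b\<in>Basis. (w \<bullet> b) *\<^sub>R f b)"
proof -
  have "f w = f (\<Sum>b\<in>Basis. (w \<bullet> b) *\<^sub>R b)"
    by (simp only: euclidean_representation)
  also have "\<dots> = (\<Sum>b\<in>Basis. (w \<bullet> b) *\<^sub>R f b)"
    by (simp only: linear_sum[OF assms] linear_scale[OF assms])
  finally show ?thesis .
qed

text \<open>\<open>Ck_on\<close> differentiates in fixed directions, whereas the chain rule
  differentiates \<open>g\<close> in a direction that moves with the point. Expanding that direction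
  in an orthonormal basis gives a finite sum of products to which the induction hypothesis applies.
  This is why the middle space is euclidean.\<close>

lemma Ck_on_compose:
  fixes f :: "'a::real_normed_vector \<Rightarrow> 'b::euclidean_space" and g :: "'b \<Rightarrow> 'c::real_normed_vector"
  assumes "open S" "f ` S \<subseteq> T"
  shows "Ck_on n S f \<Longrightarrow> Ck_on n T g \<Longrightarrow> Ck_on n S (\<lambda>x. g (f x))"
proof (induction n arbitrary: g)
  case 0
  then show ?case
    using assms(2) by (auto intro: continuous_on_compose2)
next
  case (Suc n)
  note f = Ck_on_SucD[OF Suc.prems(1)] and g = Ck_on_SucD[OF Suc.prems(2)]
  show ?case
  proof (rule Ck_on_SucI[OF \<open>open S\<close>])
    fix x assume x: "x \<in> S"
    then have fx: "f x \<in> T" using assms(2) by blast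
    have "linear (frechet_derivative g (at (f x)))"
      using g(1)[OF fx] has_derivative_linear by blast
    then have eq: "(\<lambda>v. \<Sum>b\<in>Basis. (frechet_derivative f (at x) v \<bullet> b) *\<^sub>R frechet_derivative g (at (f x)) b) =
        (\<lambda>v. frechet_derivative g (at (f x)) (frechet_derivative f (at x) v))"
      by (intro ext linear_euclidean_expansion[symmetric])
    show "((\<lambda>x. g (f x)) has_derivative (\<lambda>v. \<Sum>b\<in>Basis.
        (frechet_derivative f (at x) v \<bullet> b) *\<^sub>R frechet_derivative g (at (f x)) b)) (at x)"
      unfolding eq by (rule has_derivative_compose[OF f(1)[OF x] g(1)[OF fx]])
  next
    fix v
    show "Ck_on n S (\<lambda>x. \<Sum>b\<in>Basis.
        (frechet_derivative f (at x) v \<bullet> b) *\<^sub>R frechet_derivative g (at (f x)) b)"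
      using Suc.IH[OF Ck_on_Suc_imp[OF Suc.prems(1)] g(2)]
      by (intro Ck_on_sum Ck_on_scaleR Ck_on_bounded_linear_comp[OF bounded_linear_inner_left] f(2) \<open>open S\<close>)
  qed
qed

lemma smooth_onD:
  assumes "smooth_on S f"
  shows "x \<in> S \<Longrightarrow> (f has_derivative frechet_derivative f (at x)) (at x)"
    and "smooth_on S (\<lambda>x. frechet_derivative f (at x) v)"
    and "continuous_on S f"
proof -
  have *: "Ck_on n S f" for n
    using assms by (simp add: smooth_on_def)
  show "(f has_derivative frechet_derivative f (at x)) (at x)" if "x \<in> S"
    using Ck_on_SucD(1)[OF *[of "Suc 0"] that] .
  show "smooth_on S (\<lambda>x. frechet_derivative f (at x) v)"
    unfolding smooth_on_def using Ck_on_SucD(2)[OF *] by blast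
  show "continuous_on S f"
    using *[of 0] by simp
qed

lemma smooth_on_subset: "smooth_on S f \<Longrightarrow> T \<subseteq> S \<Longrightarrow> smooth_on T f"
  unfolding smooth_on_def using Ck_on_subset by blast

lemma smooth_on_cong: "smooth_on S f \<Longrightarrow> open S \<Longrightarrow> (\<And>x. x \<in> S \<Longrightarrow> f x = g x) \<Longrightarrow> smooth_on S g"
  unfolding smooth_on_def using Ck_on_cong by blast

lemma smooth_on_local:
  "(\<And>x. x \<in> S \<Longrightarrow> \<exists>T. open T \<and> x \<in> T \<and> smooth_on T f) \<Longrightarrow> smooth_on S f"
  unfolding smooth_on_def using Ck_on_local by meson

lemma smooth_on_const: "open S \<Longrightarrow> smooth_on S (\<lambda>x. c)"
  by (simp add: smooth_on_def Ck_on_const)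

lemma smooth_on_id: "open S \<Longrightarrow> smooth_on S (\<lambda>x. x)"
  by (simp add: smooth_on_def Ck_on_id)

lemma smooth_on_bounded_linear_comp:
  "bounded_linear L \<Longrightarrow> open S \<Longrightarrow> smooth_on S f \<Longrightarrow> smooth_on S (\<lambda>x. L (f x))"
  by (simp add: smooth_on_def Ck_on_bounded_linear_comp)

lemma smooth_on_add: "open S \<Longrightarrow> smooth_on S f \<Longrightarrow> smooth_on S g \<Longrightarrow> smooth_on S (\<lambda>x. f x + g x)"
  by (simp add: smooth_on_def Ck_on_add)

lemma smooth_on_scaleR:
  "open S \<Longrightarrow> smooth_on S f \<Longrightarrow> smooth_on S g \<Longrightarrow> smooth_on S (\<lambda>x. (f x :: real) *\<^sub>R g x)"
  by (simp add: smooth_on_def Ck_on_scaleR)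

lemma smooth_on_mult:
  "open S \<Longrightarrow> smooth_on S f \<Longrightarrow> smooth_on S g \<Longrightarrow> smooth_on S (\<lambda>x. f x * g x :: real)"
  using smooth_on_scaleR[of S f g] by simp

lemma smooth_on_componentwise:
  "open S \<Longrightarrow> (\<And>b. b \<in> Basis \<Longrightarrow> smooth_on S (\<lambda>x. f x \<bullet> b)) \<Longrightarrow> smooth_on S (f :: _ \<Rightarrow> 'b::euclidean_space)"
  by (simp add: smooth_on_def Ck_on_componentwise)

lemma smooth_on_compose:
  fixes f :: "'a::real_normed_vector \<Rightarrow> 'b::euclidean_space" and g :: "'b \<Rightarrow> 'c::real_normed_vector"
  shows "open S \<Longrightarrow> f ` S \<subseteq> T \<Longrightarrow> smooth_on S f \<Longrightarrow> smooth_on T g \<Longrightarrow> smooth_on S (\<lambda>x. g (f x))"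
  unfolding smooth_on_def using Ck_on_compose by blast

lemma smooth_on_Pair:
  assumes "open S" "smooth_on S f" "smooth_on S g"
  shows "smooth_on S (\<lambda>x. (f x, g x))"
proof -
  have "smooth_on S (\<lambda>x. (f x, 0) + (0, g x))"
    using assms
    by (intro smooth_on_add smooth_on_bounded_linear_comp[of "\<lambda>a. (a, 0)"] smooth_on_bounded_linear_comp[of "\<lambda>a. (0, a)"])
      (auto intro!: bounded_linear_Pair bounded_linear_ident bounded_linear_zero)
  then show ?thesis by simp
qed

lemma linear_lincombI:
  assumes "\<And>a b x y. f (a *\<^sub>R x + b *\<^sub>R y) = a *\<^sub>R f x + b *\<^sub>R f y"
  shows "linear f"
  using assms[of 1 _ 1] assms[of _ _ 0 0] by (intro linearI) auto

section \<open>Symmetry of mixed second derivatives\<close>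

lemma has_real_derivative_of_has_derivative:
  fixes f :: "real \<Rightarrow> real"
  assumes "(f has_derivative D) (at t)"
  shows "(f has_real_derivative D 1) (at t)"
proof (rule has_derivative_imp_has_field_derivative[OF assms])
  show "x * D 1 = D x" for x
    using linear_scale[OF has_derivative_linear[OF assms], of x 1] by simp
qed

lemma has_real_derivative_along_line:
  fixes g :: "'a::real_normed_vector \<Rightarrow> real"
  assumes "(g has_derivative D) (at (q + t *\<^sub>R v))"
  shows "((\<lambda>s. g (q + s *\<^sub>R v)) has_real_derivative D v) (at t)"
proof -
  have "((\<lambda>s. q + s *\<^sub>R v) has_derivative (\<lambda>h. h *\<^sub>R v)) (at t)"
    by (auto intro!: derivative_eq_intros)
  from has_real_derivative_of_has_derivative[OF has_derivative_compose[OF this assms]]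
  show ?thesis by simp
qed

text \<open>The mean value theorem, applied in the direction \<open>v\<close> and then in the
  direction \<open>w\<close>. The second difference on the left is symmetric in \<open>v\<close> and
  \<open>w\<close>, which is what makes the formula useful.\<close>

lemma second_difference_mean_value:
  fixes f :: "'a::real_normed_vector \<Rightarrow> real"
  assumes f: "smooth_on S f" and h: "0 < h" and S: "\<And>s t. 0 \<le> s \<Longrightarrow> s \<le> h \<Longrightarrow> 0 \<le> t \<Longrightarrow> t \<le> h \<Longrightarrow> x + s *\<^sub>R v + t *\<^sub>R w \<in> S"
  obtains s t where "0 < s" "s < h" "0 < t" "t < h"
    "f (x + h *\<^sub>R v + h *\<^sub>R w) - f (x + h *\<^sub>R v) - f (x + h *\<^sub>R w) + f x =
      h\<^sup>2 * frechet_derivative (\<lambda>y. frechet_derivative f (at y) v) (at (x + s *\<^sub>R v + t *\<^sub>R w)) w"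
proof -
  let ?D = "\<lambda>f y. frechet_derivative f (at y)"
  have ds: "((\<lambda>s. g (x + s *\<^sub>R v + t *\<^sub>R w)) has_real_derivative ?D g (x + s *\<^sub>R v + t *\<^sub>R w) v) (at s)"
    if "0 \<le> s" "s \<le> h" "0 \<le> t" "t \<le> h" "smooth_on S g" for g :: "'a \<Rightarrow> real" and s t
    using has_real_derivative_along_line[of g "?D g (x + s *\<^sub>R v + t *\<^sub>R w)" "x + t *\<^sub>R w" s v]
      smooth_onD(1)[OF that(5) S[OF that(1-4)]] by (simp add: add_ac)
  have dt: "((\<lambda>t. g (x + s *\<^sub>R v + t *\<^sub>R w)) has_real_derivative ?D g (x + s *\<^sub>R v + t *\<^sub>R w) w) (at t)"
    if "0 \<le> s" "s \<le> h" "0 \<le> t" "t \<le> h" "smooth_on S g" for g :: "'a \<Rightarrow> real" and s t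
    by (rule has_real_derivative_along_line[OF smooth_onD(1)[OF that(5) S[OF that(1-4)]]])
  have "((\<lambda>s. f (x + s *\<^sub>R v + h *\<^sub>R w) - f (x + s *\<^sub>R v + 0 *\<^sub>R w)) has_real_derivative
      ?D f (x + s *\<^sub>R v + h *\<^sub>R w) v - ?D f (x + s *\<^sub>R v + 0 *\<^sub>R w) v) (at s)" if "0 \<le> s" "s \<le> h" for s
    using that h f by (intro DERIV_diff ds) auto
  then obtain s where s: "0 < s" "s < h" and 1:
    "(f (x + h *\<^sub>R v + h *\<^sub>R w) - f (x + h *\<^sub>R v + 0 *\<^sub>R w)) - (f (x + 0 *\<^sub>R v + h *\<^sub>R w) - f (x + 0 *\<^sub>R v + 0 *\<^sub>R w)) =
      (h - 0) * (?D f (x + s *\<^sub>R v + h *\<^sub>R w) v - ?D f (x + s *\<^sub>R v + 0 *\<^sub>R w) v)"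
    using MVT2[OF h, of "\<lambda>s. f (x + s *\<^sub>R v + h *\<^sub>R w) - f (x + s *\<^sub>R v + 0 *\<^sub>R w)"
        "\<lambda>s. ?D f (x + s *\<^sub>R v + h *\<^sub>R w) v - ?D f (x + s *\<^sub>R v + 0 *\<^sub>R w) v"]
      by auto
  have "((\<lambda>t. ?D f (x + s *\<^sub>R v + t *\<^sub>R w) v) has_real_derivative ?D (\<lambda>y. ?D f y v) (x + s *\<^sub>R v + t *\<^sub>R w) w) (at t)"
    if "0 \<le> t" "t \<le> h" for t
    using dt[of s t "\<lambda>y. ?D f y v"] smooth_onD(2)[OF f] s that by simp
  then obtain t where t: "0 < t" "t < h" and 2:
    "?D f (x + s *\<^sub>R v + h *\<^sub>R w) v - ?D f (x + s *\<^sub>R v + 0 *\<^sub>R w) v =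
      (h - 0) * ?D (\<lambda>y. ?D f y v) (x + s *\<^sub>R v + t *\<^sub>R w) w"
    using MVT2[OF h, of "\<lambda>t. ?D f (x + s *\<^sub>R v + t *\<^sub>R w) v"
        "\<lambda>t. ?D (\<lambda>y. ?D f y v) (x + s *\<^sub>R v + t *\<^sub>R w) w"] by auto
  show ?thesis
    by (rule that[OF s t]) (use 1 2 in \<open>simp add: power2_eq_square algebra_simps\<close>)
qed

text \<open>The same second difference is \<open>h\<^sup>2\<close> times either mixed derivative at
  some point of a small parallelogram. If the two mixed derivatives differed at \<open>x\<close> by
  \<open>2 * e\<close>, continuity would keep each within less than \<open>e\<close> of its value at
  \<open>x\<close>, so they could not take a common value there.\<close>

lemma frechet_derivative_commute:
  fixes f :: "'a::real_normed_vector \<Rightarrow> real"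
  assumes f: "smooth_on S f" and S: "open S" "x \<in> S"
  shows "frechet_derivative (\<lambda>y. frechet_derivative f (at y) v) (at x) w =
    frechet_derivative (\<lambda>y. frechet_derivative f (at y) w) (at x) v" (is "?A x = ?B x")
proof (rule ccontr)
  assume neq: "?A x \<noteq> ?B x"
  define e where "e = dist (?A x) (?B x) / 2"
  have "e > 0" using neq by (simp add: e_def)
  have "continuous_on S ?A" "continuous_on S ?B"
    by (rule smooth_onD(3)[OF smooth_onD(2)[OF smooth_onD(2)[OF f]]])+
  then have "isCont ?A x" "isCont ?B x"
    using S by (auto simp: continuous_on_eq_continuous_at)
  moreover have "(g \<longlongrightarrow> g x) (nhds x)" if "isCont g x" for g :: "'a \<Rightarrow> real"
    by (rule isCont_tendsto_compose[OF that filterlim_ident])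
  ultimately have cont: "(?A \<longlongrightarrow> ?A x) (nhds x)" "(?B \<longlongrightarrow> ?B x) (nhds x)"
    by blast+
  have "\<forall>\<^sub>F y in nhds x. dist (?A y) (?A x) < e" "\<forall>\<^sub>F y in nhds x. dist (?B y) (?B x) < e"
    using cont[THEN tendstoD, OF \<open>e > 0\<close>] by auto
  then have "\<forall>\<^sub>F y in nhds x. y \<in> S \<and> dist (?A y) (?A x) < e \<and> dist (?B y) (?B x) < e"
    using eventually_nhds_in_open[OF S] by eventually_elim auto
  then obtain r where r: "r > 0" "\<And>y. dist y x < r \<Longrightarrow> y \<in> S \<and> dist (?A y) (?A x) < e \<and> dist (?B y) (?B x) < e"
    unfolding eventually_nhds_metric by blast
  \<comment> \<open>With this step the whole parallelogram stays within distance \<open>r\<close> of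
    \<open>x\<close>. The summand 1 covers \<open>v = w = 0\<close> and makes the estimate
    strict.\<close>
  define h where "h = r / (norm v + norm w + 1)"
  have "h > 0" using r(1) by (simp add: h_def add_nonneg_pos)
  have near: "dist (x + s *\<^sub>R v + t *\<^sub>R w) x < r" if "0 \<le> s" "s \<le> h" "0 \<le> t" "t \<le> h" for s t
  proof -
    have "dist (x + s *\<^sub>R v + t *\<^sub>R w) x \<le> s * norm v + t * norm w"
      using norm_triangle_ineq[of "s *\<^sub>R v" "t *\<^sub>R w"] that by (simp add: dist_norm algebra_simps)
    also have "\<dots> \<le> h * norm v + h * norm w"
      using that by (intro add_mono mult_right_mono) auto
    also have "\<dots> < h * (norm v + norm w + 1)"
      using \<open>h > 0\<close> by (simp add: algebra_simps)
    also have "\<dots> = r"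
      using add_nonneg_pos[of "norm v + norm w" 1] by (simp add: h_def)
    finally show ?thesis .
  qed
  let ?\<Delta> = "f (x + h *\<^sub>R v + h *\<^sub>R w) - f (x + h *\<^sub>R v) - f (x + h *\<^sub>R w) + f x"
  obtain s t where st: "0 < s" "s < h" "0 < t" "t < h" "?\<Delta> = h\<^sup>2 * ?A (x + s *\<^sub>R v + t *\<^sub>R w)"
    by (rule second_difference_mean_value[OF f \<open>h > 0\<close>]) (use near r(2) in blast)+
  have near': "dist (x + t *\<^sub>R w + s *\<^sub>R v) x < r" if "0 \<le> s" "s \<le> h" "0 \<le> t" "t \<le> h" for s t
    using near[OF that] by (simp add: algebra_simps)
  obtain s' t' where st': "0 < s'" "s' < h" "0 < t'" "t' < h"
      "f (x + h *\<^sub>R w + h *\<^sub>R v) - f (x + h *\<^sub>R w) - f (x + h *\<^sub>R v) + f x = h\<^sup>2 * ?B (x + s' *\<^sub>R w + t' *\<^sub>R v)"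
    by (rule second_difference_mean_value[OF f \<open>h > 0\<close>]) (use near' r(2) in blast)+
  have "?\<Delta> = f (x + h *\<^sub>R w + h *\<^sub>R v) - f (x + h *\<^sub>R w) - f (x + h *\<^sub>R v) + f x"
    by (simp add: algebra_simps)
  then have "?A (x + s *\<^sub>R v + t *\<^sub>R w) = ?B (x + s' *\<^sub>R w + t' *\<^sub>R v)"
    using st(5) st'(5) \<open>h > 0\<close> by simp
  moreover have "dist (?A (x + s *\<^sub>R v + t *\<^sub>R w)) (?A x) < e"
    using r(2) near[of s t] st by simp
  moreover have "dist (?B (x + s' *\<^sub>R w + t' *\<^sub>R v)) (?B x) < e"
    using r(2) near'[of t' s'] st' by simp
  ultimately show False
    using dist_triangle3[of "?A x" "?B x" "?A (x + s *\<^sub>R v + t *\<^sub>R w)"] by (simp add: e_def dist_commute)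
qed

section \<open>Inverses of smooth families of linear isomorphisms\<close>

text \<open>A product rule for a factor \<open>h\<close> that is merely continuous: since
  \<open>g\<close> vanishes at \<open>x\<close>, the error \<open>(h y - h x) *\<^sub>R g y\<close>
  is of smaller order than the distance. It serves for the inverse family, whose differentiability
  is what has to be proved.\<close>

lemma has_derivative_scaleR_vanishing:
  fixes h :: "'a::real_normed_vector \<Rightarrow> real" and g :: "'a \<Rightarrow> 'b::real_normed_vector"
  assumes h: "isCont h x" and g: "(g has_derivative g') (at x)" and "g x = 0"
  shows "((\<lambda>y. h y *\<^sub>R g y) has_derivative (\<lambda>v. h x *\<^sub>R g' v)) (at x)"
proof -
  obtain B where B: "\<And>v. norm (g' v) \<le> norm v * B"
    using has_derivative_bounded_linear[OF g] bounded_linear.bounded by blast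
  \<comment> \<open>\<open>q\<close> is the relative error of the linear approximation, so
    \<open>q y + B\<close> bounds the difference quotient of \<open>g\<close>.\<close>
  define q where "q y = norm (g y - g x - g' (y - x)) / norm (y - x)" for y
  have "((\<lambda>y. (h y - h x) *\<^sub>R g y) has_derivative (\<lambda>v. 0)) (at x)"
    unfolding has_derivative_at_within
  proof (intro conjI)
    have "(q \<longlongrightarrow> 0) (at x)"
      using g unfolding has_derivative_iff_norm q_def by simp
    moreover have "((\<lambda>y. \<bar>h y - h x\<bar>) \<longlongrightarrow> 0) (at x)"
      using h by (simp add: isCont_def LIM_zero tendsto_rabs_zero)
    ultimately have "((\<lambda>y. \<bar>h y - h x\<bar> * (q y + B)) \<longlongrightarrow> 0 * (0 + B)) (at x)"
      by (intro tendsto_intros)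
    then have lim: "((\<lambda>y. \<bar>h y - h x\<bar> * (q y + B)) \<longlongrightarrow> 0) (at x)"
      by simp
    show "((\<lambda>y. ((h y - h x) *\<^sub>R g y - (h x - h x) *\<^sub>R g x - 0) /\<^sub>R norm (y - x)) \<longlongrightarrow> 0) (at x)"
    proof (rule Lim_null_comparison[OF _ lim])
      show "\<forall>\<^sub>F y in at x. norm (((h y - h x) *\<^sub>R g y - (h x - h x) *\<^sub>R g x - 0) /\<^sub>R norm (y - x))
          \<le> \<bar>h y - h x\<bar> * (q y + B)"
        unfolding eventually_at_filter
      proof (intro always_eventually allI impI)
        fix y assume "y \<noteq> x"
        then have "norm (g y) / norm (y - x) \<le> q y + B"
          using norm_triangle_ineq[of "g y - g x - g' (y - x)" "g' (y - x)"] B[of "y - x"] \<open>g x = 0\<close>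
          by (simp add: q_def field_simps)
        from mult_left_mono[OF this, of "\<bar>h y - h x\<bar>"]
        show "norm (((h y - h x) *\<^sub>R g y - (h x - h x) *\<^sub>R g x - 0) /\<^sub>R norm (y - x)) \<le> \<bar>h y - h x\<bar> * (q y + B)"
          by (simp add: divide_inverse abs_mult mult_ac)
      qed
    qed
  qed auto
  from has_derivative_add[OF this has_derivative_scaleR_right[OF g, of "h x"]]
  show ?thesis
    by (simp add: scaleR_diff_left)
qed

context
  fixes M N :: "'a::real_normed_vector \<Rightarrow> 'b::euclidean_space \<Rightarrow> 'b" and S :: "'a set"
  assumes S: "open S" and M: "\<And>b. smooth_on S (\<lambda>x. M x b)"
    and linear_M: "\<And>x. x \<in> S \<Longrightarrow> linear (M x)" and linear_N: "\<And>x. x \<in> S \<Longrightarrow> linear (N x)"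
    and MN: "\<And>x y. x \<in> S \<Longrightarrow> M x (N x y) = y" and NM: "\<And>x y. x \<in> S \<Longrightarrow> N x (M x y) = y"
begin

text \<open>The resolvent identity \<open>N x - N x0 = - N x0 (M x - M x0) N x\<close>. It is
  written in coordinates because the smoothness of \<open>M\<close> is known on fixed vectors
  only.\<close>

lemma inverse_family_diff:
  assumes "x0 \<in> S" "x \<in> S"
  shows "N x X - N x0 X = - (\<Sum>b\<in>Basis. (N x X \<bullet> b) *\<^sub>R N x0 (M x b - M x0 b))"
proof -
  have "(\<Sum>b\<in>Basis. (N x X \<bullet> b) *\<^sub>R N x0 (M x b - M x0 b)) =
      N x0 (M x (\<Sum>b\<in>Basis. (N x X \<bullet> b) *\<^sub>R b) - M x0 (\<Sum>b\<in>Basis. (N x X \<bullet> b) *\<^sub>R b))"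
    using linear_N[OF assms(1)] linear_M[OF assms(1)] linear_M[OF assms(2)]
    by (simp add: linear_sum linear_scale linear_diff sum_subtractf scaleR_diff_right)
  also have "\<dots> = N x0 X - N x X"
    unfolding euclidean_representation using MN[OF assms(2)] NM[OF assms(1)] linear_diff[OF linear_N[OF assms(1)]] by simp
  finally show ?thesis by simp
qed

text \<open>The resolvent identity bounds the difference by \<open>norm (N x X)\<close> times a
  quantity that tends to 0. Once that quantity is below 1/2, the same bound yields
  \<open>norm (N x X) \<le> 2 * norm (N x0 X)\<close>, so the unknown factor stays bounded.\<close>

lemma isCont_inverse_family:
  assumes x0: "x0 \<in> S"
  shows "isCont (\<lambda>x. N x X) x0"
proof -
  define \<epsilon> where "\<epsilon> x = (\<Sum>b\<in>Basis. norm (N x0 (M x b - M x0 b)))" for x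
  have "isCont (\<lambda>x. N x0 (M x b - M x0 b)) x0" for b
  proof -
    have "isCont (\<lambda>x. M x b) x0"
      using continuous_on_eq_continuous_at[OF S] smooth_onD(3)[OF M] x0 by blast
    then show ?thesis
      using linear_N[OF x0] by (intro bounded_linear.isCont[where f = "N x0"] continuous_diff)
        (auto simp: linear_conv_bounded_linear)
  qed
  then have "isCont \<epsilon> x0"
    unfolding \<epsilon>_def by (intro continuous_intros)
  moreover have "\<epsilon> x0 = 0"
    using linear_0[OF linear_N[OF x0]] by (simp add: \<epsilon>_def)
  ultimately have \<epsilon>: "(\<epsilon> \<longlongrightarrow> 0) (at x0)"
    by (simp add: isCont_def)
  have bound: "norm (N x X - N x0 X) \<le> norm (N x X) * \<epsilon> x" if "x \<in> S" for x
  proof -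
    have "norm (N x X - N x0 X) \<le> (\<Sum>b\<in>Basis. norm ((N x X \<bullet> b) *\<^sub>R N x0 (M x b - M x0 b)))"
      unfolding inverse_family_diff[OF x0 that] norm_minus_cancel by (rule norm_sum)
    also have "\<dots> \<le> (\<Sum>b\<in>Basis. norm (N x X) * norm (N x0 (M x b - M x0 b)))"
      by (intro sum_mono) (simp add: Basis_le_norm mult_right_mono)
    finally show ?thesis
      by (simp add: \<epsilon>_def sum_distrib_left)
  qed
  have "((\<lambda>x. 2 * norm (N x0 X) * \<epsilon> x) \<longlongrightarrow> 2 * norm (N x0 X) * 0) (at x0)"
    by (intro tendsto_intros \<epsilon>)
  then have lim: "((\<lambda>x. 2 * norm (N x0 X) * \<epsilon> x) \<longlongrightarrow> 0) (at x0)"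
    by simp
  have "((\<lambda>x. N x X - N x0 X) \<longlongrightarrow> 0) (at x0)"
  proof (rule Lim_null_comparison[OF _ lim])
    have "\<forall>\<^sub>F x in at x0. \<epsilon> x < 1 / 2"
      using \<epsilon> by (rule order_tendstoD) simp
    moreover have "\<forall>\<^sub>F x in at x0. x \<in> S"
      using eventually_nhds_in_open[OF S x0] by (simp add: eventually_at_filter eventually_mono)
    ultimately show "\<forall>\<^sub>F x in at x0. norm (N x X - N x0 X) \<le> 2 * norm (N x0 X) * \<epsilon> x"
    proof eventually_elim
      case (elim x)
      have "\<epsilon> x \<ge> 0"
        by (simp add: \<epsilon>_def sum_nonneg)
      have "norm (N x X) \<le> norm (N x0 X) + norm (N x X - N x0 X)"
        by norm
      also have "\<dots> \<le> norm (N x0 X) + norm (N x X) * (1 / 2)"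
        using bound[OF elim(2)] mult_left_mono[of "\<epsilon> x" "1 / 2" "norm (N x X)"] elim(1) by simp
      finally have "norm (N x X) \<le> 2 * norm (N x0 X)"
        by simp
      then show ?case
        using bound[OF elim(2)] \<open>\<epsilon> x \<ge> 0\<close> mult_right_mono by (metis order_trans)
    qed
  qed
  then show ?thesis
    by (simp add: isCont_def LIM_zero_iff)
qed

text \<open>Differentiation of the resolvent identity at \<open>x0\<close>. The coefficients
  involving \<open>N x X\<close> are only continuous so far, but they multiply functions that vanish
  at \<open>x0\<close>.\<close>

lemma has_derivative_inverse_family:
  assumes x0: "x0 \<in> S"
  shows "((\<lambda>x. N x X) has_derivative
    (\<lambda>v. - (\<Sum>b\<in>Basis. (N x0 X \<bullet> b) *\<^sub>R N x0 (frechet_derivative (\<lambda>x. M x b) (at x0) v)))) (at x0)"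
proof -
  have "((\<lambda>x. N x0 (M x b - M x0 b)) has_derivative
      (\<lambda>v. N x0 (frechet_derivative (\<lambda>x. M x b) (at x0) v))) (at x0)" for b
    using bounded_linear.has_derivative[OF linear_conv_bounded_linear[THEN iffD1, OF linear_N[OF x0]]
        has_derivative_diff[OF smooth_onD(1)[OF M x0] has_derivative_const[of "M x0 b"]]] by simp
  then have "((\<lambda>x. (N x X \<bullet> b) *\<^sub>R N x0 (M x b - M x0 b)) has_derivative
      (\<lambda>v. (N x0 X \<bullet> b) *\<^sub>R N x0 (frechet_derivative (\<lambda>x. M x b) (at x0) v))) (at x0)" for b
    using isCont_inverse_family[OF x0] linear_0[OF linear_N[OF x0]]
    by (intro has_derivative_scaleR_vanishing continuous_intros) auto
  then have "((\<lambda>x. N x0 X + - (\<Sum>b\<in>Basis. (N x X \<bullet> b) *\<^sub>R N x0 (M x b - M x0 b))) has_derivative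
      (\<lambda>v. 0 + - (\<Sum>b\<in>Basis. (N x0 X \<bullet> b) *\<^sub>R N x0 (frechet_derivative (\<lambda>x. M x b) (at x0) v)))) (at x0)"
    by (intro has_derivative_add has_derivative_const has_derivative_minus has_derivative_sum)
  then have "((\<lambda>x. N x0 X + - (\<Sum>b\<in>Basis. (N x X \<bullet> b) *\<^sub>R N x0 (M x b - M x0 b))) has_derivative
      (\<lambda>v. - (\<Sum>b\<in>Basis. (N x0 X \<bullet> b) *\<^sub>R N x0 (frechet_derivative (\<lambda>x. M x b) (at x0) v)))) (at x0)"
    by simp
  then show ?thesis
  proof (rule has_derivative_transform_within_open[OF _ S x0])
    show "N x0 X + - (\<Sum>b\<in>Basis. (N x X \<bullet> b) *\<^sub>R N x0 (M x b - M x0 b)) = N x X" if "x \<in> S" for x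
      using inverse_family_diff[OF x0 that, of X] by (simp add: algebra_simps)
  qed
qed

text \<open>Bootstrapping: the derivative is expressed by \<open>N\<close> itself and derivatives of
  \<open>M\<close>, so n-fold differentiability of \<open>N\<close> on all fixed vectors passes to
  the derivative.\<close>

lemma smooth_on_inverse_family: "smooth_on S (\<lambda>x. N x X)"
proof -
  have "Ck_on n S (\<lambda>x. N x X)" for n X
  proof (induction n arbitrary: X)
    case 0
    then show ?case
      using isCont_inverse_family by (simp add: continuous_at_imp_continuous_on)
  next
    case (Suc n)
    let ?z = "\<lambda>v x. \<Sum>b\<in>Basis. (N x X \<bullet> b) *\<^sub>R frechet_derivative (\<lambda>x. M x b) (at x) v"
    show ?case
    proof (rule Ck_on_SucI[OF S has_derivative_inverse_family])
      fix v
      have dM: "Ck_on n S (\<lambda>x. frechet_derivative (\<lambda>x. M x b) (at x) v)" for b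
        using smooth_onD(2)[OF M] by (simp add: smooth_on_def)
      \<comment> \<open>In the derivative formula \<open>N x\<close> is applied to vectors depending
        on \<open>x\<close>. Expanding their combination \<open>?z v x\<close> in the basis leaves
        \<open>N x\<close> on basis vectors, where the induction hypothesis applies.\<close>
      have "Ck_on n S (\<lambda>x. \<Sum>c\<in>Basis. (?z v x \<bullet> c) *\<^sub>R N x c)"
        by (intro Ck_on_sum Ck_on_scaleR Ck_on_bounded_linear_comp[OF bounded_linear_inner_left] S Suc.IH dM)
      then have "Ck_on n S (\<lambda>x. - (\<Sum>c\<in>Basis. (?z v x \<bullet> c) *\<^sub>R N x c))"
        by (rule Ck_on_bounded_linear_comp[OF bounded_linear_minus[OF bounded_linear_ident] S])
      then show "Ck_on n S (\<lambda>x. - (\<Sum>b\<in>Basis. (N x X \<bullet> b) *\<^sub>R N x (frechet_derivative (\<lambda>x. M x b) (at x) v)))"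
      proof (rule Ck_on_cong[OF _ S])
        fix x assume x: "x \<in> S"
        have "N x (?z v x) = (\<Sum>c\<in>Basis. (?z v x \<bullet> c) *\<^sub>R N x c)"
          by (rule linear_euclidean_expansion[OF linear_N[OF x]])
        moreover have "N x (?z v x) = (\<Sum>b\<in>Basis. (N x X \<bullet> b) *\<^sub>R N x (frechet_derivative (\<lambda>x. M x b) (at x) v))"
          by (simp add: linear_sum[OF linear_N[OF x]] linear_scale[OF linear_N[OF x]])
        ultimately show "- (\<Sum>c\<in>Basis. (?z v x \<bullet> c) *\<^sub>R N x c) =
            - (\<Sum>b\<in>Basis. (N x X \<bullet> b) *\<^sub>R N x (frechet_derivative (\<lambda>x. M x b) (at x) v))"
          by simp
      qed
    qed
  qed
  then show ?thesis
    by (simp add: smooth_on_def)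
qed

end


section \<open>Smooth maps and tangent vectors\<close>

text \<open>The part of the atlas axioms that does not speak of transition maps. It passes to
  products of atlases by a purely topological argument and suffices for composing with smooth
  maps.\<close>

definition chart_system :: "('a::topological_space, 'm::real_normed_vector) atlas \<Rightarrow> bool" where
  "chart_system A \<longleftrightarrow> (\<Union>(U,\<phi>)\<in>A. U) = UNIV \<and>
     (\<forall>(U,\<phi>)\<in>A. open U \<and> inj_on \<phi> U \<and> continuous_on U \<phi> \<and> (\<forall>W. open W \<and> W \<subseteq> U \<longrightarrow> open (\<phi> ` W)))"

lemma smooth_manifold_chart_system:
  assumes "smooth_manifold A"
  shows "chart_system A"
proof -
  have "open (\<phi> ` W)" if "(U, \<phi>) \<in> A" "open W" "W \<subseteq> U" for U \<phi> W
  proof -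
    have *: "open (\<phi> ` U)" "homeomorphism U (\<phi> ` U) \<phi> (inv_into U \<phi>)" "open U"
      using assms that(1) by (auto simp: smooth_manifold_def)
    then have "openin (top_of_set (\<phi> ` U)) (\<phi> ` W)"
      using that homeomorphism_imp_open_map openin_open_eq by blast
    with * show ?thesis
      using openin_open_trans by blast
  qed
  moreover have "inj_on \<phi> U" "continuous_on U \<phi>" if "(U, \<phi>) \<in> A" for U \<phi>
    using assms that by (auto simp: smooth_manifold_def homeomorphism_def intro!: inj_on_inverseI)
  ultimately show ?thesis
    using assms by (auto simp: chart_system_def smooth_manifold_def)
qed

lemma chart_systemD:
  assumes "chart_system A" "(U, \<phi>) \<in> A"
  shows "open U" "inj_on \<phi> U" "continuous_on U \<phi>" "open W \<Longrightarrow> W \<subseteq> U \<Longrightarrow> open (\<phi> ` W)"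
  using assms by (auto simp: chart_system_def)

lemma chart_system_cover:
  assumes "chart_system A"
  obtains U \<phi> where "(U, \<phi>) \<in> A" "u \<in> U"
proof -
  have "u \<in> (\<Union>(U,\<phi>)\<in>A. U)"
    using assms unfolding chart_system_def by blast
  then show ?thesis
    by (auto intro: that)
qed

lemma chart_system_prod:
  assumes A: "chart_system A" and B: "chart_system B"
  shows "chart_system (prod_atlas A B)"
  unfolding chart_system_def
proof (intro conjI)
  have "p \<in> (\<Union>(U,\<phi>)\<in>prod_atlas A B. U)" for p
  proof -
    obtain U \<phi> V \<psi> where "(U, \<phi>) \<in> A" "fst p \<in> U" "(V, \<psi>) \<in> B" "snd p \<in> V"
      using chart_system_cover[OF A] chart_system_cover[OF B] by metis
    then have "(U \<times> V, map_prod \<phi> \<psi>) \<in> prod_atlas A B" "p \<in> U \<times> V"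
      by (force simp: prod_atlas_def, cases p) auto
    then show ?thesis by blast
  qed
  then show "(\<Union>(U,\<phi>)\<in>prod_atlas A B. U) = UNIV" by blast
next
  show "\<forall>(U,\<phi>)\<in>prod_atlas A B. open U \<and> inj_on \<phi> U \<and> continuous_on U \<phi> \<and> (\<forall>W. open W \<and> W \<subseteq> U \<longrightarrow> open (\<phi> ` W))"
    unfolding prod_atlas_def
  proof (safe del: subsetI)
    fix U \<phi> V \<psi> assume UV: "(U, \<phi>) \<in> A" "(V, \<psi>) \<in> B"
    note U = chart_systemD[OF A UV(1)] and V = chart_systemD[OF B UV(2)]
    show "open (U \<times> V)" using U V by (simp add: open_Times)
    show "inj_on (map_prod \<phi> \<psi>) (U \<times> V)" using U V by (simp add: map_prod_inj_on)
    show "continuous_on (U \<times> V) (map_prod \<phi> \<psi>)"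
      unfolding map_prod_def case_prod_beta
      by (intro continuous_on_Pair continuous_on_compose2[OF U(3)] continuous_on_compose2[OF V(3)]
          continuous_on_fst continuous_on_snd continuous_on_id) auto
    fix W assume W: "open W" "W \<subseteq> U \<times> V"
    show "open (map_prod \<phi> \<psi> ` W)"
    proof (subst open_subopen, intro ballI)
      fix z assume "z \<in> map_prod \<phi> \<psi> ` W"
      then obtain x y where xy: "(x, y) \<in> W" "z = (\<phi> x, \<psi> y)" by auto
      obtain X Y where XY: "open X" "open Y" "(x, y) \<in> X \<times> Y" "X \<times> Y \<subseteq> W"
        using open_prod_elim[OF W(1) xy(1)] by metis
      then have "X \<subseteq> U" "Y \<subseteq> V" using W(2) by auto
      then have "open (\<phi> ` X \<times> \<psi> ` Y)"
        using U(4) V(4) XY by (simp add: open_Times)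
      moreover have "z \<in> \<phi> ` X \<times> \<psi> ` Y" "\<phi> ` X \<times> \<psi> ` Y \<subseteq> map_prod \<phi> \<psi> ` W"
        using XY xy by (auto simp: image_iff map_prod_def)
      ultimately show "\<exists>T. open T \<and> z \<in> T \<and> T \<subseteq> map_prod \<phi> \<psi> ` W" by blast
    qed
  qed
qed

text \<open>Smooth maps from an open set of a normed space into a manifold. Curves, inverse charts
  and families with several parameters all have this shape, and composing them with maps of
  manifolds reduces to the chain rule between normed spaces.\<close>

definition smooth_param ::
  "('a::topological_space, 'm::real_normed_vector) atlas \<Rightarrow> 'n::real_normed_vector set \<Rightarrow> ('n \<Rightarrow> 'a) \<Rightarrow> bool" where
  "smooth_param A S F \<longleftrightarrow> open S \<and> continuous_on S F \<and> (\<forall>(U,\<phi>)\<in>A. smooth_on (S \<inter> F -` U) (\<lambda>x. \<phi> (F x)))"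

lemma smooth_paramD:
  assumes "smooth_param A S F"
  shows "open S" "continuous_on S F" "(U, \<phi>) \<in> A \<Longrightarrow> smooth_on (S \<inter> F -` U) (\<lambda>x. \<phi> (F x))"
    and "open U' \<Longrightarrow> open (S \<inter> F -` U')"
  using assms by (auto simp: smooth_param_def intro: continuous_open_preimage)

lemma smooth_param_subset: "smooth_param A S F \<Longrightarrow> open T \<Longrightarrow> T \<subseteq> S \<Longrightarrow> smooth_param A T F"
  unfolding smooth_param_def by (auto intro: continuous_on_subset smooth_on_subset)

lemma smooth_param_compose:
  fixes g :: "'k::real_normed_vector \<Rightarrow> 'n::euclidean_space"
  assumes F: "smooth_param A S F" and g: "smooth_on T g" "open T" "g ` T \<subseteq> S" and A: "chart_system A"
  shows "smooth_param A T (\<lambda>x. F (g x))"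
  unfolding smooth_param_def
proof (safe intro!: g(2))
  show cont: "continuous_on T (\<lambda>x. F (g x))"
    using continuous_on_compose2[OF smooth_paramD(2)[OF F] smooth_onD(3)[OF g(1)] g(3)] .
  fix U \<phi> assume U: "(U, \<phi>) \<in> A"
  have "open (T \<inter> (\<lambda>x. F (g x)) -` U)"
    using continuous_open_preimage[OF cont g(2) chart_systemD(1)[OF A U]] .
  then show "smooth_on (T \<inter> (\<lambda>x. F (g x)) -` U) (\<lambda>x. \<phi> (F (g x)))"
    using g by (intro smooth_on_compose[OF _ _ smooth_on_subset[OF g(1)] smooth_paramD(3)[OF F U]]) auto
qed

lemma smooth_param_local:
  assumes "chart_system A" "open S" "\<And>x. x \<in> S \<Longrightarrow> \<exists>T. x \<in> T \<and> smooth_param A T F"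
  shows "smooth_param A S F"
  unfolding smooth_param_def
proof (safe intro!: assms(2))
  show "continuous_on S F"
  proof (intro continuous_at_imp_continuous_on ballI)
    fix x assume "x \<in> S"
    with assms(3) obtain T where "x \<in> T" "smooth_param A T F" by blast
    then show "isCont F x"
      using continuous_on_eq_continuous_at[OF smooth_paramD(1)] smooth_paramD(2) by blast
  qed
  fix U \<phi> assume U: "(U, \<phi>) \<in> A"
  show "smooth_on (S \<inter> F -` U) (\<lambda>x. \<phi> (F x))"
  proof (rule smooth_on_local)
    fix x assume x: "x \<in> S \<inter> F -` U"
    with assms(3) obtain T where T: "x \<in> T" "smooth_param A T F" by blast
    then show "\<exists>T. open T \<and> x \<in> T \<and> smooth_on T (\<lambda>x. \<phi> (F x))"
      using smooth_paramD(3,4)[OF T(2)] U chart_systemD(1)[OF assms(1) U] x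
      by (intro exI[of _ "T \<inter> F -` U"]) auto
  qed
qed

lemma smooth_param_cong:
  assumes "chart_system A" "smooth_param A S F" "\<And>x. x \<in> S \<Longrightarrow> F x = G x"
  shows "smooth_param A S G"
  unfolding smooth_param_def
proof (safe intro!: smooth_paramD(1)[OF assms(2)])
  show "continuous_on S G"
    using smooth_paramD(2)[OF assms(2)] assms(3) by (simp cong: continuous_on_cong)
  fix U \<phi> assume U: "(U, \<phi>) \<in> A"
  have eq: "S \<inter> G -` U = S \<inter> F -` U" using assms(3) by auto
  show "smooth_on (S \<inter> G -` U) (\<lambda>x. \<phi> (G x))"
    unfolding eq using assms(3)
    by (intro smooth_on_cong[OF smooth_paramD(3)[OF assms(2) U] smooth_paramD(4)[OF assms(2) chart_systemD(1)[OF assms(1) U]]]) auto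
qed

lemma smooth_param_const:
  assumes "chart_system A" "open S"
  shows "smooth_param A S (\<lambda>x. c)"
  unfolding smooth_param_def using assms by (auto simp: smooth_on_const chart_systemD)

lemma smooth_param_Pair:
  assumes F: "smooth_param A S F" and G: "smooth_param B S G"
    and A: "chart_system A" and B: "chart_system B"
  shows "smooth_param (prod_atlas A B) S (\<lambda>x. (F x, G x))"
  unfolding smooth_param_def prod_atlas_def
proof (safe intro!: smooth_paramD(1)[OF F] continuous_on_Pair smooth_paramD(2)[OF F] smooth_paramD(2)[OF G])
  fix U \<phi> V \<psi> assume UV: "(U, \<phi>) \<in> A" "(V, \<psi>) \<in> B"
  have eq: "S \<inter> (\<lambda>x. (F x, G x)) -` (U \<times> V) = (S \<inter> F -` U) \<inter> (S \<inter> G -` V)" by auto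
  show "smooth_on (S \<inter> (\<lambda>x. (F x, G x)) -` (U \<times> V)) (\<lambda>x. map_prod \<phi> \<psi> (F x, G x))"
    unfolding eq map_prod_simp
    by (intro smooth_on_Pair open_Int smooth_paramD(4)[OF F chart_systemD(1)[OF A UV(1)]]
        smooth_paramD(4)[OF G chart_systemD(1)[OF B UV(2)]]
        smooth_on_subset[OF smooth_paramD(3)[OF F UV(1)]] smooth_on_subset[OF smooth_paramD(3)[OF G UV(2)]]) auto
qed

lemma smooth_map_param:
  fixes A :: "('a::topological_space, 'm::euclidean_space) atlas"
  assumes A: "chart_system A" and B: "chart_system B" and K: "smooth_map A B W K" "open W"
    and F: "smooth_param A S F" "F ` S \<subseteq> W"
  shows "smooth_param B S (\<lambda>x. K (F x))"
  unfolding smooth_param_def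
proof (safe intro!: smooth_paramD(1)[OF F(1)])
  show cont: "continuous_on S (\<lambda>x. K (F x))"
    using K F smooth_paramD(2)[OF F(1)] by (auto simp: smooth_map_def intro: continuous_on_compose2)
  fix V \<psi> assume V: "(V, \<psi>) \<in> B"
  show "smooth_on (S \<inter> (\<lambda>x. K (F x)) -` V) (\<lambda>x. \<psi> (K (F x)))"
  proof (rule smooth_on_local)
    fix x assume x: "x \<in> S \<inter> (\<lambda>x. K (F x)) -` V"
    obtain U \<phi> where U: "(U, \<phi>) \<in> A" "F x \<in> U"
      using chart_system_cover[OF A] by metis
    define T where "T = (S \<inter> F -` U) \<inter> (S \<inter> (\<lambda>x. K (F x)) -` V)"
    have T: "open T" "x \<in> T"
      unfolding T_def using smooth_paramD(4)[OF F(1) chart_systemD(1)[OF A U(1)]] x U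
        continuous_open_preimage[OF cont smooth_paramD(1)[OF F(1)] chart_systemD(1)[OF B V]]
      by auto
    have inv: "inv_into U \<phi> (\<phi> (F y)) = F y" if "y \<in> T" for y
      using that chart_systemD(2)[OF A U(1)] by (simp add: T_def)
    have "smooth_on (\<phi> ` (U \<inter> W \<inter> K -` V)) (\<psi> \<circ> K \<circ> inv_into U \<phi>)"
      using K(1) U(1) V by (auto simp: smooth_map_def)
    moreover have "smooth_on T (\<lambda>y. \<phi> (F y))"
      by (rule smooth_on_subset[OF smooth_paramD(3)[OF F(1) U(1)]]) (auto simp: T_def)
    moreover have "(\<lambda>y. \<phi> (F y)) ` T \<subseteq> \<phi> ` (U \<inter> W \<inter> K -` V)"
      using F(2) by (auto simp: T_def)
    ultimately have "smooth_on T (\<lambda>y. (\<psi> \<circ> K \<circ> inv_into U \<phi>) (\<phi> (F y)))"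
      using smooth_on_compose[OF T(1)] by blast
    then have "smooth_on T (\<lambda>x. \<psi> (K (F x)))"
      using T(1) by (rule smooth_on_cong) (simp add: inv)
    with T show "\<exists>T. open T \<and> x \<in> T \<and> smooth_on T (\<lambda>x. \<psi> (K (F x)))" by blast
  qed
qed

text \<open>The local extension that smoothness on a subset provides agrees with \<open>K\<close>
  along \<open>F\<close>, because \<open>F\<close> takes values in that subset. Thus actions of
  closed subgroups can be differentiated along curves in the subgroup without a submanifold
  structure.\<close>

lemma smooth_map_on_param:
  fixes A :: "('a::topological_space, 'm::euclidean_space) atlas"
  assumes A: "chart_system A" and B: "chart_system B" and K: "smooth_map_on A B S0 K"
    and F: "smooth_param A S F" "F ` S \<subseteq> S0"
  shows "smooth_param B S (\<lambda>x. K (F x))"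
proof (rule smooth_param_local[OF B smooth_paramD(1)[OF F(1)]])
  fix x assume x: "x \<in> S"
  then obtain W K' where W: "open W" "F x \<in> W" "smooth_map A B W K'" "\<forall>y\<in>W \<inter> S0. K' y = K y"
    using K F(2) unfolding smooth_map_on_def by blast
  define T where "T = S \<inter> F -` W"
  have T: "open T" "x \<in> T" "T \<subseteq> S"
    using smooth_paramD(4)[OF F(1) W(1)] x W(2) by (auto simp: T_def)
  have "smooth_param B T (\<lambda>x. K' (F x))"
    using smooth_map_param[OF A B W(3,1) smooth_param_subset[OF F(1) T(1,3)]] by (auto simp: T_def)
  then have "smooth_param B T (\<lambda>x. K (F x))"
    by (rule smooth_param_cong[OF B]) (use W(4) F(2) in \<open>auto simp: T_def\<close>)
  with T show "\<exists>T. x \<in> T \<and> smooth_param B T (\<lambda>x. K (F x))" by blast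
qed

lemma chart_inverse_param:
  assumes "smooth_manifold A" and U: "(U, \<phi>) \<in> A"
  shows "smooth_param A (\<phi> ` U) (inv_into U \<phi>)"
  unfolding smooth_param_def
proof (safe)
  have *: "open (\<phi> ` U)" "homeomorphism U (\<phi> ` U) \<phi> (inv_into U \<phi>)" "open U" "inj_on \<phi> U"
    using assms chart_systemD(2)[OF smooth_manifold_chart_system] by (auto simp: smooth_manifold_def)
  show "open (\<phi> ` U)" "continuous_on (\<phi> ` U) (inv_into U \<phi>)"
    using * by (auto simp: homeomorphism_def)
  fix V \<psi> assume V: "(V, \<psi>) \<in> A"
  have eq: "\<phi> ` U \<inter> inv_into U \<phi> -` V = \<phi> ` (U \<inter> V)"
    using * by (auto simp: inv_into_f_f)
  have "smooth_on (\<phi> ` (U \<inter> V)) (\<psi> \<circ> inv_into U \<phi>)"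
    using assms V by (auto simp: smooth_manifold_def)
  then show "smooth_on (\<phi> ` U \<inter> inv_into U \<phi> -` V) (\<lambda>x. \<psi> (inv_into U \<phi> x))"
    by (simp add: eq o_def)
qed

lemma smooth_fun_param:
  fixes A :: "('a::topological_space, 'm::euclidean_space) atlas"
  assumes A: "chart_system A" and f: "smooth_fun_on A W f" "open W"
    and F: "smooth_param A S F" "F ` S \<subseteq> W"
  shows "smooth_on S (\<lambda>x. f (F x))"
proof (rule smooth_on_local)
  fix x assume x: "x \<in> S"
  obtain U \<phi> where U: "(U, \<phi>) \<in> A" "F x \<in> U"
    using chart_system_cover[OF A] by metis
  define T where "T = S \<inter> F -` U"
  have T: "open T" "x \<in> T"
    unfolding T_def using smooth_paramD(4)[OF F(1) chart_systemD(1)[OF A U(1)]] x U by auto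
  have inv: "inv_into U \<phi> (\<phi> (F y)) = F y" if "y \<in> T" for y
    using that chart_systemD(2)[OF A U(1)] by (simp add: T_def)
  have "smooth_on (\<phi> ` (U \<inter> W)) (f \<circ> inv_into U \<phi>)"
    using f U(1) by (auto simp: smooth_fun_on_def)
  moreover have "smooth_on T (\<lambda>y. \<phi> (F y))"
    by (rule smooth_on_subset[OF smooth_paramD(3)[OF F(1) U(1)]]) (auto simp: T_def)
  moreover have "(\<lambda>y. \<phi> (F y)) ` T \<subseteq> \<phi> ` (U \<inter> W)"
    using F(2) by (auto simp: T_def)
  ultimately have "smooth_on T (\<lambda>y. (f \<circ> inv_into U \<phi>) (\<phi> (F y)))"
    using smooth_on_compose[OF T(1)] by blast
  then have "smooth_on T (\<lambda>x. f (F x))"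
    using T(1) by (rule smooth_on_cong) (simp add: inv)
  with T show "\<exists>T. open T \<and> x \<in> T \<and> smooth_on T (\<lambda>x. f (F x))" by blast
qed

section \<open>Smooth functions on manifolds\<close>

lemma chart_image_open:
  "smooth_manifold A \<Longrightarrow> (U, \<phi>) \<in> A \<Longrightarrow> open W \<Longrightarrow> open (\<phi> ` (U \<inter> W))"
  using chart_systemD(1,4)[OF smooth_manifold_chart_system] by (metis inf_le1 open_Int)

lemma smooth_fun_on_subset: "smooth_fun_on A W f \<Longrightarrow> V \<subseteq> W \<Longrightarrow> smooth_fun_on A V f"
  unfolding smooth_fun_on_def by (fastforce intro: smooth_on_subset[OF _ image_mono])

lemma smooth_fun_on_cong:
  assumes "smooth_manifold A" "smooth_fun_on A W f" "open W" "\<And>x. x \<in> W \<Longrightarrow> f x = g x"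
  shows "smooth_fun_on A W g"
  unfolding smooth_fun_on_def
proof safe
  fix U \<phi> assume U: "(U, \<phi>) \<in> A"
  have "smooth_on (\<phi> ` (U \<inter> W)) (f \<circ> inv_into U \<phi>)"
    using assms(2) U by (auto simp: smooth_fun_on_def)
  then show "smooth_on (\<phi> ` (U \<inter> W)) (g \<circ> inv_into U \<phi>)"
  proof (rule smooth_on_cong[OF _ chart_image_open[OF assms(1) U assms(3)]])
    fix y assume "y \<in> \<phi> ` (U \<inter> W)"
    then obtain x where x: "x \<in> U" "x \<in> W" "y = \<phi> x" by blast
    then have "inv_into U \<phi> y = x"
      using chart_systemD(2)[OF smooth_manifold_chart_system[OF assms(1)] U] by simp
    then show "(f \<circ> inv_into U \<phi>) y = (g \<circ> inv_into U \<phi>) y"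
      using assms(4) x by simp
  qed
qed

lemma smooth_fun_on_local:
  assumes "smooth_manifold A" "\<And>x. x \<in> W \<Longrightarrow> \<exists>V. open V \<and> x \<in> V \<and> smooth_fun_on A V f"
  shows "smooth_fun_on A W f"
  unfolding smooth_fun_on_def
proof (safe, rule smooth_on_local)
  fix U \<phi> y assume U: "(U, \<phi>) \<in> A" and "y \<in> \<phi> ` (U \<inter> W)"
  then obtain x where x: "x \<in> U" "x \<in> W" "y = \<phi> x" by blast
  with assms(2) obtain V where "open V" "x \<in> V" "smooth_fun_on A V f" by blast
  then show "\<exists>T. open T \<and> y \<in> T \<and> smooth_on T (f \<circ> inv_into U \<phi>)"
    using chart_image_open[OF assms(1) U, of V] U x
    by (intro exI[of _ "\<phi> ` (U \<inter> V)"]) (auto simp: smooth_fun_on_def)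
qed

lemma smooth_fun_on_const: "smooth_manifold A \<Longrightarrow> open W \<Longrightarrow> smooth_fun_on A W (\<lambda>x. c)"
  by (auto simp: smooth_fun_on_def o_def intro!: smooth_on_const chart_image_open)

lemma smooth_fun_on_add:
  "smooth_manifold A \<Longrightarrow> open W \<Longrightarrow> smooth_fun_on A W f \<Longrightarrow> smooth_fun_on A W g \<Longrightarrow> smooth_fun_on A W (\<lambda>x. f x + g x)"
  by (fastforce simp: smooth_fun_on_def o_def intro!: smooth_on_add chart_image_open)

lemma smooth_fun_on_mult:
  "smooth_manifold A \<Longrightarrow> open W \<Longrightarrow> smooth_fun_on A W f \<Longrightarrow> smooth_fun_on A W g \<Longrightarrow> smooth_fun_on A W (\<lambda>x. f x * g x)"
  by (fastforce simp: smooth_fun_on_def o_def intro!: smooth_on_mult chart_image_open)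

lemma smooth_fun_on_sum:
  "smooth_manifold A \<Longrightarrow> open W \<Longrightarrow> (\<And>i. i \<in> I \<Longrightarrow> smooth_fun_on A W (f i)) \<Longrightarrow> smooth_fun_on A W (\<lambda>x. \<Sum>i\<in>I. f i x)"
  by (induction I rule: infinite_finite_induct) (auto intro: smooth_fun_on_const smooth_fun_on_add)

lemma smooth_fun_on_chart:
  fixes A :: "('a::{t2_space,second_countable_topology}, 'm::euclidean_space) atlas"
  assumes A: "smooth_manifold A" and U: "(U, \<phi>) \<in> A" and V: "open V" "V \<subseteq> U" and h: "smooth_on (\<phi> ` V) h"
  shows "smooth_fun_on A V (\<lambda>u. h (\<phi> u))"
  unfolding smooth_fun_on_def
proof safe
  fix U' \<phi>' assume U': "(U', \<phi>') \<in> A"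
  have inj: "inj_on \<phi>' U'"
    using chart_systemD(2)[OF smooth_manifold_chart_system[OF A] U'] .
  have "smooth_on (\<phi>' ` (U' \<inter> U)) (\<phi> \<circ> inv_into U' \<phi>')"
    using A U U' by (auto simp: smooth_manifold_def)
  then show "smooth_on (\<phi>' ` (U' \<inter> V)) ((\<lambda>u. h (\<phi> u)) \<circ> inv_into U' \<phi>')"
    using smooth_on_compose[OF chart_image_open[OF A U' V(1)] _ smooth_on_subset h, of "\<phi> \<circ> inv_into U' \<phi>'" "\<phi>' ` (U' \<inter> U)"]
      V(2) inj by (auto simp: o_def image_subset_iff inv_into_f_f image_mono)
qed

text \<open>Smoothness is tested on inverse charts, so smoothness of translations follows from the
  closure properties of \<open>smooth_param\<close>.\<close>

lemma smooth_mapI: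
  assumes A: "smooth_manifold A" and B: "chart_system B"
    and K: "\<And>U \<phi>. (U, \<phi>) \<in> A \<Longrightarrow> smooth_param B (\<phi> ` U) (\<lambda>x. K (inv_into U \<phi> x))"
  shows "smooth_map A B UNIV K"
  unfolding smooth_map_def
proof (safe)
  show "continuous_on UNIV K"
  proof (intro continuous_at_imp_continuous_on ballI)
    fix u
    obtain U \<phi> where U: "(U, \<phi>) \<in> A" "u \<in> U"
      using chart_system_cover[OF smooth_manifold_chart_system[OF A]] by metis
    note c = chart_systemD[OF smooth_manifold_chart_system[OF A] U(1)]
    have "continuous_on U (\<lambda>u. K (inv_into U \<phi> (\<phi> u)))"
      using continuous_on_compose2[OF smooth_paramD(2)[OF K[OF U(1)]] c(3)] by auto
    then have "continuous_on U K"
      using c(2) by (simp cong: continuous_on_cong)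
    then show "isCont K u"
      using c(1) U(2) continuous_on_eq_continuous_at by blast
  qed
  fix U \<phi> V \<psi> assume U: "(U, \<phi>) \<in> A" and V: "(V, \<psi>) \<in> B"
  have eq: "\<phi> ` (U \<inter> UNIV \<inter> K -` V) = \<phi> ` U \<inter> (\<lambda>x. K (inv_into U \<phi> x)) -` V"
    using chart_systemD(2)[OF smooth_manifold_chart_system[OF A] U] by (auto simp: inv_into_f_f)
  show "smooth_on (\<phi> ` (U \<inter> UNIV \<inter> K -` V)) (\<psi> \<circ> K \<circ> inv_into U \<phi>)"
    unfolding eq using smooth_paramD(3)[OF K[OF U] V] by (simp add: o_def)
qed

lemma smooth_fun_on_pullback:
  fixes A :: "('a::{t2_space,second_countable_topology}, 'm::euclidean_space) atlas"
    and B :: "('b::topological_space, 'n::euclidean_space) atlas"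
  assumes A: "smooth_manifold A" and B: "chart_system B" and K: "smooth_map A B UNIV K"
    and f: "smooth_fun_on B W f" "open W" and V: "open V" "K ` V \<subseteq> W"
  shows "smooth_fun_on A V (\<lambda>x. f (K x))"
  unfolding smooth_fun_on_def
proof safe
  fix U \<phi> assume U: "(U, \<phi>) \<in> A"
  have "smooth_param A (\<phi> ` (U \<inter> V)) (inv_into U \<phi>)"
    by (rule smooth_param_subset[OF chart_inverse_param[OF A U] chart_image_open[OF A U V(1)]]) auto
  then have "smooth_param B (\<phi> ` (U \<inter> V)) (\<lambda>x. K (inv_into U \<phi> x))"
    using smooth_map_param[OF smooth_manifold_chart_system[OF A] B K open_UNIV] by simp
  then show "smooth_on (\<phi> ` (U \<inter> V)) ((\<lambda>x. f (K x)) \<circ> inv_into U \<phi>)"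
    unfolding o_def using V(2) chart_systemD(2)[OF smooth_manifold_chart_system[OF A] U]
    by (intro smooth_fun_param[OF B f]) (auto simp: inv_into_f_f)
qed

section \<open>Germs and derivations\<close>

lemma smooth_near_const: "smooth_manifold A \<Longrightarrow> smooth_near A u (\<lambda>x. c)"
  unfolding smooth_near_def using smooth_fun_on_const by blast

lemma smooth_near_Int:
  assumes "smooth_near A u f" "smooth_near A u g"
  obtains W where "open W" "u \<in> W" "smooth_fun_on A W f" "smooth_fun_on A W g"
proof -
  from assms obtain V W where "open V" "u \<in> V" "smooth_fun_on A V f" "open W" "u \<in> W" "smooth_fun_on A W g"
    unfolding smooth_near_def by blast
  then show ?thesis
    by (intro that[of "V \<inter> W"]) (auto intro: smooth_fun_on_subset)
qed

lemma smooth_near_add: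
  "smooth_manifold A \<Longrightarrow> smooth_near A u f \<Longrightarrow> smooth_near A u g \<Longrightarrow> smooth_near A u (\<lambda>x. f x + g x)"
  by (metis smooth_near_Int smooth_near_def smooth_fun_on_add)

lemma smooth_near_mult:
  "smooth_manifold A \<Longrightarrow> smooth_near A u f \<Longrightarrow> smooth_near A u g \<Longrightarrow> smooth_near A u (\<lambda>x. f x * g x)"
  by (metis smooth_near_Int smooth_near_def smooth_fun_on_mult)

lemma smooth_near_sum:
  "smooth_manifold A \<Longrightarrow> (\<And>i. i \<in> I \<Longrightarrow> smooth_near A u (f i)) \<Longrightarrow> smooth_near A u (\<lambda>x. \<Sum>i\<in>I. f i x)"
  by (induction I rule: infinite_finite_induct) (auto intro: smooth_near_const smooth_near_add)

lemma smooth_near_cong: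
  assumes "smooth_manifold A" "smooth_near A u f" "open W" "u \<in> W" "\<And>x. x \<in> W \<Longrightarrow> f x = g x"
  shows "smooth_near A u g"
proof -
  from assms(2) obtain V where V: "open V" "u \<in> V" "smooth_fun_on A V f"
    unfolding smooth_near_def by blast
  have "smooth_fun_on A (V \<inter> W) g"
    using assms V by (intro smooth_fun_on_cong[OF assms(1) smooth_fun_on_subset[OF V(3)]]) auto
  then show ?thesis
    unfolding smooth_near_def using assms V by blast
qed

lemma tangent_spaceD:
  assumes "\<xi> \<in> tangent_space A u"
  shows "\<not> smooth_near A u f \<Longrightarrow> \<xi> f = 0"
    and "smooth_near A u f \<Longrightarrow> \<xi> (\<lambda>x. c * f x) = c * \<xi> f"
    and "smooth_near A u f \<Longrightarrow> smooth_near A u g \<Longrightarrow> \<xi> (\<lambda>x. f x + g x) = \<xi> f + \<xi> g"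
    and "smooth_near A u f \<Longrightarrow> smooth_near A u g \<Longrightarrow> \<xi> (\<lambda>x. f x * g x) = f u * \<xi> g + g u * \<xi> f"
  using assms by (auto simp: tangent_space_def)

lemma tangent_const:
  assumes "smooth_manifold A" and \<xi>: "\<xi> \<in> tangent_space A u"
  shows "\<xi> (\<lambda>x. c) = 0"
  using tangent_spaceD(4)[OF \<xi> smooth_near_const smooth_near_const, of 1 1]
    tangent_spaceD(2)[OF \<xi> smooth_near_const, of c 1] assms(1) by simp

text \<open>The Leibniz rule for \<open>\<chi> * \<chi> = \<chi>\<close>, with \<open>\<chi>\<close> the indicator of a neighbourhood,
  forces \<open>\<xi> \<chi> = 0\<close>, so \<open>\<xi> f = \<xi> (f * \<chi>)\<close>.\<close>
lemma tangent_local: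
  assumes A: "smooth_manifold A" and \<xi>: "\<xi> \<in> tangent_space A u" and f: "smooth_near A u f"
    and W: "open W" "u \<in> W" "\<And>x. x \<in> W \<Longrightarrow> f x = g x"
  shows "\<xi> f = \<xi> g"
proof -
  let ?\<chi> = "\<lambda>x. indicat_real W x"
  have \<chi>: "smooth_near A u ?\<chi>"
    by (rule smooth_near_cong[OF A smooth_near_const[OF A, of u 1] W(1,2)]) simp
  have g: "smooth_near A u g"
    by (rule smooth_near_cong[OF A f W])
  have "(\<lambda>x. ?\<chi> x * ?\<chi> x) = ?\<chi>"
    by (auto simp: indicator_def)
  then have "\<xi> ?\<chi> = 0"
    using tangent_spaceD(4)[OF \<xi> \<chi> \<chi>] W(2) by simp
  moreover have "(\<lambda>x. f x * ?\<chi> x) = (\<lambda>x. g x * ?\<chi> x)"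
    using W(3) by (auto simp: indicator_def)
  ultimately show ?thesis
    using tangent_spaceD(4)[OF \<xi> f \<chi>] tangent_spaceD(4)[OF \<xi> g \<chi>] W(2) by simp
qed

lemma tangent_sum:
  assumes "smooth_manifold A" and \<xi>: "\<xi> \<in> tangent_space A u" and "\<And>i. i \<in> I \<Longrightarrow> smooth_near A u (f i)"
  shows "\<xi> (\<lambda>x. \<Sum>i\<in>I. f i x) = (\<Sum>i\<in>I. \<xi> (f i))"
  using assms(3) by (induction I rule: infinite_finite_induct)
    (auto simp: tangent_const[OF assms(1,2)] tangent_spaceD(3)[OF \<xi>] smooth_near_sum[OF assms(1)])

lemma tangent_lincomb:
  assumes "smooth_manifold A" and "\<xi> \<in> tangent_space A u" "\<eta> \<in> tangent_space A u"
  shows "(\<lambda>f. a * \<xi> f + b * \<eta> f) \<in> tangent_space A u"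
  using assms by (auto simp: tangent_space_def algebra_simps)

text \<open>The differential of \<open>F\<close> at \<open>x\<close>, with the default value 0 that
  \<open>tangent_space\<close> prescribes on functions that are not smooth near the point.\<close>

definition push ::
  "('a::topological_space, 'm::real_normed_vector) atlas \<Rightarrow> ('n::real_normed_vector \<Rightarrow> 'a) \<Rightarrow> 'n \<Rightarrow> 'n \<Rightarrow> 'a tangent" where
  "push A F x v = (\<lambda>f. if smooth_near A (F x) f then frechet_derivative (\<lambda>y. f (F y)) (at x) v else 0)"

lemma smooth_near_param:
  fixes A :: "('a::topological_space, 'm::euclidean_space) atlas"
  assumes A: "chart_system A" and F: "smooth_param A S F" "x \<in> S" and f: "smooth_near A (F x) f"
  obtains T where "open T" "x \<in> T" "T \<subseteq> S" "smooth_on T (\<lambda>y. f (F y))"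
proof -
  from f obtain W where W: "open W" "F x \<in> W" "smooth_fun_on A W f"
    unfolding smooth_near_def by blast
  have o: "open (S \<inter> F -` W)"
    by (rule smooth_paramD(4)[OF F(1) W(1)])
  have "smooth_on (S \<inter> F -` W) (\<lambda>y. f (F y))"
    by (rule smooth_fun_param[OF A W(3,1) smooth_param_subset[OF F(1) o]]) auto
  with o F(2) W(2) show ?thesis
    by (intro that) auto
qed

lemma push_has_derivative:
  fixes A :: "('a::topological_space, 'm::euclidean_space) atlas"
  assumes A: "chart_system A" and F: "smooth_param A S F" "x \<in> S" and f: "smooth_near A (F x) f"
  shows "((\<lambda>y. f (F y)) has_derivative (\<lambda>v. push A F x v f)) (at x)"
proof -
  obtain T where "open T" "x \<in> T" "T \<subseteq> S" "smooth_on T (\<lambda>y. f (F y))"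
    by (rule smooth_near_param[OF assms])
  then show ?thesis
    using smooth_onD(1) f by (fastforce simp: push_def)
qed

lemma push_eqI:
  fixes A :: "('a::topological_space, 'm::euclidean_space) atlas"
  assumes A: "chart_system A" and F: "smooth_param A S F" "x \<in> S" and f: "smooth_near A (F x) f"
    and D: "((\<lambda>y. f (F y)) has_derivative D) (at x)"
  shows "push A F x v f = D v"
  using has_derivative_unique[OF push_has_derivative[OF A F f] D] by metis

lemma push_linear:
  fixes A :: "('a::topological_space, 'm::euclidean_space) atlas"
  assumes A: "chart_system A" and F: "smooth_param A S F" "x \<in> S"
  shows "push A F x (a *\<^sub>R v + b *\<^sub>R w) = (\<lambda>f. a * push A F x v f + b * push A F x w f)"
proof
  fix f
  show "push A F x (a *\<^sub>R v + b *\<^sub>R w) f = a * push A F x v f + b * push A F x w f"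
  proof (cases "smooth_near A (F x) f")
    case True
    then have lin: "linear (\<lambda>v. push A F x v f)"
      using has_derivative_linear[OF push_has_derivative[OF A F]] by blast
    show ?thesis
      using linear_add[OF lin, of "a *\<^sub>R v" "b *\<^sub>R w"] linear_scale[OF lin, of a v] linear_scale[OF lin, of b w]
      by simp
  qed (simp add: push_def)
qed

lemma push_in_tangent_space:
  fixes A :: "('a::{t2_space,second_countable_topology}, 'm::euclidean_space) atlas"
  assumes A: "smooth_manifold A" and F: "smooth_param A S F" "x \<in> S"
  shows "push A F x v \<in> tangent_space A (F x)"
  unfolding tangent_space_def
proof (intro CollectI conjI allI impI)
  note cs = smooth_manifold_chart_system[OF A]
  show "push A F x v f = 0" if "\<not> smooth_near A (F x) f" for f
    using that by (simp add: push_def)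
  fix f assume f: "smooth_near A (F x) f"
  note df = push_has_derivative[OF cs F f]
  show "push A F x v (\<lambda>x. c * f x) = c * push A F x v f" for c
    using smooth_near_mult[OF A smooth_near_const[OF A] f]
    by (intro push_eqI[OF cs F]) (auto intro!: derivative_eq_intros df)
  fix g assume g: "smooth_near A (F x) g"
  note dg = push_has_derivative[OF cs F g]
  show "push A F x v (\<lambda>x. f x + g x) = push A F x v f + push A F x v g"
    using smooth_near_add[OF A f g]
    by (intro push_eqI[OF cs F]) (auto intro!: derivative_eq_intros df dg)
  show "push A F x v (\<lambda>x. f x * g x) = f (F x) * push A F x v g + g (F x) * push A F x v f"
    using smooth_near_mult[OF A f g]
    by (subst push_eqI[OF cs F _ has_derivative_mult[OF df dg]]) (auto simp: algebra_simps)
qed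

lemma velocity_eq_push:
  fixes A :: "('a::topological_space, 'm::euclidean_space) atlas"
  assumes A: "chart_system A" and c: "smooth_param A S c" "0 \<in> S"
  shows "velocity A c = push A c 0 1"
proof
  fix f
  show "velocity A c f = push A c 0 1 f"
  proof (cases "smooth_near A (c 0) f")
    case True
    have "((\<lambda>t. f (c t)) has_real_derivative push A c 0 1 f) (at 0)"
      by (rule has_real_derivative_of_has_derivative[OF push_has_derivative[OF A c True]])
    then show ?thesis
      using True by (simp add: velocity_def o_def DERIV_imp_deriv)
  qed (simp add: velocity_def push_def)
qed

lemma smooth_vector_field_param:
  fixes A :: "('a::{t2_space,second_countable_topology}, 'm::euclidean_space) atlas"
  assumes "smooth_vector_field A W X" "open W" "u \<in> W" "smooth_near A u f"
  obtains V where "open V" "u \<in> V" "V \<subseteq> W" "smooth_fun_on A V f" "smooth_fun_on A V (\<lambda>u. X u f)"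
proof -
  from assms(4) obtain V where "open V" "u \<in> V" "smooth_fun_on A V f"
    unfolding smooth_near_def by blast
  then show ?thesis
    using assms by (intro that[of "V \<inter> W"])
      (auto simp: smooth_vector_field_def intro: smooth_fun_on_subset elim!: allE[of _ "V \<inter> W"])
qed

lemma smooth_vector_field_near:
  fixes A :: "('a::{t2_space,second_countable_topology}, 'm::euclidean_space) atlas"
  assumes "smooth_vector_field A W X" "open W" "u \<in> W" "smooth_near A u f"
  shows "smooth_near A u (\<lambda>u. X u f)"
  using smooth_vector_field_param[OF assms] unfolding smooth_near_def by metis

lemma smooth_vector_field_chart:
  fixes A :: "('a::{t2_space,second_countable_topology}, 'm::euclidean_space) atlas"
  assumes A: "smooth_manifold A" and U: "(U, \<phi>) \<in> A"
  shows "smooth_vector_field A U (\<lambda>u. push A (inv_into U \<phi>) (\<phi> u) v)"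
  unfolding smooth_vector_field_def
proof (intro conjI ballI allI impI)
  note cs = smooth_manifold_chart_system[OF A]
  note c = chart_systemD[OF cs U] and p = chart_inverse_param[OF A U]
  have inv: "inv_into U \<phi> (\<phi> u) = u" if "u \<in> U" for u
    using that c(2) by simp
  show "push A (inv_into U \<phi>) (\<phi> u) v \<in> tangent_space A u" if "u \<in> U" for u
    using push_in_tangent_space[OF A p, of "\<phi> u" v] that inv by auto
  fix V f assume V: "open V \<and> V \<subseteq> U \<and> smooth_fun_on A V f"
  then have o: "open (\<phi> ` V)" using c(4) by blast
  have "smooth_on (\<phi> ` V) (\<lambda>x. f (inv_into U \<phi> x))"
    using V inv by (intro smooth_fun_param[OF cs _ _ smooth_param_subset[OF p o]]) auto
  from smooth_fun_on_chart[OF A U _ _ smooth_onD(2)[OF this]] V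
  have "smooth_fun_on A V (\<lambda>u. frechet_derivative (\<lambda>x. f (inv_into U \<phi> x)) (at (\<phi> u)) v)"
    by simp
  moreover have "smooth_near A u f" if "u \<in> V" for u
    using that V unfolding smooth_near_def by blast
  ultimately show "smooth_fun_on A V (\<lambda>u. push A (inv_into U \<phi>) (\<phi> u) v f)"
    using V inv by (elim smooth_fun_on_cong[OF A]) (auto simp: push_def subset_iff)
qed

text \<open>The coordinate functions of the chart are smooth near \<open>u\<close> and recover the
  components of \<open>v\<close>. Injectivity of the chart differential is all that is proved here;
  that it reaches every tangent vector is deduced later by counting dimensions through the Cartan
  connection.\<close>

lemma push_chart_eq_0:
  fixes A :: "('a::{t2_space,second_countable_topology}, 'm::euclidean_space) atlas"
  assumes A: "smooth_manifold A" and U: "(U, \<phi>) \<in> A" "u \<in> U"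
    and 0: "push A (inv_into U \<phi>) (\<phi> u) v = (\<lambda>f. 0)"
  shows "v = 0"
proof (rule euclidean_eqI)
  fix b :: 'm assume "b \<in> Basis"
  note cs = smooth_manifold_chart_system[OF A]
  note c = chart_systemD[OF cs U(1)] and p = chart_inverse_param[OF A U(1)]
  have o: "open (\<phi> ` U)" using c(1,4) by blast
  have inv: "inv_into U \<phi> (\<phi> u) = u"
    using U(2) c(2) by simp
  have "smooth_on (\<phi> ` U) (\<lambda>x. x \<bullet> b)"
    by (intro smooth_on_bounded_linear_comp[OF bounded_linear_inner_left] o smooth_on_id)
  then have "smooth_fun_on A U (\<lambda>u. \<phi> u \<bullet> b)"
    by (rule smooth_fun_on_chart[OF A U(1) c(1) order_refl])
  then have near: "smooth_near A (inv_into U \<phi> (\<phi> u)) (\<lambda>u. \<phi> u \<bullet> b)"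
    unfolding smooth_near_def inv using c(1) U(2) by blast
  have "((\<lambda>x. x \<bullet> b) has_derivative (\<lambda>v. v \<bullet> b)) (at (\<phi> u))"
    by (auto intro!: derivative_eq_intros)
  then have "((\<lambda>x. \<phi> (inv_into U \<phi> x) \<bullet> b) has_derivative (\<lambda>v. v \<bullet> b)) (at (\<phi> u))"
    by (rule has_derivative_transform_within_open[OF _ o])
      (use U(2) in \<open>auto simp: f_inv_into_f\<close>)
  from push_eqI[OF cs p _ near this, of v] show "v \<bullet> b = 0 \<bullet> b"
    using U(2) 0 by simp
qed

section \<open>Finite-dimensional values seen through linear functionals\<close>

text \<open>The representation space is a bare vector space without norm or inner product, so
  coordinates relative to a finite basis take the place of \<open>Basis\<close>.\<close>

lemma fin_dim_coordinates:
  assumes "fin_dim (UNIV :: 'w::real_vector set)"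
  shows "\<exists>(B :: 'w set) (r :: 'w \<Rightarrow> 'w \<Rightarrow> real).
    finite B \<and> (\<forall>b. linear (r b)) \<and> (\<forall>w. (\<Sum>b\<in>B. r b w *\<^sub>R b) = w)"
proof -
  obtain B0 :: "'w set" where B0: "finite B0" "span B0 = UNIV"
    using assms by (auto simp: fin_dim_def)
  then obtain B where B: "B \<subseteq> B0" "independent B" "span B = UNIV"
    using maximal_independent_subset[of B0] span_eq[of B] span_mono
    by (metis span_superset top.extremum_uniqueI span_span span_mono)
  then have fin: "finite B" using B0 finite_subset by blast
  have "linear (\<lambda>w. representation B w b)" for b
    using B by (intro linearI) (simp_all add: representation_add representation_scale)
  moreover have "(\<Sum>b\<in>B. representation B w b *\<^sub>R b) = w" for w
    using sum_representation_eq[OF B(2) _ fin order_refl, of w] B(3) by simp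
  ultimately show ?thesis
    using fin by (intro exI[of _ B] exI[of _ "\<lambda>b w. representation B w b"]) blast
qed

lemma sum_coordinates_functional:
  fixes m :: "'w::real_vector \<Rightarrow> real"
  assumes "\<And>w. (\<Sum>b\<in>B. r b w *\<^sub>R b) = w" and m: "linear m"
  shows "(\<Sum>b\<in>B. r b w * m b) = m w"
  using assms(1)[of w] linear_sum[OF m, of "\<lambda>b. r b w *\<^sub>R b" B] by (simp add: linear_scale[OF m])

lemma linear_functionals_separate:
  fixes v w :: "'w::real_vector"
  assumes "fin_dim (UNIV :: 'w set)" "\<And>l :: 'w \<Rightarrow> real. linear l \<Longrightarrow> l v = l w"
  shows "v = w"
proof -
  obtain B :: "'w set" and r where B: "\<And>b. linear (r b)" "\<And>w. (\<Sum>b\<in>B. r b w *\<^sub>R b) = w"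
    using fin_dim_coordinates[OF assms(1)] by blast
  have "(\<Sum>b\<in>B. r b v *\<^sub>R b) = (\<Sum>b\<in>B. r b w *\<^sub>R b)"
    using assms(2)[OF B(1)] by simp
  then show ?thesis
    unfolding B(2) .
qed

lemma fin_dim_euclidean: "fin_dim (UNIV :: 'a::euclidean_space set)"
  unfolding fin_dim_def by (intro exI[of _ Basis]) auto

definition vnear :: "('a::topological_space, 'm::real_normed_vector) atlas \<Rightarrow> 'a \<Rightarrow> ('a \<Rightarrow> 'w::real_vector) \<Rightarrow> bool" where
  "vnear A u \<sigma> \<longleftrightarrow> (\<forall>l :: 'w \<Rightarrow> real. linear l \<longrightarrow> smooth_near A u (\<lambda>v. l (\<sigma> v)))"

lemma vnear_vsmooth_on: "vsmooth_on A W \<sigma> \<Longrightarrow> open W \<Longrightarrow> u \<in> W \<Longrightarrow> vnear A u \<sigma>"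
  unfolding vnear_def vsmooth_on_def smooth_near_def o_def by blast

text \<open>The description in \<open>vderiv\<close> is met by the vector whose coordinates are the
  derivatives of the coordinates of \<open>\<sigma>\<close>. It is unique because functionals
  separate points.\<close>

lemma linear_vderiv:
  fixes \<sigma> :: "'a::{t2_space,second_countable_topology} \<Rightarrow> 'w::real_vector" and l :: "'w \<Rightarrow> real"
  assumes w: "fin_dim (UNIV :: 'w set)" and A: "smooth_manifold A"
    and \<xi>: "\<xi> \<in> tangent_space A u" and \<sigma>: "vnear A u \<sigma>" and l: "linear l"
  shows "l (vderiv \<xi> \<sigma>) = \<xi> (\<lambda>v. l (\<sigma> v))"
proof -
  obtain B :: "'w set" and r where B: "finite B" "\<And>b. linear (r b)" "\<And>w. (\<Sum>b\<in>B. r b w *\<^sub>R b) = w"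
    using fin_dim_coordinates[OF w] by blast
  define w0 where "w0 = (\<Sum>b\<in>B. \<xi> (\<lambda>v. r b (\<sigma> v)) *\<^sub>R b)"
  have near: "smooth_near A u (\<lambda>v. r b (\<sigma> v))" for b
    using \<sigma> B(2) by (simp add: vnear_def)
  have w0: "l w0 = \<xi> (\<lambda>v. l (\<sigma> v))" if "linear l" for l :: "'w \<Rightarrow> real"
  proof -
    have "l (\<sigma> v) = (\<Sum>b\<in>B. l b * r b (\<sigma> v))" for v
      using sum_coordinates_functional[OF B(3) that, of "\<sigma> v"] by (simp add: mult.commute)
    then have "\<xi> (\<lambda>v. l (\<sigma> v)) = (\<Sum>b\<in>B. \<xi> (\<lambda>v. l b * r b (\<sigma> v)))"
      using tangent_sum[OF A \<xi>, of B "\<lambda>b v. l b * r b (\<sigma> v)"] smooth_near_mult[OF A smooth_near_const[OF A] near]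
      by simp
    also have "\<dots> = (\<Sum>b\<in>B. l b * \<xi> (\<lambda>v. r b (\<sigma> v)))"
      using tangent_spaceD(2)[OF \<xi> near] by simp
    also have "\<dots> = l w0"
      by (simp add: w0_def linear_sum[OF that] linear_scale[OF that] mult.commute)
    finally show ?thesis by simp
  qed
  have "vderiv \<xi> \<sigma> = w0"
    unfolding vderiv_def o_def
  proof (rule the_equality)
    show "w = w0" if "\<forall>l. linear l \<longrightarrow> l w = \<xi> (\<lambda>x. l (\<sigma> x))" for w
      using that w0 by (intro linear_functionals_separate[OF w]) auto
  qed (use w0 in auto)
  with w0[OF l] show ?thesis by simp
qed

lemma vderiv_eqI:
  fixes \<sigma> :: "'a::{t2_space,second_countable_topology} \<Rightarrow> 'w::real_vector"
  assumes w: "fin_dim (UNIV :: 'w set)" and A: "smooth_manifold A"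
    and \<xi>: "\<xi> \<in> tangent_space A u" and \<sigma>: "vnear A u \<sigma>"
    and "\<And>l :: 'w \<Rightarrow> real. linear l \<Longrightarrow> l w = \<xi> (\<lambda>v. l (\<sigma> v))"
  shows "vderiv \<xi> \<sigma> = w"
  using linear_vderiv[OF w A \<xi> \<sigma>] assms(5) by (intro linear_functionals_separate[OF w]) simp


section \<open>Nilradicals and parabolic subalgebras\<close>

lemma bracket_span_minimal:
  "subspace V \<Longrightarrow> (\<And>x y. x \<in> S \<Longrightarrow> y \<in> T \<Longrightarrow> br x y \<in> V) \<Longrightarrow> bracket_span br S T \<subseteq> V"
  unfolding bracket_span_def by (intro span_minimal) auto

lemma bracket_span_base: "x \<in> S \<Longrightarrow> y \<in> T \<Longrightarrow> br x y \<in> bracket_span br S T"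
  unfolding bracket_span_def by (intro span_base) blast

lemma subspace_bracket_span: "subspace (bracket_span br S T)"
  unfolding bracket_span_def by (rule subspace_span)

lemma lie_ideal_nilradical:
  assumes br: "bilinear br" and S: "lie_subalgebra br S"
  shows "lie_ideal br (nilradical br S) S"
  unfolding lie_ideal_def
proof (intro conjI ballI)
  let ?U = "\<Union>{I. lie_ideal br I S \<and> lie_nilpotent br I}"
  show "subspace (nilradical br S)"
    by (simp add: nilradical_def)
  show "nilradical br S \<subseteq> S"
    unfolding nilradical_def using S
    by (intro span_minimal) (auto simp: lie_ideal_def lie_subalgebra_def)
  fix x y assume x: "x \<in> S" and y: "y \<in> nilradical br S"
  have lin: "linear (br x)"
    using br by (simp add: bilinear_def)
  have "br x ` nilradical br S = span (br x ` ?U)"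
    unfolding nilradical_def by (rule linear_span_image[OF lin, symmetric])
  also have "\<dots> \<subseteq> nilradical br S"
    unfolding nilradical_def using x by (intro span_mono) (auto simp: lie_ideal_def)
  finally show "br x y \<in> nilradical br S"
    using y by blast
qed

lemma iterated_bracket_span_subset:
  assumes "lie_ideal br I S"
  shows "((\<lambda>T. bracket_span br I T) ^^ n) I \<subseteq> I"
proof (induction n)
  case (Suc n)
  have "bracket_span br I (((\<lambda>T. bracket_span br I T) ^^ n) I) \<subseteq> I"
    using assms Suc by (intro bracket_span_minimal) (auto simp: lie_ideal_def)
  then show ?case by simp
qed simp

text \<open>An automorphism of \<open>S\<close> maps nilpotent ideals to nilpotent ideals, since it
  carries the lower central series of an ideal to that of the image. Multiplicativity is assumed on
  \<open>S\<close> only, so the series is kept inside the ideal throughout.\<close>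

lemma nilradical_image_subset:
  assumes f: "linear f" and S: "f ` S = S" and hom: "\<And>x y. x \<in> S \<Longrightarrow> y \<in> S \<Longrightarrow> f (br x y) = br (f x) (f y)"
  shows "f ` nilradical br S \<subseteq> nilradical br S"
proof -
  have "lie_ideal br (f ` I) S \<and> lie_nilpotent br (f ` I)" if I: "lie_ideal br I S" "lie_nilpotent br I" for I
  proof
    show "lie_ideal br (f ` I) S"
      unfolding lie_ideal_def
    proof (intro conjI ballI)
      show "subspace (f ` I)"
        using I f by (simp add: lie_ideal_def linear_subspace_image)
      show "f ` I \<subseteq> S"
        using I S by (auto simp: lie_ideal_def)
      fix x y assume "x \<in> S" "y \<in> f ` I"
      then obtain x' y' where "x' \<in> S" "x = f x'" "y' \<in> I" "y = f y'"
        using S by blast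
      moreover have "br x' y' \<in> I" "f (br x' y') = br (f x') (f y')"
        using I hom[of x' y'] \<open>x' \<in> S\<close> \<open>y' \<in> I\<close> by (auto simp: lie_ideal_def)
      ultimately show "br x y \<in> f ` I"
        by (metis imageI)
    qed
    define C where "C n = ((\<lambda>T. bracket_span br I T) ^^ n) I" for n
    have CI: "C n \<subseteq> I" for n
      unfolding C_def by (rule iterated_bracket_span_subset[OF I(1)])
    have "((\<lambda>T. bracket_span br (f ` I) T) ^^ n) (f ` I) = f ` C n" for n
    proof (induction n)
      case (Suc n)
      have "{br x y |x y. x \<in> f ` I \<and> y \<in> f ` C n} = f ` {br x y |x y. x \<in> I \<and> y \<in> C n}" (is "?L = ?R")
      proof -
        have eq: "br (f x) (f y) = f (br x y)" if "x \<in> I" "y \<in> C n" for x y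
          using hom[of x y] I that CI[of n] unfolding lie_ideal_def by (metis subsetD)
        show ?thesis
        proof (intro equalityI subsetI)
          fix z assume "z \<in> ?L"
          then obtain x y where "x \<in> I" "y \<in> C n" "z = br (f x) (f y)" by blast
          with eq[of x y] show "z \<in> ?R" by blast
        next
          fix z assume "z \<in> ?R"
          then obtain x y where xy: "x \<in> I" "y \<in> C n" "z = f (br x y)" by blast
          with eq[of x y] have "z = br (f x) (f y)" by simp
          with xy show "z \<in> ?L" by blast
        qed
      qed
      then show ?case
        using Suc linear_span_image[OF f] by (simp add: C_def bracket_span_def)
    qed (simp add: C_def)
    moreover obtain n where "C n = {0}"
      using I by (auto simp: lie_nilpotent_def C_def)
    ultimately show "lie_nilpotent br (f ` I)"
      using linear_0[OF f] unfolding lie_nilpotent_def by (intro exI[of _ n]) simp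
  qed
  then show ?thesis
    unfolding nilradical_def linear_span_image[OF f, symmetric] by (intro span_mono) blast
qed

section \<open>Nilpotent ideals and Borel subalgebras\<close>

lemma bilinear_cplx_bracket:
  assumes "bilinear br"
  shows "bilinear (cplx_bracket br)"
  unfolding bilinear_def cplx_bracket_def
  by (auto intro!: linearI simp: bilinear_ladd[OF assms] bilinear_radd[OF assms] bilinear_lmul[OF assms]
      bilinear_rmul[OF assms] scaleR_diff_right scaleR_add_right split: prod.split)

text \<open>Adding the complexification of a nilpotent ideal to a Borel subalgebra keeps it solvable,
  so maximality of the Borel subalgebra absorbs the ideal.\<close>
lemma nilpotent_ideal_in_borel:
  fixes br :: "'l::real_vector \<Rightarrow> 'l \<Rightarrow> 'l"
  assumes la: "lie_algebra br" and p: "lie_subalgebra br p" and I: "lie_ideal br I p" "lie_nilpotent br I"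
    and b: "borel_subalgebra br b" "b \<subseteq> p \<times> p"
  shows "I \<times> I \<subseteq> b"
proof -
  let ?cb = "cplx_bracket br"
  let ?D = "\<lambda>T. bracket_span ?cb T T"
  define J where "J = I \<times> I"
  define s where "s = {x + y |x y. x \<in> b \<and> y \<in> J}"
  have bil: "bilinear br" using la by (simp add: lie_algebra_def)
  have anti: "br x y = - br y x" for x y
    using la by (intro alternating_bilinear_minus[OF bil]) (simp add: lie_algebra_def)
  note cbil = bilinear_cplx_bracket[OF bil]
  have subI: "subspace I" and Ip: "I \<subseteq> p" and idl: "\<And>x y. x \<in> p \<Longrightarrow> y \<in> I \<Longrightarrow> br x y \<in> I"
    using I by (auto simp: lie_ideal_def)
  have idl': "br y x \<in> I" if "x \<in> p" "y \<in> I" for x y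
    using idl[OF that] anti[of y x] subspace_neg[OF subI] by simp
  have sb: "subspace b" and bb: "\<And>x y. x \<in> b \<Longrightarrow> y \<in> b \<Longrightarrow> ?cb x y \<in> b"
    and ib: "\<And>x y. (x, y) \<in> b \<Longrightarrow> (- y, x) \<in> b"
    using b by (auto simp: borel_subalgebra_def cplx_subalgebra_def lie_subalgebra_def)
  have subJ: "subspace J"
    unfolding J_def using subI subI by (rule subspace_Times)
  have Jp: "J \<subseteq> p \<times> p" using Ip by (auto simp: J_def)
  have pJ: "?cb x y \<in> J" "?cb y x \<in> J" if "x \<in> p \<times> p" "y \<in> J" for x y
    using that idl idl' subspace_diff[OF subI] subspace_add[OF subI]
    by (auto simp: J_def cplx_bracket_def split: prod.split)
  have expand: "?cb (x + y) (x' + y') = ?cb x x' + (?cb x y' + ?cb y x' + ?cb y y')" for x y x' y'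
    by (simp add: bilinear_ladd[OF cbil] bilinear_radd[OF cbil])
  \<comment> \<open>Modulo \<open>J\<close> the bracket of two elements of \<open>b + J\<close> is
    that of their components in \<open>b\<close>, because \<open>J\<close> is an ideal in the
    complexification of \<open>p\<close>.\<close>
  have step: "\<exists>z\<in>J. ?cb (x + y) (x' + y') = ?cb x x' + z"
    if "x \<in> p \<times> p" "y \<in> J" "x' \<in> p \<times> p" "y' \<in> J" for x y x' y'
  proof -
    have "?cb x y' \<in> J" "?cb y x' \<in> J" "?cb y y' \<in> J"
      using that Jp by (blast intro: pJ)+
    then have "?cb x y' + ?cb y x' + ?cb y y' \<in> J"
      by (intro subspace_add[OF subJ])
    then show ?thesis
      unfolding expand by blast
  qed
  have "cplx_subalgebra br s"
    unfolding cplx_subalgebra_def lie_subalgebra_def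
  proof (intro conjI ballI)
    show "subspace s"
      unfolding s_def by (rule subspace_sums[OF sb subJ])
    show "?cb z z' \<in> s" if "z \<in> s" "z' \<in> s" for z z'
    proof -
      from that obtain x y x' y' where *: "x \<in> b" "y \<in> J" "x' \<in> b" "y' \<in> J" "z = x + y" "z' = x' + y'"
        by (auto simp: s_def)
      with step[of x y x' y'] b(2) obtain w where "w \<in> J" "?cb z z' = ?cb x x' + w"
        by blast
      with * bb show ?thesis unfolding s_def by blast
    qed
    show "case z of (x, y) \<Rightarrow> (- y, x) \<in> s" if "z \<in> s" for z
    proof -
      from that obtain x1 x2 y1 y2 where *: "(x1, x2) \<in> b" "(y1, y2) \<in> J" "z = (x1 + y1, x2 + y2)"
        unfolding s_def by force
      then have "(- x2, x1) \<in> b" "(- y2, y1) \<in> J"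
        using ib subspace_neg[OF subI] by (auto simp: J_def)
      then have "(- x2, x1) + (- y2, y1) \<in> s"
        unfolding s_def by blast
      then show ?thesis using * by simp
    qed
  qed
  moreover have "lie_solvable ?cb s"
  proof -
    obtain n where n: "(?D ^^ n) b = {0}"
      using b by (auto simp: borel_subalgebra_def lie_solvable_def)
    obtain m where m: "((\<lambda>T. bracket_span br I T) ^^ m) I = {0}"
      using I by (auto simp: lie_nilpotent_def)
    have Db: "(?D ^^ n) b \<subseteq> b" for n
    proof (induction n)
      case (Suc n)
      have "?D ((?D ^^ n) b) \<subseteq> b"
        using Suc bb by (intro bracket_span_minimal[OF sb]) blast
      then show ?case by simp
    qed simp
    \<comment> \<open>The derived series of \<open>s\<close> lies over that of \<open>b\<close>
      modulo \<open>J\<close>. Once the latter has reached \<open>{0}\<close>, the former is inside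
      \<open>J\<close>.\<close>
    have "(?D ^^ n) s \<subseteq> {x + y |x y. x \<in> (?D ^^ n) b \<and> y \<in> J}" for n
    proof (induction n)
      case 0
      then show ?case by (simp add: s_def)
    next
      case (Suc n)
      have "?D ((?D ^^ n) s) \<subseteq> {x + y |x y. x \<in> ?D ((?D ^^ n) b) \<and> y \<in> J}"
      proof (rule bracket_span_minimal[OF subspace_sums[OF subspace_bracket_span subJ]])
        fix z z' assume "z \<in> (?D ^^ n) s" "z' \<in> (?D ^^ n) s"
        then obtain x y x' y' where *: "x \<in> (?D ^^ n) b" "y \<in> J" "x' \<in> (?D ^^ n) b" "y' \<in> J" "z = x + y" "z' = x' + y'"
          using Suc by blast
        with step[of x y x' y'] Db b(2) obtain w where "w \<in> J" "?cb z z' = ?cb x x' + w"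
          by blast
        with * bracket_span_base[of x _ x' _ ?cb] show "?cb z z' \<in> {x + y |x y. x \<in> ?D ((?D ^^ n) b) \<and> y \<in> J}"
          by blast
      qed
      then show ?case by simp
    qed
    note reduced = this[of n, unfolded n]
    have sJ: "(?D ^^ n) s \<subseteq> J"
    proof
      fix z assume "z \<in> (?D ^^ n) s"
      then obtain x y where "x \<in> {0}" "y \<in> J" "z = x + y"
        using reduced by blast
      then show "z \<in> J" by simp
    qed
    define C where "C n = ((\<lambda>T. bracket_span br I T) ^^ n) I" for n
    have CI: "C n \<subseteq> I" for n
      unfolding C_def by (rule iterated_bracket_span_subset[OF I(1)])
    \<comment> \<open>From here on the derived series is dominated by the complexified lower central
      series of \<open>I\<close>, because brackets within \<open>C k\<close> are brackets of
      \<open>I\<close> with \<open>C k\<close>.\<close>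
    have "(?D ^^ k) ((?D ^^ n) s) \<subseteq> C k \<times> C k" for k
    proof (induction k)
      case 0
      then show ?case using sJ by (simp add: C_def J_def)
    next
      case (Suc k)
      have sub: "subspace (C (Suc k))"
        by (simp add: C_def subspace_bracket_span)
      have "?D ((?D ^^ k) ((?D ^^ n) s)) \<subseteq> C (Suc k) \<times> C (Suc k)"
      proof (rule bracket_span_minimal[OF subspace_Times[OF sub sub]])
        fix z z' assume "z \<in> (?D ^^ k) ((?D ^^ n) s)" "z' \<in> (?D ^^ k) ((?D ^^ n) s)"
        then have "z \<in> C k \<times> C k" "z' \<in> C k \<times> C k"
          using Suc by (simp_all only: subsetD)
        then obtain x y x' y' where *: "x \<in> C k" "y \<in> C k" "x' \<in> C k" "y' \<in> C k" "z = (x, y)" "z' = (x', y')"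
          by (cases z; cases z') auto
        have "br u v \<in> C (Suc k)" if "u \<in> C k" "v \<in> C k" for u v
        proof -
          have "br u v \<in> bracket_span br I (C k)"
            using that CI by (blast intro: bracket_span_base)
          then show ?thesis by (simp add: C_def)
        qed
        with * show "?cb z z' \<in> C (Suc k) \<times> C (Suc k)"
          using subspace_add[OF sub] subspace_diff[OF sub] by (simp add: cplx_bracket_def)
      qed
      then show ?case by simp
    qed
    from this[of m] have "(?D ^^ m) ((?D ^^ n) s) \<subseteq> {0}"
      using m by (auto simp: C_def zero_prod_def)
    then have "?cb x y \<in> {0}" if "x \<in> (?D ^^ m) ((?D ^^ n) s)" for x y
      using that bilinear_lzero[OF cbil] by blast
    then have "?D ((?D ^^ m) ((?D ^^ n) s)) \<subseteq> {0}"
      by (intro bracket_span_minimal subspace_single_0)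
    then have *: "(?D ^^ (Suc m + n)) s \<subseteq> {0}"
      by (simp add: funpow_add)
    \<comment> \<open>Solvability demands equality with \<open>{0}\<close>. The additional step
      \<open>Suc m\<close> makes the set a span, which contains 0.\<close>
    have "0 \<in> (?D ^^ (Suc m + n)) s"
      by (simp add: subspace_0 subspace_bracket_span)
    with * have "(?D ^^ (Suc m + n)) s = {0}" by blast
    then show ?thesis
      unfolding lie_solvable_def by blast
  qed
  moreover have "b \<subseteq> s"
  proof
    fix x assume "x \<in> b"
    then have "x + 0 \<in> s" using subspace_0[OF subJ] unfolding s_def by blast
    then show "x \<in> s" by simp
  qed
  ultimately have "s = b"
    using b unfolding borel_subalgebra_def by blast
  moreover have "J \<subseteq> s"
  proof
    fix y assume "y \<in> J"
    then have "0 + y \<in> s" using subspace_0[OF sb] unfolding s_def by blast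
    then show "y \<in> s" by simp
  qed
  ultimately show ?thesis
    by (simp add: J_def)
qed

text \<open>A Borel subalgebra in the complexification of \<open>q\<close> also lies in that of
  \<open>p\<close>. It therefore contains the complexification of every nilpotent ideal of
  \<open>p\<close>, and hence so does the complexification of \<open>q\<close>.\<close>

lemma nilradical_subset_parabolic:
  assumes la: "lie_algebra br" and p: "lie_subalgebra br p" and q: "parabolic_subalgebra br q" "q \<subseteq> p"
  shows "nilradical br p \<subseteq> q"
proof -
  obtain b where b: "borel_subalgebra br b" "b \<subseteq> q \<times> q" and sq: "subspace q"
    using q by (auto simp: parabolic_subalgebra_def lie_subalgebra_def)
  have "I \<subseteq> q" if "lie_ideal br I p" "lie_nilpotent br I" for I
    using nilpotent_ideal_in_borel[OF la p that b(1)] b(2) q(2) by blast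
  then show ?thesis
    unfolding nilradical_def using sq by (intro span_minimal) auto
qed


section \<open>One-parameter subgroups and the adjoint action\<close>

locale lie_group_loc =
  fixes G :: "('g::{t2_space,second_countable_topology}, 'l::euclidean_space, 'z) lie_grp_scheme" (structure)
  assumes lie_group: "lie_group G"
begin

abbreviation "\<A> \<equiv> grp_atlas G"
abbreviation "linv \<equiv> left_inv_vf G"

lemma manifold: "smooth_manifold \<A>" and charts: "chart_system \<A>"
  using lie_group by (auto simp: lie_group_def intro: smooth_manifold_chart_system)

lemma carrier [simp]: "carrier G = UNIV" and group: "group G"
  using lie_group by (auto simp: lie_group_def)

lemma m_assoc: "a \<otimes> b \<otimes> c = a \<otimes> (b \<otimes> c)"
  using group.is_monoid[OF group] monoid.m_assoc by fastforce

lemma group_simps [simp]: "\<one> \<otimes> a = a" "a \<otimes> \<one> = a" "inv a \<otimes> a = \<one>" "a \<otimes> inv a = \<one>"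
    "inv (inv a) = a" "inv \<one> = \<one>" "inv a \<otimes> (a \<otimes> b) = b" "a \<otimes> (inv a \<otimes> b) = b"
proof -
  interpret group G by (rule group)
  show "\<one> \<otimes> a = a" "a \<otimes> \<one> = a" "inv a \<otimes> a = \<one>" "a \<otimes> inv a = \<one>" "inv (inv a) = a" "inv \<one> = \<one>"
    by auto
  then show "inv a \<otimes> (a \<otimes> b) = b" "a \<otimes> (inv a \<otimes> b) = b"
    by (simp_all flip: lie_group_loc.m_assoc[OF lie_group_loc_axioms])
qed

lemma inv_mult: "inv (a \<otimes> b) = inv b \<otimes> inv a"
  using group.inv_mult_group[OF group] by simp

lemma smooth_param_mult:
  assumes "smooth_param \<A> S F" "smooth_param \<A> S H"
  shows "smooth_param \<A> S (\<lambda>x. F x \<otimes> H x)"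
proof -
  have "smooth_map (prod_atlas \<A> \<A>) \<A> UNIV (\<lambda>(g,h). g \<otimes> h)"
    using lie_group by (simp add: lie_group_def)
  from smooth_map_param[OF chart_system_prod[OF charts charts] charts this open_UNIV
      smooth_param_Pair[OF assms charts charts]]
  show ?thesis by simp
qed

lemma smooth_map_right_mult: "smooth_map \<A> \<A> UNIV (\<lambda>h. h \<otimes> g)"
  by (intro smooth_mapI manifold charts smooth_param_mult smooth_param_const chart_inverse_param[OF manifold]
      smooth_paramD(1)[OF chart_inverse_param[OF manifold]])

lemma smooth_near_mult_iff:
  "smooth_near \<A> (a \<otimes> u \<otimes> b) f \<longleftrightarrow> smooth_near \<A> u (\<lambda>h. f (a \<otimes> h \<otimes> b))"
proof -
  have pull: "smooth_near \<A> u (\<lambda>h. f (a \<otimes> h \<otimes> b))" if f: "smooth_near \<A> (a \<otimes> u \<otimes> b) f" for a u b f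
  proof -
    obtain W where W: "open W" "a \<otimes> u \<otimes> b \<in> W" "smooth_fun_on \<A> W f"
      using f unfolding smooth_near_def by blast
    have K: "smooth_map \<A> \<A> UNIV (\<lambda>h. a \<otimes> h \<otimes> b)"
      by (intro smooth_mapI manifold charts smooth_param_mult smooth_param_const chart_inverse_param[OF manifold]
          smooth_paramD(1)[OF chart_inverse_param[OF manifold]])
    then have "open ((\<lambda>h. a \<otimes> h \<otimes> b) -` W)"
      using W(1) by (auto simp: smooth_map_def intro: open_vimage)
    then show ?thesis
      unfolding smooth_near_def using W smooth_fun_on_pullback[OF manifold charts K W(3,1)]
      by (intro exI[of _ "(\<lambda>h. a \<otimes> h \<otimes> b) -` W"]) auto
  qed
  show ?thesis
  proof
    assume "smooth_near \<A> u (\<lambda>h. f (a \<otimes> h \<otimes> b))"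
    then have "smooth_near \<A> (inv a \<otimes> (a \<otimes> u \<otimes> b) \<otimes> inv b) (\<lambda>h. f (a \<otimes> h \<otimes> b))"
      by (simp add: m_assoc)
    from pull[OF this] show "smooth_near \<A> (a \<otimes> u \<otimes> b) f"
      by (simp add: m_assoc)
  qed (rule pull)
qed

lemma smooth_near_right_iff: "smooth_near \<A> (u \<otimes> b) f \<longleftrightarrow> smooth_near \<A> u (\<lambda>h. f (h \<otimes> b))"
  using smooth_near_mult_iff[of \<one> u b f] by simp

lemma smooth_near_left_iff: "smooth_near \<A> (a \<otimes> u) f \<longleftrightarrow> smooth_near \<A> u (\<lambda>h. f (a \<otimes> h))"
  using smooth_near_mult_iff[of a u \<one> f] by simp

lemma left_invariant_linv: "left_invariant G (linv x)"
  using lie_group unfolding lie_group_def bij_betw_def by blast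

lemma smooth_linv: "smooth_vector_field \<A> UNIV (linv x)"
  using left_invariant_linv by (simp add: left_invariant_def)

lemma linv_tangent: "linv x g \<in> tangent_space \<A> g"
  using smooth_linv by (simp add: smooth_vector_field_def)

lemma linv_left: "linv x (g \<otimes> h) f = linv x h (\<lambda>k. f (g \<otimes> k))"
  using left_invariant_linv by (simp add: left_invariant_def)

lemma linv_linear: "linv (a *\<^sub>R x + b *\<^sub>R y) g f = a * linv x g f + b * linv y g f"
  using lie_group by (simp add: lie_group_def)

lemma linear_linv: "linear (\<lambda>x. linv x g f)"
  by (rule linear_lincombI) (simp add: linv_linear)

lemma linv_bracket: "linv (lie_br G x y) = vf_bracket \<A> (linv x) (linv y)"
  using lie_group by (simp add: lie_group_def)

lemma lie_algebra_br: "lie_algebra (lie_br G)"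
  using lie_group by (simp add: lie_group_def)

text \<open>Left invariance propagates equality at the identity to the whole group. This is how
  identities in the Lie algebra are verified below.\<close>

lemma linv_one_inj:
  assumes "\<And>f. linv x \<one> f = linv y \<one> f"
  shows "x = y"
proof -
  have "linv x g f = linv y g f" for g f
    using linv_left[of x g \<one> f] linv_left[of y g \<one> f] assms by simp
  then have "linv x = linv y" by blast
  moreover have "inj linv"
    using lie_group by (simp add: lie_group_def bij_betw_def)
  ultimately show ?thesis by (simp add: inj_eq)
qed

text \<open>Pushing a left invariant field forward by the right translation by \<open>inv g\<close>
  gives a left invariant field again. Its generator meets the description in \<open>Ad\<close>, and
  \<open>Ad\<close> is thereby known at all points of the group, not just at the identity.\<close>

lemma linv_Ad: "linv (Ad G g x) h f = linv x (h \<otimes> g) (\<lambda>k. f (k \<otimes> inv g))"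
proof -
  define Z where "Z = (\<lambda>h f. linv x (h \<otimes> g) (\<lambda>k. f (k \<otimes> inv g)))"
  have near: "smooth_near \<A> (h \<otimes> g) (\<lambda>k. f (k \<otimes> inv g)) \<longleftrightarrow> smooth_near \<A> h f" for h f
    by (simp add: m_assoc flip: smooth_near_right_iff)
  have "left_invariant G Z"
    unfolding left_invariant_def smooth_vector_field_def
  proof (intro conjI ballI allI impI)
    show "Z h \<in> tangent_space \<A> h" for h
      using tangent_spaceD[OF linv_tangent[of x "h \<otimes> g"]] unfolding tangent_space_def Z_def
      by (auto simp: near m_assoc)
    show "Z (k \<otimes> h) f = Z h (\<lambda>x. f (k \<otimes> x))" for k h f
      by (simp add: Z_def m_assoc linv_left)
    fix V f assume V: "open V \<and> V \<subseteq> UNIV \<and> smooth_fun_on \<A> V f"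
    let ?V = "(\<lambda>k. k \<otimes> inv g) -` V"
    have o: "open ?V"
      using V smooth_map_right_mult[of "inv g"] by (auto simp: smooth_map_def intro: open_vimage)
    have "smooth_fun_on \<A> ?V (\<lambda>k. f (k \<otimes> inv g))"
      using V by (intro smooth_fun_on_pullback[OF manifold charts smooth_map_right_mult]) (auto simp: o)
    then have "smooth_fun_on \<A> ?V (\<lambda>k. linv x k (\<lambda>k. f (k \<otimes> inv g)))"
      using smooth_linv[of x] o by (simp add: smooth_vector_field_def)
    then show "smooth_fun_on \<A> V (\<lambda>h. Z h f)"
      unfolding Z_def using V o
      by (intro smooth_fun_on_pullback[OF manifold charts smooth_map_right_mult, where W = ?V]) (auto simp: m_assoc)
  qed
  then obtain y where y: "linv y = Z"
    using lie_group unfolding lie_group_def bij_betw_def by (metis (no_types, lifting) imageE mem_Collect_eq)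
  have y1: "linv y \<one> f = linv x \<one> (\<lambda>h. f (g \<otimes> h \<otimes> inv g))" for f
    using linv_left[of x g \<one>] unfolding y Z_def by simp
  have "Ad G g x = y"
    unfolding Ad_def
  proof (rule the_equality)
    show "z = y" if "\<forall>f. linv z \<one> f = linv x \<one> (\<lambda>h. f (g \<otimes> h \<otimes> inv g))" for z
      using that y1 by (intro linv_one_inj) simp
  qed (simp add: y1)
  with y show ?thesis
    by (simp add: Z_def)
qed

lemma Ad_one: "Ad G \<one> x = x"
  by (rule linv_one_inj) (simp add: linv_Ad)

lemma Ad_mult: "Ad G (g \<otimes> h) x = Ad G g (Ad G h x)"
  by (rule linv_one_inj) (simp add: linv_Ad m_assoc inv_mult)

lemma Ad_inv [simp]: "Ad G (inv g) (Ad G g x) = x" "Ad G g (Ad G (inv g) x) = x"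
  by (simp_all add: Ad_one flip: Ad_mult)

lemma linear_Ad: "linear (Ad G g)"
proof (rule linearI)
  show "Ad G g (x + y) = Ad G g x + Ad G g y" for x y
    by (rule linv_one_inj) (simp add: linv_Ad linear_add[OF linear_linv])
  show "Ad G g (c *\<^sub>R x) = c *\<^sub>R Ad G g x" for c x
    by (rule linv_one_inj) (simp add: linv_Ad linear_scale[OF linear_linv])
qed

lemma Ad_bracket: "Ad G g (lie_br G x y) = lie_br G (Ad G g x) (Ad G g y)"
proof (rule linv_one_inj)
  fix f
  have "smooth_near \<A> g (\<lambda>k. f (k \<otimes> inv g)) \<longleftrightarrow> smooth_near \<A> \<one> f"
    by (simp flip: smooth_near_right_iff)
  then show "linv (Ad G g (lie_br G x y)) \<one> f = linv (lie_br G (Ad G g x) (Ad G g y)) \<one> f"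
    by (simp add: linv_bracket linv_Ad vf_bracket_def m_assoc)
qed

section \<open>One-parameter subgroups\<close>

lemma additive_zero:
  assumes "\<And>s t :: real. c (s + t) = c s \<otimes> c t"
  shows "c 0 = \<one>"
proof -
  have "inv (c 0) \<otimes> (c 0 \<otimes> c 0) = inv (c 0) \<otimes> c 0"
    using assms[of 0 0] by simp
  then show ?thesis by (simp only: group_simps)
qed

lemma one_paramD:
  assumes "one_param G c x"
  shows "smooth_param \<A> UNIV c" "c (s + t) = c s \<otimes> c t" "c 0 = \<one>" "c (- t) = inv (c t)"
    "velocity \<A> c = linv x \<one>"
proof -
  have c: "smooth_map real_atlas \<A> UNIV c" "\<And>s t. c (s + t) = c s \<otimes> c t" "velocity \<A> c = linv x \<one>"
    using assms by (auto simp: one_param_def)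
  show "velocity \<A> c = linv x \<one>" "c (s + t) = c s \<otimes> c t" by (rule c)+
  show c0: "c 0 = \<one>"
    by (rule additive_zero[OF c(2)])
  have "c (- t) \<otimes> c t = \<one>"
    using c(2)[of "- t" t] c0 by simp
  then have "c (- t) \<otimes> c t \<otimes> inv (c t) = inv (c t)" by simp
  then show "c (- t) = inv (c t)" by (simp add: m_assoc)
  have "chart_system (real_atlas :: (real, real) atlas)"
    by (auto simp: chart_system_def real_atlas_def)
  moreover have "smooth_param real_atlas UNIV (\<lambda>x::real. x)"
    by (auto simp: smooth_param_def real_atlas_def smooth_on_id id_def)
  ultimately show "smooth_param \<A> UNIV c"
    using smooth_map_param[OF _ charts c(1) open_UNIV] by simp
qed

lemma linv_one_param:
  assumes c: "one_param G c x" and f: "smooth_near \<A> g f"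
  shows "((\<lambda>t. f (g \<otimes> c t)) has_real_derivative linv x g f) (at 0)"
proof -
  note c' = one_paramD[OF c]
  have near: "smooth_near \<A> (c 0) (\<lambda>k. f (g \<otimes> k))"
    using f by (simp add: c'(3) flip: smooth_near_left_iff)
  have "((\<lambda>t. f (g \<otimes> c t)) has_real_derivative push \<A> c 0 1 (\<lambda>k. f (g \<otimes> k))) (at 0)"
    by (rule has_real_derivative_of_has_derivative[OF push_has_derivative[OF charts c'(1) UNIV_I near]])
  moreover have "push \<A> c 0 1 = linv x \<one>"
    using velocity_eq_push[OF charts c'(1)] c'(5) by simp
  ultimately show ?thesis
    using linv_left[of x g \<one> f] by simp
qed

lemma one_paramI:
  assumes c: "smooth_param \<A> UNIV c" "\<And>s t. c (s + t) = c s \<otimes> c t"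
    and d: "\<And>f. smooth_near \<A> \<one> f \<Longrightarrow> ((\<lambda>t. f (c t)) has_real_derivative linv x \<one> f) (at 0)"
  shows "one_param G c x"
  unfolding one_param_def
proof (intro conjI allI)
  show "smooth_map real_atlas \<A> UNIV c"
  proof -
    have "(UNIV \<inter> UNIV \<inter> c -` V) = (UNIV \<inter> c -` V)" for V by auto
    then show ?thesis
      using c(1) unfolding smooth_map_def smooth_param_def real_atlas_def
      by (auto simp: o_def inv_into_def)
  qed
  have c0: "c 0 = \<one>"
    by (rule additive_zero[OF c(2)])
  show "velocity \<A> c = linv x \<one>"
    unfolding velocity_def c0 using DERIV_imp_deriv[OF d] tangent_spaceD(1)[OF linv_tangent[of x \<one>]]
    by (auto simp: o_def)
qed (rule c(2))

lemma one_param_scale: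
  assumes c: "one_param G c x"
  shows "one_param G (\<lambda>t. c (a * t)) (a *\<^sub>R x)"
proof (rule one_paramI)
  note c' = one_paramD[OF c]
  have "smooth_on UNIV (\<lambda>t. a * t)"
    by (rule smooth_on_bounded_linear_comp[OF bounded_linear_mult_right open_UNIV smooth_on_id]) simp
  then show "smooth_param \<A> UNIV (\<lambda>t. c (a * t))"
    by (rule smooth_param_compose[OF c'(1) _ open_UNIV _ charts]) simp
  show "c (a * (s + t)) = c (a * s) \<otimes> c (a * t)" for s t
    by (simp add: distrib_left c'(2))
  show "((\<lambda>t. f (c (a * t))) has_real_derivative linv (a *\<^sub>R x) \<one> f) (at 0)" if f: "smooth_near \<A> \<one> f" for f
  proof -
    have "((\<lambda>t. f (c t)) has_real_derivative linv x \<one> f) (at (a * 0))"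
      using linv_one_param[OF c f] by simp
    moreover have "((\<lambda>t. a * t) has_real_derivative a) (at 0)"
      by (auto intro!: derivative_eq_intros)
    ultimately have "((\<lambda>t. f (c (a * t))) has_real_derivative linv x \<one> f * a) (at 0)"
      by (rule DERIV_chain2[where f = "\<lambda>t. f (c t)" and g = "\<lambda>t. a * t"])
    then show ?thesis
      by (simp add: linear_scale[OF linear_linv] mult.commute)
  qed
qed

lemma one_param_conj:
  assumes c: "one_param G c x"
  shows "one_param G (\<lambda>t. g \<otimes> c t \<otimes> inv g) (Ad G g x)"
proof (rule one_paramI)
  note c' = one_paramD[OF c]
  show "smooth_param \<A> UNIV (\<lambda>t. g \<otimes> c t \<otimes> inv g)"
    by (intro smooth_param_mult smooth_param_const charts c'(1)) simp_all
  show "g \<otimes> c (s + t) \<otimes> inv g = g \<otimes> c s \<otimes> inv g \<otimes> (g \<otimes> c t \<otimes> inv g)" for s t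
    by (simp add: c'(2) m_assoc)
  show "((\<lambda>t. f (g \<otimes> c t \<otimes> inv g)) has_real_derivative linv (Ad G g x) \<one> f) (at 0)" if f: "smooth_near \<A> \<one> f" for f
  proof -
    have "smooth_near \<A> g (\<lambda>k. f (k \<otimes> inv g))"
      using f by (simp flip: smooth_near_right_iff)
    from linv_one_param[OF c this] show ?thesis
      by (simp add: linv_Ad)
  qed
qed

end

text \<open>The functionals for which the derivative is known form a subspace. The vectors
  representing a separating family span everything, since a vector orthogonal to all of them would
  be annihilated by the family.\<close>

lemma has_vector_derivative_functionals:
  fixes \<gamma> :: "real \<Rightarrow> 'l::euclidean_space" and \<Lambda> :: "('l \<Rightarrow> real) set"
  assumes lin: "\<And>m. m \<in> \<Lambda> \<Longrightarrow> linear m"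
    and sep: "\<And>z. (\<And>m. m \<in> \<Lambda> \<Longrightarrow> m z = 0) \<Longrightarrow> z = 0"
    and der: "\<And>m. m \<in> \<Lambda> \<Longrightarrow> ((\<lambda>t. m (\<gamma> t)) has_real_derivative m w) (at t)"
  shows "(\<gamma> has_vector_derivative w) (at t)"
proof -
  define S where "S = {a. ((\<lambda>t. a \<bullet> \<gamma> t) has_real_derivative a \<bullet> w) (at t)}"
  define R where "R = (\<lambda>m. \<Sum>b\<in>Basis. m b *\<^sub>R b) ` \<Lambda>"
  have rep: "(\<Sum>b\<in>Basis. m b *\<^sub>R b) \<bullet> z = m z" if "m \<in> \<Lambda>" for m z
  proof -
    have "(\<Sum>b\<in>Basis. m b *\<^sub>R b) \<bullet> z = (\<Sum>b\<in>Basis. m b * (b \<bullet> z))"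
      by (simp add: inner_sum_left)
    also have "\<dots> = (\<Sum>b\<in>Basis. (z \<bullet> b) *\<^sub>R m b)"
      by (intro sum.cong) (auto simp: inner_commute)
    also have "\<dots> = m z"
      by (rule linear_euclidean_expansion[OF lin[OF that], symmetric])
    finally show ?thesis .
  qed
  have "subspace S"
    unfolding subspace_def S_def
    by (auto simp: inner_add_left intro!: derivative_eq_intros)
  moreover have "R \<subseteq> S"
    unfolding R_def S_def using der by (auto simp: rep)
  ultimately have "span R \<subseteq> S"
    by (simp add: span_minimal)
  moreover have "span R = UNIV"
  proof (rule ccontr)
    assume "span R \<noteq> UNIV"
    then obtain a where a: "a \<noteq> 0" "\<forall>x\<in>span R. a \<bullet> x = 0"
      using span_not_UNIV_orthogonal by blast
    have "m a = 0" if "m \<in> \<Lambda>" for m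
      using a(2) span_base[of "\<Sum>b\<in>Basis. m b *\<^sub>R b" R] that rep[OF that, of a]
      by (auto simp: R_def inner_commute)
    with a(1) sep show False by blast
  qed
  ultimately have *: "((\<lambda>t. b \<bullet> \<gamma> t) has_real_derivative b \<bullet> w) (at t)" for b
    unfolding S_def by blast
  show ?thesis
    unfolding has_vector_derivative_def
  proof (subst has_derivative_componentwise_within, intro ballI)
    fix b :: 'l assume "b \<in> Basis"
    show "((\<lambda>t. \<gamma> t \<bullet> b) has_derivative (\<lambda>x. (x *\<^sub>R w) \<bullet> b)) (at t)"
      using *[of b] by (simp add: has_field_derivative_def inner_commute mult.commute[of _ "b \<bullet> w"] cong: if_cong)
  qed
qed

section \<open>The derivative of the adjoint action\<close>

context lie_group_loc
begin

text \<open>Let H(r,s,t) be \<open>f\<close> at \<open>c r \<otimes> d s \<otimes> c t\<close>. Its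
  s-derivative along the line (t, 0, -t) is the function to be differentiated, so the derivative at
  0 is the (r,s) minus the (s,t) mixed derivative. The first is X(Yf); by symmetry of second
  derivatives the other is the t-derivative differentiated in s, that is Y(Xf), for the left
  invariant fields X and Y of \<open>x\<close> and \<open>y\<close>.\<close>

lemma Ad_derivative_functional:
  assumes c: "one_param G c x" and d: "one_param G d y" and f: "smooth_near \<A> \<one> f"
  shows "((\<lambda>t. linv (Ad G (c t) y) \<one> f) has_real_derivative linv (lie_br G x y) \<one> f) (at 0)"
proof -
  note c' = one_paramD[OF c] and d' = one_paramD[OF d]
  let ?K = "\<lambda>p :: real \<times> real \<times> real. c (fst p) \<otimes> d (fst (snd p)) \<otimes> c (snd (snd p))"
  let ?H = "\<lambda>p. f (?K p)"
  let ?D = "\<lambda>h p. frechet_derivative h (at (p :: real \<times> real \<times> real))"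
  have lin: "bounded_linear (\<lambda>p :: real \<times> real \<times> real. fst p)" "bounded_linear (\<lambda>p :: real \<times> real \<times> real. fst (snd p))"
    "bounded_linear (\<lambda>p :: real \<times> real \<times> real. snd (snd p))"
    by (auto intro: bounded_linear_fst bounded_linear_snd bounded_linear_fst_comp bounded_linear_snd_comp)
  have K: "smooth_param \<A> UNIV ?K"
    by (intro smooth_param_mult smooth_param_compose[OF c'(1)] smooth_param_compose[OF d'(1)]
        smooth_on_bounded_linear_comp[OF lin(1)] smooth_on_bounded_linear_comp[OF lin(2)]
        smooth_on_bounded_linear_comp[OF lin(3)] smooth_on_id charts) simp_all
  obtain T where T: "open T" "(0,0,0) \<in> T" "smooth_on T ?H"
    using smooth_near_param[OF charts K, of "(0,0,0)" f] f by (auto simp: c'(3) d'(3))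
  note H = smooth_onD[OF T(3)]
  note H' = smooth_onD[OF smooth_onD(2)[OF T(3)]]
  have curve: "((\<lambda>t. h (q + t *\<^sub>R v)) has_real_derivative ?D h q v) (at 0)"
    if "(h has_derivative ?D h q) (at q)" for h :: "real \<times> real \<times> real \<Rightarrow> real" and q v
    using has_real_derivative_along_line[of h "?D h q" q 0 v] that by simp
  obtain W where W: "open W" "\<one> \<in> W" "smooth_fun_on \<A> W f"
    using f unfolding smooth_near_def by blast
  have Wnear: "smooth_near \<A> g f" if "g \<in> W" for g
    using that W unfolding smooth_near_def by blast
  have ev: "\<forall>\<^sub>F t in nhds (0::real). t *\<^sub>R v \<in> T" for v
  proof (rule eventually_nhds_in_open[of "(\<lambda>t. t *\<^sub>R v) -` T", simplified])
    show "open ((\<lambda>t. t *\<^sub>R v) -` T)"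
      by (intro open_vimage T(1) continuous_intros)
    show "0 *\<^sub>R v \<in> T" using T(2) by (simp add: zero_prod_def)
  qed
  have evW: "\<forall>\<^sub>F t in nhds (0::real). \<gamma> t \<in> W" if "smooth_param \<A> UNIV \<gamma>" "\<gamma> 0 = \<one>" for \<gamma>
    using that W(1,2) smooth_paramD(2)[OF that(1)]
      eventually_nhds_in_open[OF open_vimage[OF W(1)], of \<gamma> 0] by simp
  let ?e1 = "(1,0,0) :: real \<times> real \<times> real" and ?e2 = "(0,1,0) :: real \<times> real \<times> real"
    and ?e3 = "(0,0,1) :: real \<times> real \<times> real"
  let ?E2 = "\<lambda>p. ?D ?H p ?e2" and ?E3 = "\<lambda>p. ?D ?H p ?e3"
  have 0: "(0,0,0) = (0 :: real \<times> real \<times> real)" by (simp add: zero_prod_def)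
  note T0 = T(2)[unfolded 0]
  have \<A>: "\<forall>\<^sub>F t in nhds 0. ?E2 (0 + t *\<^sub>R (1, 0, - 1)) = linv (Ad G (c t) y) \<one> f"
    using ev[of "(1,0,-1)"]
  proof eventually_elim
    case (elim t)
    have "((\<lambda>s. ?H (t *\<^sub>R (1, 0, - 1) + s *\<^sub>R ?e2)) has_real_derivative ?E2 (t *\<^sub>R (1, 0, - 1))) (at 0)"
      by (rule curve[OF H(1)[OF elim]])
    moreover have "((\<lambda>s. ?H (t *\<^sub>R (1, 0, - 1) + s *\<^sub>R ?e2)) has_real_derivative linv (Ad G (c t) y) \<one> f) (at 0)"
      using linv_one_param[OF one_param_conj[OF d, of "c t"] f] by (simp add: c'(4))
    ultimately show ?case
      using DERIV_unique by simp
  qed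
  have B: "\<forall>\<^sub>F t in nhds 0. ?E2 (0 + t *\<^sub>R ?e1) = linv y (c t) f"
    using ev[of ?e1] evW[OF c'(1,3)]
  proof eventually_elim
    case (elim t)
    have "((\<lambda>s. ?H (t *\<^sub>R ?e1 + s *\<^sub>R ?e2)) has_real_derivative ?E2 (t *\<^sub>R ?e1)) (at 0)"
      by (rule curve[OF H(1)[OF elim(1)]])
    moreover have "((\<lambda>s. ?H (t *\<^sub>R ?e1 + s *\<^sub>R ?e2)) has_real_derivative linv y (c t) f) (at 0)"
      using linv_one_param[OF d Wnear[OF elim(2)]] by (simp add: c'(3))
    ultimately show ?case
      using DERIV_unique by simp
  qed
  have C: "\<forall>\<^sub>F s in nhds 0. ?E3 (0 + s *\<^sub>R ?e2) = linv x (d s) f"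
    using ev[of ?e2] evW[OF d'(1,3)]
  proof eventually_elim
    case (elim s)
    have "((\<lambda>t. ?H (s *\<^sub>R ?e2 + t *\<^sub>R ?e3)) has_real_derivative ?E3 (s *\<^sub>R ?e2)) (at 0)"
      by (rule curve[OF H(1)[OF elim(1)]])
    moreover have "((\<lambda>t. ?H (s *\<^sub>R ?e2 + t *\<^sub>R ?e3)) has_real_derivative linv x (d s) f) (at 0)"
      using linv_one_param[OF c Wnear[OF elim(2)]] by (simp add: c'(3))
    ultimately show ?case
      using DERIV_unique by simp
  qed
  have "((\<lambda>t. linv y (c t) f) has_real_derivative ?D ?E2 0 ?e1) (at 0)"
    by (rule DERIV_cong_ev[OF refl B refl, THEN iffD1, OF curve[OF H'(1)[OF T0]]])
  moreover have "((\<lambda>t. linv y (c t) f) has_real_derivative linv x \<one> (\<lambda>g. linv y g f)) (at 0)"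
    using linv_one_param[OF c smooth_vector_field_near[OF smooth_linv open_UNIV UNIV_I f]] by simp
  ultimately have 1: "?D ?E2 0 ?e1 = linv x \<one> (\<lambda>g. linv y g f)"
    by (rule DERIV_unique)
  have "((\<lambda>t. linv x (d t) f) has_real_derivative ?D ?E3 0 ?e2) (at 0)"
    by (rule DERIV_cong_ev[OF refl C refl, THEN iffD1, OF curve[OF H'(1)[OF T0]]])
  moreover have "((\<lambda>t. linv x (d t) f) has_real_derivative linv y \<one> (\<lambda>g. linv x g f)) (at 0)"
    using linv_one_param[OF d smooth_vector_field_near[OF smooth_linv open_UNIV UNIV_I f]] by simp
  ultimately have 2: "?D ?E3 0 ?e2 = linv y \<one> (\<lambda>g. linv x g f)"
    by (rule DERIV_unique)
  have lin2: "linear (?D ?E2 0)"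
    using has_derivative_linear[OF H'(1)[OF T0]] .
  have "?D ?E2 0 (1, 0, - 1) = ?D ?E2 0 ?e1 - ?D ?E2 0 ?e3"
    using linear_diff[OF lin2, of ?e1 ?e3] by simp
  also have "?D ?E2 0 ?e3 = ?D ?E3 0 ?e2"
    by (rule frechet_derivative_commute[OF T(3,1) T0])
  finally have "?D ?E2 0 (1, 0, - 1) = linv (lie_br G x y) \<one> f"
    using f by (simp add: 1 2 linv_bracket vf_bracket_def)
  moreover have "((\<lambda>t. linv (Ad G (c t) y) \<one> f) has_real_derivative ?D ?E2 0 (1, 0, - 1)) (at 0)"
    by (rule DERIV_cong_ev[OF refl \<A> refl, THEN iffD1, OF curve[OF H'(1)[OF T0]]])
  ultimately show ?thesis by simp
qed

text \<open>At \<open>t = 0\<close> the functionals \<open>\<lambda>x. linv x \<one> f\<close>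
  separate points and reduce the claim to \<open>Ad_derivative_functional\<close>; the homomorphism
  property moves it to other times. The subgroup \<open>d\<close> generated by \<open>y\<close> is a
  hypothesis, which elements of \<open>big_par\<close> satisfy.\<close>

lemma Ad_has_derivative:
  assumes c: "one_param G c x" and d: "one_param G d y"
  shows "((\<lambda>t. Ad G (c t) y) has_vector_derivative Ad G (c t) (lie_br G x y)) (at t)"
proof -
  have 0: "((\<lambda>t. Ad G (c t) y) has_vector_derivative lie_br G x y) (at 0)"
  proof (rule has_vector_derivative_functionals[where \<Lambda> = "{(\<lambda>x. linv x \<one> f) |f. smooth_near \<A> \<one> f}"])
    show "z = 0" if "\<And>m. m \<in> {(\<lambda>x. linv x \<one> f) |f. smooth_near \<A> \<one> f} \<Longrightarrow> m z = 0" for z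
    proof (rule linv_one_inj)
      show "linv z \<one> f = linv 0 \<one> f" for f
        using that linear_0[OF linear_linv] tangent_spaceD(1)[OF linv_tangent[of z \<one>]]
        by (cases "smooth_near \<A> \<one> f") auto
    qed
  qed (auto simp: linear_linv intro: Ad_derivative_functional[OF c d])
  have "((\<lambda>s. Ad G (c t) (Ad G (c s) y)) has_vector_derivative Ad G (c t) (lie_br G x y)) (at 0)"
    by (rule bounded_linear.has_vector_derivative[OF _ 0]) (simp add: linear_Ad flip: linear_conv_bounded_linear)
  then have "((\<lambda>s. Ad G (c (t + s)) y) has_vector_derivative Ad G (c t) (lie_br G x y)) (at 0)"
    by (simp add: Ad_mult one_paramD(2)[OF c])
  then have "((\<lambda>s. Ad G (c (t + s)) y) \<circ> (\<lambda>s. s - t) has_vector_derivative 1 *\<^sub>R Ad G (c t) (lie_br G x y)) (at t)"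
    by (intro vector_diff_chain_at) (auto intro!: derivative_eq_intros)
  then show ?thesis
    by (simp add: o_def)
qed

end


section \<open>Nested parabolics and representations\<close>

text \<open>Gronwall's argument for the sum of squares \<open>N\<close>: as
  \<open>\<bar>N' t\<bar> \<le> C * N t\<close>, the function \<open>N t * exp (- C * t)\<close>
  does not increase for positive time and \<open>N t * exp (C * t)\<close> does not decrease for
  negative time. Both start or end at 0.\<close>

lemma linear_ode_zero:
  fixes f :: "'i \<Rightarrow> real \<Rightarrow> real"
  assumes I: "finite I" and f: "\<And>i t. i \<in> I \<Longrightarrow> (f i has_real_derivative (\<Sum>j\<in>I. r i j * f j t)) (at t)"
    and f0: "\<And>i. i \<in> I \<Longrightarrow> f i 0 = 0" and i: "i \<in> I"
  shows "f i t = 0"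
proof -
  define N where "N t = (\<Sum>i\<in>I. (f i t)\<^sup>2)" for t
  define N' where "N' t = (\<Sum>i\<in>I. 2 * f i t * (\<Sum>j\<in>I. r i j * f j t))" for t
  \<comment> \<open>The constant comes from
    \<open>2 * (\<bar>f i t\<bar> * \<bar>f j t\<bar>) \<le> 2 * N t\<close>, applied to each
    product in \<open>N'\<close>.\<close>
  define C where "C = (\<Sum>i\<in>I. \<Sum>j\<in>I. 2 * \<bar>r i j\<bar>)"
  have N': "(N has_real_derivative N' t) (at t)" for t
    unfolding N_def N'_def by (auto intro!: derivative_eq_intros f DERIV_sum)
  have N0: "N t \<ge> 0" for t
    by (simp add: N_def sum_nonneg)
  have fN: "(f i t)\<^sup>2 \<le> N t" if "i \<in> I" for i t
    unfolding N_def using that I by (intro member_le_sum) auto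
  have bound: "\<bar>N' t\<bar> \<le> C * N t" for t
  proof -
    have "\<bar>N' t\<bar> \<le> (\<Sum>i\<in>I. \<Sum>j\<in>I. \<bar>2 * f i t * (r i j * f j t)\<bar>)"
      unfolding N'_def sum_distrib_left by (intro order_trans[OF sum_abs] sum_mono sum_abs)
    also have "\<dots> \<le> (\<Sum>i\<in>I. \<Sum>j\<in>I. 2 * \<bar>r i j\<bar> * N t)"
    proof (intro sum_mono)
      fix i j assume ij: "i \<in> I" "j \<in> I"
      have "2 * (\<bar>f i t\<bar> * \<bar>f j t\<bar>) \<le> \<bar>f i t\<bar>\<^sup>2 + \<bar>f j t\<bar>\<^sup>2"
        using sum_squares_bound[of "\<bar>f i t\<bar>" "\<bar>f j t\<bar>"] by simp
      also have "\<dots> \<le> 2 * N t"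
        using fN[OF ij(1), of t] fN[OF ij(2), of t] by simp
      finally have "\<bar>f i t\<bar> * \<bar>f j t\<bar> \<le> N t" by simp
      from mult_left_mono[OF this, of "2 * \<bar>r i j\<bar>"]
      show "\<bar>2 * f i t * (r i j * f j t)\<bar> \<le> 2 * \<bar>r i j\<bar> * N t"
        by (simp add: abs_mult mult_ac)
    qed
    also have "\<dots> = C * N t"
      by (simp add: C_def sum_distrib_right)
    finally show ?thesis .
  qed
  have "N t \<le> 0"
  proof (cases "t \<ge> 0")
    case True
    have "N t * exp (- C * t) \<le> N 0 * exp (- C * 0)"
    proof (rule DERIV_nonpos_imp_nonincreasing[OF True])
      fix x
      have "((\<lambda>t. N t * exp (- C * t)) has_real_derivative (N' x - C * N x) * exp (- C * x)) (at x)"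
        by (auto intro!: derivative_eq_intros N' simp: algebra_simps)
      moreover have "(N' x - C * N x) * exp (- C * x) \<le> 0"
        using bound[of x] by (intro mult_nonpos_nonneg) auto
      ultimately show "\<exists>y. ((\<lambda>t. N t * exp (- C * t)) has_real_derivative y) (at x) \<and> y \<le> 0" by blast
    qed
    then show ?thesis
      using f0 by (simp add: N_def mult_le_0_iff)
  next
    case False
    then have t: "t \<le> 0" by simp
    have "N t * exp (C * t) \<le> N 0 * exp (C * 0)"
    proof (rule DERIV_nonneg_imp_nondecreasing[OF t])
      fix x
      have "((\<lambda>t. N t * exp (C * t)) has_real_derivative (N' x + C * N x) * exp (C * x)) (at x)"
        by (auto intro!: derivative_eq_intros N' simp: algebra_simps)
      moreover have "(N' x + C * N x) * exp (C * x) \<ge> 0"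
        using bound[of x] by (intro mult_nonneg_nonneg) auto
      ultimately show "\<exists>y. ((\<lambda>t. N t * exp (C * t)) has_real_derivative y) (at x) \<and> 0 \<le> y" by blast
    qed
    then show ?thesis
      using f0 by (simp add: N_def mult_le_0_iff)
  qed
  with fN[OF i, of t] show ?thesis
    by (smt (verit) zero_le_power2 power2_eq_iff zero_power2)
qed

text \<open>Double orthogonal complements. It turns membership of a curve in a subspace into the
  vanishing of scalar functions, to which differential arguments apply.\<close>

lemma subspace_orthogonal_test:
  fixes V :: "'a::euclidean_space set"
  assumes "subspace V" "\<And>z. (\<And>v. v \<in> V \<Longrightarrow> z \<bullet> v = 0) \<Longrightarrow> z \<bullet> w = 0"
  shows "w \<in> V"
proof -
  have "w \<in> orthogonal_comp (orthogonal_comp V)"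
    using assms(2) by (auto simp: orthogonal_comp_def orthogonal_def inner_commute)
  then show ?thesis
    using orthogonal_comp_self[OF assms(1)] by simp
qed

locale nested_type_loc =
  fixes T :: "('g::{t2_space,second_countable_topology}, 'l::euclidean_space, 'r::real_vector) nested_type" (structure)
  assumes nested: "nested_parabolic_type T"
begin

sublocale lie_group_loc T
  using nested by unfold_locales (simp add: nested_parabolic_type_def)

abbreviation "p \<equiv> big_par T"
abbreviation "q \<equiv> small_par T"
abbreviation "P \<equiv> par_grp T"
abbreviation "Q \<equiv> sub_grp T"
abbreviation "br \<equiv> lie_br T"

lemma bilinear_br: "bilinear br"
  using lie_algebra_br by (simp add: lie_algebra_def)

lemma br_self: "br x x = 0"
  using lie_algebra_br by (simp add: lie_algebra_def)

lemma br_minus: "br x y = - br y x"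
  by (rule alternating_bilinear_minus[OF bilinear_br br_self])

lemma subalgebra_p: "lie_subalgebra br p" and subalgebra_q: "lie_subalgebra br q"
  using nested by (auto simp: nested_parabolic_type_def parabolic_subalgebra_def)

lemma subspace_p: "subspace p" and subspace_q: "subspace q"
  using subalgebra_p subalgebra_q by (auto simp: lie_subalgebra_def)

lemma br_p: "x \<in> p \<Longrightarrow> y \<in> p \<Longrightarrow> br x y \<in> p" and br_q: "x \<in> q \<Longrightarrow> y \<in> q \<Longrightarrow> br x y \<in> q"
  using subalgebra_p subalgebra_q by (auto simp: lie_subalgebra_def)

lemma q_subset_p: "q \<subseteq> p"
  using nested by (simp add: nested_parabolic_type_def)

lemma ideal_N: "lie_ideal br (big_nil T) p"
  unfolding big_nil_def by (rule lie_ideal_nilradical[OF bilinear_br subalgebra_p])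

lemma subspace_N: "subspace (big_nil T)" and N_subset_p: "big_nil T \<subseteq> p"
  using ideal_N by (auto simp: lie_ideal_def)

lemma br_N: "x \<in> p \<Longrightarrow> y \<in> big_nil T \<Longrightarrow> br x y \<in> big_nil T" "x \<in> p \<Longrightarrow> y \<in> big_nil T \<Longrightarrow> br y x \<in> big_nil T"
proof -
  show *: "br x y \<in> big_nil T" if "x \<in> p" "y \<in> big_nil T" for x y
    using that ideal_N by (auto simp: lie_ideal_def)
  show "br y x \<in> big_nil T" if "x \<in> p" "y \<in> big_nil T" for x y
    using *[OF that] br_minus[of y x] subspace_neg[OF subspace_N] by simp
qed

lemma N_subset_q: "big_nil T \<subseteq> q"
  unfolding big_nil_def using nested
  by (intro nilradical_subset_parabolic lie_algebra_br subalgebra_p) (auto simp: nested_parabolic_type_def)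

lemma subgroup_P: "subgroup P T"
  using nested by (simp add: nested_parabolic_type_def)

lemma P_closed: "g \<in> P \<Longrightarrow> h \<in> P \<Longrightarrow> g \<otimes> h \<in> P" "g \<in> P \<Longrightarrow> inv g \<in> P" "\<one> \<in> P"
  using subgroup_P by (auto simp: subgroup_def)

lemma p_one_param:
  assumes "x \<in> p"
  shows "\<exists>c. one_param T c x \<and> range c \<subseteq> P"
proof -
  have "lie_alg_of T P = p"
    using nested by (simp add: nested_parabolic_type_def)
  with assms show ?thesis
    unfolding lie_alg_of_def by blast
qed

lemma one_param_p:
  assumes "one_param T c x" "range c \<subseteq> P"
  shows "x \<in> p"
proof -
  have "lie_alg_of T P = p"
    using nested by (simp add: nested_parabolic_type_def)
  with assms show ?thesis
    unfolding lie_alg_of_def by blast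
qed

text \<open>Conjugation by \<open>g\<close> keeps a one-parameter subgroup inside \<open>P\<close>,
  and \<open>p\<close> consists of the generators of such subgroups.\<close>

lemma Ad_p:
  assumes "g \<in> P" "x \<in> p"
  shows "Ad T g x \<in> p"
proof -
  obtain c where c: "one_param T c x" "range c \<subseteq> P"
    using p_one_param[OF assms(2)] by blast
  show ?thesis
    by (rule one_param_p[OF one_param_conj[OF c(1)]]) (use c(2) assms(1) P_closed in auto)
qed

lemma Ad_image_p: "g \<in> P \<Longrightarrow> Ad T g ` p = p"
  using Ad_p P_closed(2) by (auto intro!: image_eqI[of _ _ "Ad T (inv g) _"])

lemma Ad_N:
  assumes "g \<in> P" "x \<in> big_nil T"
  shows "Ad T g x \<in> big_nil T"
proof -
  have "Ad T g ` nilradical br p \<subseteq> nilradical br p"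
    by (rule nilradical_image_subset[OF linear_Ad Ad_image_p[OF assms(1)]]) (rule Ad_bracket)
  then show ?thesis
    using assms(2) by (auto simp: big_nil_def)
qed

text \<open>For \<open>z\<close> orthogonal to \<open>V\<close> and \<open>b\<close> in a basis of
  \<open>V\<close>, the functions \<open>z \<bullet> Ad T (c t) b\<close> solve a homogeneous linear
  system whose coefficients are the matrix of bracketing with \<open>x\<close> on \<open>V\<close>.
  They vanish at time 0. The inclusion of \<open>V\<close> in \<open>p\<close> provides the
  one-parameter subgroup of \<open>b\<close> that \<open>Ad_has_derivative\<close> asks for.\<close>

lemma Ad_invariant_subspace:
  assumes V: "subspace V" "V \<subseteq> p" and x: "\<And>y. y \<in> V \<Longrightarrow> br x y \<in> V"
    and c: "one_param T c x" and y: "y \<in> V"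
  shows "Ad T (c t) y \<in> V"
proof (rule subspace_orthogonal_test[OF V(1)])
  fix z assume z: "\<And>v. v \<in> V \<Longrightarrow> z \<bullet> v = 0"
  obtain B where B: "B \<subseteq> V" "independent B" "V = span B"
    using basis_exists[of V] V(1) by (metis span_subspace)
  have fin: "finite B"
    using B(2) by (rule independent_imp_finite)
  have ode: "z \<bullet> Ad T (c t) b = 0" if "b \<in> B" for b t
  proof (rule linear_ode_zero[OF fin, where r = "\<lambda>b b'. representation B (br x b) b'" and f = "\<lambda>b t. z \<bullet> Ad T (c t) b"])
    fix b t assume b: "b \<in> B"
    then obtain d where d: "one_param T d b"
      using p_one_param B(1) V(2) by blast
    have "br x b = (\<Sum>b'\<in>B. representation B (br x b) b' *\<^sub>R b')"
      using sum_representation_eq[OF B(2) _ fin order_refl, of "br x b"] x B b by auto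
    then have "z \<bullet> Ad T (c t) (br x b) = z \<bullet> Ad T (c t) (\<Sum>b'\<in>B. representation B (br x b) b' *\<^sub>R b')"
      by simp
    also have "\<dots> = (\<Sum>b'\<in>B. representation B (br x b) b' * (z \<bullet> Ad T (c t) b'))"
      by (simp add: linear_sum[OF linear_Ad] linear_scale[OF linear_Ad] inner_sum_right)
    finally have eq: "z \<bullet> Ad T (c t) (br x b) = (\<Sum>b'\<in>B. representation B (br x b) b' * (z \<bullet> Ad T (c t) b'))" .
    have "((\<lambda>t. z \<bullet> Ad T (c t) b) has_vector_derivative z \<bullet> Ad T (c t) (br x b)) (at t)"
      by (rule bounded_linear.has_vector_derivative[OF bounded_linear_inner_right Ad_has_derivative[OF c d]])
    then show "((\<lambda>t. z \<bullet> Ad T (c t) b) has_real_derivative (\<Sum>b'\<in>B. representation B (br x b) b' * (z \<bullet> Ad T (c t) b'))) (at t)"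
      unfolding has_real_derivative_iff_has_vector_derivative eq[symmetric] .
  next
    show "z \<bullet> Ad T (c 0) b = 0" if "b \<in> B" for b
      using that z B(1) by (auto simp: one_paramD(3)[OF c] Ad_one)
  qed (rule that)
  have "y = (\<Sum>b\<in>B. representation B y b *\<^sub>R b)"
    using sum_representation_eq[OF B(2) _ fin order_refl, of y] y B(3) by simp
  then have "z \<bullet> Ad T (c t) y = z \<bullet> Ad T (c t) (\<Sum>b\<in>B. representation B y b *\<^sub>R b)"
    by simp
  also have "\<dots> = 0"
    using ode by (simp add: linear_sum[OF linear_Ad] linear_scale[OF linear_Ad] inner_sum_right)
  finally show "z \<bullet> Ad T (c t) y = 0" .
qed

text \<open>A generator in \<open>q\<close> preserves \<open>q\<close> under bracketing, so its
  subgroup preserves \<open>q\<close>; times \<open>t\<close> and \<open>- t\<close> together give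
  equality of the image. Membership in \<open>Q\<close> is what lets the Cartan connection reproduce
  the generator.\<close>

lemma one_param_Q:
  assumes "x \<in> q" "one_param T c x" "range c \<subseteq> P"
  shows "range c \<subseteq> Q"
proof -
  have sub: "Ad T (c t) y \<in> q" if "y \<in> q" for y t
    using Ad_invariant_subspace[OF subspace_q q_subset_p _ assms(2) that] br_q[OF assms(1)] by blast
  have "Ad T (c t) ` q = q" for t
  proof (intro equalityI subsetI)
    fix y assume "y \<in> q"
    then have "Ad T (inv (c t)) y \<in> q"
      using sub[of y "- t"] by (simp add: one_paramD(4)[OF assms(2)])
    then show "y \<in> Ad T (c t) ` q"
      by (rule image_eqI[rotated]) simp
  qed (use sub in auto)
  then show ?thesis
    using assms(3) by (auto simp: sub_grp_def)
qed

text \<open>The derivative of \<open>Ad T (c t) y\<close> is \<open>Ad T (c t) (br x y)\<close>,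
  which stays in the ideal. Tested against vectors orthogonal to the ideal, the curve is
  constant.\<close>

lemma Ad_one_param_N:
  assumes x: "x \<in> big_nil T" and c: "one_param T c x" and y: "y \<in> p"
  shows "Ad T (c t) y - y \<in> big_nil T"
proof (rule subspace_orthogonal_test[OF subspace_N])
  fix z assume z: "\<And>v. v \<in> big_nil T \<Longrightarrow> z \<bullet> v = 0"
  obtain d where d: "one_param T d y"
    using p_one_param[OF y] by blast
  have "((\<lambda>t. z \<bullet> Ad T (c t) y) has_vector_derivative 0) (at t)" for t
  proof -
    have "Ad T (c t) (br x y) \<in> big_nil T"
      using Ad_invariant_subspace[OF subspace_N N_subset_p _ c] br_N x y N_subset_p by blast
    then show ?thesis
      using bounded_linear.has_vector_derivative[OF bounded_linear_inner_right Ad_has_derivative[OF c d], of z t] z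
      by simp
  qed
  then have "((\<lambda>t. z \<bullet> Ad T (c t) y) has_derivative (\<lambda>h. 0)) (at t)" for t
    by (simp add: has_vector_derivative_def)
  then have "z \<bullet> Ad T (c t) y = z \<bullet> Ad T (c 0) y"
    using has_derivative_zero_unique[of UNIV "\<lambda>t. z \<bullet> Ad T (c t) y" 0 t] by simp
  then show "z \<bullet> (Ad T (c t) y - y) = 0"
    by (simp add: inner_diff_right one_paramD(3)[OF c] Ad_one)
qed

lemma Q_subset_P: "g \<in> Q \<Longrightarrow> g \<in> P"
  by (simp add: sub_grp_def)

lemma Q_inv: "g \<in> Q \<Longrightarrow> inv g \<in> Q"
proof -
  assume g: "g \<in> Q"
  then have "Ad T (inv g) ` Ad T g ` q = Ad T (inv g) ` q"
    by (simp add: sub_grp_def)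
  then show ?thesis
    using g P_closed(2) by (simp add: sub_grp_def image_image)
qed

section \<open>The quotient of the large parabolic by its nilradical\<close>

lemma linear_quot: "linear (quot T)" and quot_p: "quot T ` p = UNIV"
  using nested by (auto simp: nested_parabolic_type_def)

lemma quot_eq_iff: "x \<in> p \<Longrightarrow> y \<in> p \<Longrightarrow> quot T x = quot T y \<longleftrightarrow> x - y \<in> big_nil T"
proof -
  assume "x \<in> p" "y \<in> p"
  then have "quot T (x - y) = 0 \<longleftrightarrow> x - y \<in> big_nil T"
    using nested subspace_diff[OF subspace_p] by (auto simp: nested_parabolic_type_def)
  then show ?thesis
    by (simp add: linear_diff[OF linear_quot])
qed

lemma descend_quot:
  assumes "x \<in> p" "\<And>y. y \<in> p \<Longrightarrow> y - x \<in> big_nil T \<Longrightarrow> F y = F x"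
  shows "descend T F (quot T x) = F x"
  unfolding descend_def
  by (rule the_equality) (use assms quot_eq_iff in auto)

text \<open>An arbitrary linear section of the quotient map. It is neither multiplicative nor
  equivariant; both hold up to the nilradical, and the derivatives and actions evaluated on lifts
  below do not see that difference.\<close>

definition lift :: "'r \<Rightarrow> 'l" where
  "lift = (SOME \<sigma>. linear \<sigma> \<and> (\<forall>a. \<sigma> a \<in> p \<and> quot T (\<sigma> a) = a))"

lemma lift: "linear lift" "lift a \<in> p" "quot T (lift a) = a"
proof -
  have "\<exists>\<sigma>. linear \<sigma> \<and> (\<forall>a. \<sigma> a \<in> p \<and> quot T (\<sigma> a) = a)"
    using linear_exists_right_inverse_on[OF linear_quot subspace_p] unfolding quot_p by blast
  from someI_ex[OF this] show "linear lift" "lift a \<in> p" "quot T (lift a) = a"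
    unfolding lift_def by blast+
qed

lemma Ad_quot_quot:
  assumes "g \<in> P" "x \<in> p"
  shows "Ad_quot T g (quot T x) = quot T (Ad T g x)"
  unfolding Ad_quot_def
proof (rule descend_quot[OF assms(2)])
  show "quot T (Ad T g y) = quot T (Ad T g x)" if "y \<in> p" "y - x \<in> big_nil T" for y
    using that Ad_N[OF assms(1) that(2)] Ad_p[OF assms(1)] assms(2)
    by (simp add: quot_eq_iff linear_diff[OF linear_Ad])
qed

lemma br_quot_quot:
  assumes "x \<in> p" "y \<in> p"
  shows "br_quot T (quot T x) (quot T y) = quot T (br x y)"
proof -
  have 1: "quot T (br x' y') = quot T (br x' y)" if "x' \<in> p" "y' \<in> p" "y' - y \<in> big_nil T" for x' y'
    using br_N(1)[OF that(1,3)] that assms br_p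
    by (simp add: quot_eq_iff bilinear_rsub[OF bilinear_br])
  have 2: "quot T (br x' y) = quot T (br x y)" if "x' \<in> p" "x' - x \<in> big_nil T" for x'
    using br_N(2)[OF assms(2) that(2)] that assms br_p
    by (simp add: quot_eq_iff bilinear_lsub[OF bilinear_br])
  have 3: "descend T (\<lambda>y. quot T (br x' y)) (quot T y) = quot T (br x' y)" if "x' \<in> p" for x'
    using 1 that by (intro descend_quot[OF assms(2)]) auto
  show ?thesis
    unfolding br_quot_def using 2 3 assms(1)
    by (subst descend_quot[OF assms(1)]) (auto simp: 3)
qed

lemma br_quot_lift: "br_quot T a b = quot T (br (lift a) (lift b))"
  using br_quot_quot[OF lift(2) lift(2), of a b] by (simp add: lift)

lemma Ad_quot_lift: "g \<in> P \<Longrightarrow> Ad_quot T g a = quot T (Ad T g (lift a))"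
  using Ad_quot_quot[OF _ lift(2), of g a] by (simp add: lift)

end

section \<open>The infinitesimal representation\<close>

locale rep_loc = nested_type_loc T
  for T :: "('g::{t2_space,second_countable_topology}, 'l::euclidean_space, 'r::real_vector) nested_type" (structure) +
  fixes R :: "'g \<Rightarrow> 'v::real_vector \<Rightarrow> 'v"
  assumes rep: "rel_tractor_rep T R"
begin

lemma fin_dim_V: "fin_dim (UNIV :: 'v set)"
  using rep by (simp add: rel_tractor_rep_def)

lemma linear_R: "g \<in> P \<Longrightarrow> linear (R g)" and R_one: "R \<one> v = v"
  and R_mult: "g \<in> P \<Longrightarrow> h \<in> P \<Longrightarrow> R (g \<otimes> h) v = R g (R h v)"
  using rep by (auto simp: rel_tractor_rep_def)

lemma R_inv: "g \<in> P \<Longrightarrow> R g (R (inv g) v) = v" "g \<in> P \<Longrightarrow> R (inv g) (R g v) = v"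
  by (simp_all add: P_closed R_one flip: R_mult)

text \<open>A matrix coefficient of \<open>R\<close> is defined on \<open>P\<close> only. One smooth
  extension \<open>F\<close> near the identity serves all curves in \<open>P\<close>, so derivatives
  along them become values of left invariant fields on a single function.\<close>

lemma R_extension:
  fixes l :: "'v \<Rightarrow> real"
  assumes "linear l"
  shows "\<exists>F. smooth_near (grp_atlas T) \<one> F \<and> (\<forall>x c. one_param T c x \<and> range c \<subseteq> P \<longrightarrow>
    ((\<lambda>t. l (R (c t) v)) has_real_derivative left_inv_vf T x \<one> F) (at 0))"
proof -
  have "smooth_map_on (grp_atlas T) real_atlas P (\<lambda>g. l (R g v))"
    using rep assms by (simp add: rel_tractor_rep_def)
  then obtain W F where W: "open W" "\<one> \<in> W" "smooth_map (grp_atlas T) real_atlas W F"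
      "\<forall>y\<in>W \<inter> P. F y = l (R y v)"
    using P_closed(3) unfolding smooth_map_on_def by blast
  have "smooth_fun_on (grp_atlas T) W F"
    using W(3) by (auto simp: smooth_map_def smooth_fun_on_def real_atlas_def)
  then have F: "smooth_near (grp_atlas T) \<one> F"
    using W unfolding smooth_near_def by blast
  have "((\<lambda>t. l (R (c t) v)) has_real_derivative left_inv_vf T x \<one> F) (at 0)"
    if c: "one_param T c x" "range c \<subseteq> P" for x c
  proof -
    have 1: "((\<lambda>t. F (c t)) has_real_derivative left_inv_vf T x \<one> F) (at 0)"
      using linv_one_param[OF c(1) F] by simp
    have 2: "\<forall>\<^sub>F t in nhds 0. F (c t) = l (R (c t) v)"
    proof -
      have "open (c -` W)"
        using smooth_paramD(4)[OF one_paramD(1)[OF c(1)] W(1)] by simp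
      then have "\<forall>\<^sub>F t in nhds 0. t \<in> c -` W"
        using W(2) by (intro eventually_nhds_in_open) (auto simp: one_paramD(3)[OF c(1)])
      then show ?thesis
        by eventually_elim (use W(4) c(2) in auto)
    qed
    show ?thesis
      by (rule DERIV_cong_ev[OF refl 2 refl, THEN iffD1, OF 1])
  qed
  with F show ?thesis by blast
qed

abbreviation "\<rho> \<equiv> inf_act T R"

text \<open>By \<open>R_extension\<close> the derivative of each coordinate depends on the generator
  alone and not on the curve \<open>c\<close>, so the vector assembled from these derivatives meets
  the description in \<open>inf_act\<close>.\<close>

lemma inf_act_derivative:
  assumes x: "x \<in> p" and c: "one_param T c x" "range c \<subseteq> P" and l: "linear (l :: 'v \<Rightarrow> real)"
  shows "((\<lambda>t. l (R (c t) v)) has_real_derivative l (\<rho> x v)) (at 0)"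
proof -
  obtain B :: "'v set" and r :: "'v \<Rightarrow> 'v \<Rightarrow> real" where B: "finite B" "\<And>b. linear (r b)" "\<And>w. (\<Sum>b\<in>B. r b w *\<^sub>R b) = w"
    using fin_dim_coordinates[OF fin_dim_V] by blast
  have "\<exists>m. \<forall>c. one_param T c x \<and> range c \<subseteq> P \<longrightarrow> ((\<lambda>t. r b (R (c t) v)) has_real_derivative m) (at 0)" for b
  proof -
    obtain F where "\<forall>x c. one_param T c x \<and> range c \<subseteq> P \<longrightarrow>
        ((\<lambda>t. r b (R (c t) v)) has_real_derivative left_inv_vf T x \<one> F) (at 0)"
      using R_extension[OF B(2)[of b], of v] by (elim exE conjE)
    then show ?thesis
      by (intro exI[of _ "left_inv_vf T x \<one> F"]) simp
  qed
  then have "\<forall>b. \<exists>m. \<forall>c. one_param T c x \<and> range c \<subseteq> P \<longrightarrow> ((\<lambda>t. r b (R (c t) v)) has_real_derivative m) (at 0)"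
    by blast
  from choice[OF this] obtain m where m: "\<And>b c. one_param T c x \<Longrightarrow> range c \<subseteq> P \<Longrightarrow> ((\<lambda>t. r b (R (c t) v)) has_real_derivative m b) (at 0)"
    by blast
  define w where "w = (\<Sum>b\<in>B. m b *\<^sub>R b)"
  have w: "((\<lambda>t. l (R (c t) v)) has_real_derivative l w) (at 0)"
    if c: "one_param T c x" "range c \<subseteq> P" and l: "linear l" for c and l :: "'v \<Rightarrow> real"
  proof -
    have "((\<lambda>t. \<Sum>b\<in>B. r b (R (c t) v) * l b) has_real_derivative (\<Sum>b\<in>B. m b * l b)) (at 0)"
      by (intro DERIV_sum DERIV_cmult_right m c)
    moreover have "(\<Sum>b\<in>B. r b z * l b) = l z" for z
      by (rule sum_coordinates_functional[OF B(3) l])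
    moreover have "(\<Sum>b\<in>B. m b * l b) = l w"
      by (simp add: w_def linear_sum[OF l] linear_scale[OF l])
    ultimately show ?thesis by simp
  qed
  have "\<rho> x v = w"
    unfolding inf_act_def
  proof (rule the_equality)
    fix w' assume *: "\<forall>c. one_param T c x \<and> range c \<subseteq> P \<longrightarrow>
      (\<forall>l :: 'v \<Rightarrow> real. linear l \<longrightarrow> ((\<lambda>t. l (R (c t) v)) has_real_derivative l w') (at 0))"
    show "w' = w"
    proof (rule linear_functionals_separate[OF fin_dim_V])
      fix l :: "'v \<Rightarrow> real" assume l: "linear l"
      show "l w' = l w"
        using * c l w[OF c l] DERIV_unique by blast
    qed
  qed (use w in blast)
  with w[OF c l] show ?thesis by simp
qed

text \<open>Makes the dependence on \<open>x\<close> visible: it is that of a left invariant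
  derivative. Linearity in \<open>x\<close> and the derivative of Ad are carried over to
  \<open>\<rho>\<close> in this way.\<close>

lemma inf_act_extension:
  assumes "linear (l :: 'v \<Rightarrow> real)"
  shows "\<exists>F. smooth_near (grp_atlas T) \<one> F \<and> (\<forall>x\<in>p. l (\<rho> x v) = left_inv_vf T x \<one> F)"
proof -
  obtain F where F: "smooth_near (grp_atlas T) \<one> F" "\<forall>x c. one_param T c x \<and> range c \<subseteq> P \<longrightarrow>
    ((\<lambda>t. l (R (c t) v)) has_real_derivative left_inv_vf T x \<one> F) (at 0)"
    using R_extension[OF assms, of v] by (elim exE conjE)
  have "l (\<rho> x v) = left_inv_vf T x \<one> F" if x: "x \<in> p" for x
  proof -
    obtain c where c: "one_param T c x" "range c \<subseteq> P"
      using p_one_param[OF x] by blast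
    from DERIV_unique[OF inf_act_derivative[OF x c assms] F(2)[rule_format, OF conjI[OF c]]] show ?thesis .
  qed
  with F(1) show ?thesis by blast
qed

lemma inf_act_lincomb_left:
  assumes "x \<in> p" "y \<in> p"
  shows "\<rho> (a *\<^sub>R x + b *\<^sub>R y) v = a *\<^sub>R \<rho> x v + b *\<^sub>R \<rho> y v"
proof (rule linear_functionals_separate[OF fin_dim_V])
  fix l :: "'v \<Rightarrow> real" assume l: "linear l"
  obtain F where "\<forall>x\<in>p. l (\<rho> x v) = left_inv_vf T x \<one> F"
    using inf_act_extension[OF l] by blast
  moreover have "a *\<^sub>R x + b *\<^sub>R y \<in> p"
    using assms subspace_p by (intro subspace_add subspace_scale)
  ultimately show "l (\<rho> (a *\<^sub>R x + b *\<^sub>R y) v) = l (a *\<^sub>R \<rho> x v + b *\<^sub>R \<rho> y v)"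
    using assms by (simp add: linear_add[OF l] linear_scale[OF l] linv_linear)
qed

lemma linear_inf_act_right:
  assumes x: "x \<in> p"
  shows "linear (\<rho> x)"
proof -
  obtain c where c: "one_param T c x" "range c \<subseteq> P"
    using p_one_param[OF x] by blast
  have "\<rho> x (a *\<^sub>R v + b *\<^sub>R w) = a *\<^sub>R \<rho> x v + b *\<^sub>R \<rho> x w" for a b v w
  proof (rule linear_functionals_separate[OF fin_dim_V])
    fix l :: "'v \<Rightarrow> real" assume l: "linear l"
    have "((\<lambda>t. a * l (R (c t) v) + b * l (R (c t) w)) has_real_derivative a * l (\<rho> x v) + b * l (\<rho> x w)) (at 0)"
      by (intro DERIV_add DERIV_cmult inf_act_derivative x c l)
    moreover have "a * l (R (c t) v) + b * l (R (c t) w) = l (R (c t) (a *\<^sub>R v + b *\<^sub>R w))" for t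
    proof -
      have "linear (R (c t))" using c(2) linear_R by blast
      then show ?thesis
        by (simp add: linear_add linear_scale linear_add[OF l] linear_scale[OF l])
    qed
    ultimately have "((\<lambda>t. l (R (c t) (a *\<^sub>R v + b *\<^sub>R w))) has_real_derivative a * l (\<rho> x v) + b * l (\<rho> x w)) (at 0)"
      by simp
    from DERIV_unique[OF inf_act_derivative[OF x c l] this]
    show "l (\<rho> x (a *\<^sub>R v + b *\<^sub>R w)) = l (a *\<^sub>R \<rho> x v + b *\<^sub>R \<rho> x w)"
      by (simp add: linear_add[OF l] linear_scale[OF l])
  qed
  then show ?thesis
    by (rule linear_lincombI)
qed

text \<open>\<open>exp_image\<close> records values at time 1; time \<open>t\<close> is reached by
  rescaling the generator inside the nilradical.\<close>

lemma R_one_param_N: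
  assumes x: "x \<in> big_nil T" and c: "one_param T c x"
  shows "R (c t) v = v"
proof -
  have "one_param T (\<lambda>s. c (t * s)) (t *\<^sub>R x)"
    by (rule one_param_scale[OF c])
  then have "c (t * 1) \<in> exp_image T (big_nil T)"
    unfolding exp_image_def using subspace_scale[OF subspace_N x]
    by (intro CollectI exI[of _ "\<lambda>s. c (t * s)"] exI[of _ "t *\<^sub>R x"]) simp
  then show ?thesis
    using rep by (simp add: rel_tractor_rep_def)
qed

lemma inf_act_N:
  assumes x: "x \<in> big_nil T"
  shows "\<rho> x v = 0"
proof (rule linear_functionals_separate[OF fin_dim_V])
  have xp: "x \<in> p" using x N_subset_p by blast
  obtain c where c: "one_param T c x" "range c \<subseteq> P"
    using p_one_param[OF xp] by blast
  fix l :: "'v \<Rightarrow> real" assume l: "linear l"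
  have "((\<lambda>t. l v) has_real_derivative l (\<rho> x v)) (at 0)"
    using inf_act_derivative[OF xp c l, of v] by (simp add: R_one_param_N[OF x c(1)])
  from DERIV_unique[OF this DERIV_const] show "l (\<rho> x v) = l 0"
    by (simp add: linear_0[OF l])
qed

lemma inf_act_Ad:
  assumes g: "g \<in> P" and x: "x \<in> p"
  shows "\<rho> (Ad T g x) v = R g (\<rho> x (R (inv g) v))"
proof (rule linear_functionals_separate[OF fin_dim_V])
  obtain c where c: "one_param T c x" "range c \<subseteq> P"
    using p_one_param[OF x] by blast
  fix l :: "'v \<Rightarrow> real" assume l: "linear l"
  have lg: "linear (\<lambda>w. l (R g w))"
    using linear_compose[OF linear_R[OF g] l] by (simp add: o_def)
  have "R (g \<otimes> c t \<otimes> inv g) v = R g (R (c t) (R (inv g) v))" for t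
    using R_mult P_closed g c(2) by (simp add: m_assoc range_subsetD)
  moreover have "((\<lambda>t. l (R (g \<otimes> c t \<otimes> inv g) v)) has_real_derivative l (\<rho> (Ad T g x) v)) (at 0)"
    using c(2) g P_closed by (intro inf_act_derivative Ad_p x one_param_conj c(1) l) auto
  ultimately have "((\<lambda>t. l (R g (R (c t) (R (inv g) v)))) has_real_derivative l (\<rho> (Ad T g x) v)) (at 0)"
    by simp
  from DERIV_unique[OF this inf_act_derivative[OF x c lg]]
  show "l (\<rho> (Ad T g x) v) = l (R g (\<rho> x (R (inv g) v)))" .
qed

text \<open>The derivative at 0 of \<open>\<rho> (Ad T (c t) y) v\<close> is computed twice: through
  the derivative of Ad, and by the product rule from
  \<open>R (c t) (\<rho> y (R (c (- t)) v))\<close>. Derivatives of \<open>R\<close> are known on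
  fixed vectors, so the inner curve \<open>R (c (- t)) v\<close> is expanded in coordinates before
  the product rule is used.\<close>

lemma inf_act_bracket:
  assumes x: "x \<in> p" and y: "y \<in> p"
  shows "\<rho> (br x y) v = \<rho> x (\<rho> y v) - \<rho> y (\<rho> x v)"
proof (rule linear_functionals_separate[OF fin_dim_V])
  obtain c where c: "one_param T c x" "range c \<subseteq> P"
    using p_one_param[OF x] by blast
  obtain d where d: "one_param T d y"
    using p_one_param[OF y] by blast
  have cP: "c t \<in> P" for t using c(2) by blast
  fix l :: "'v \<Rightarrow> real" assume l: "linear l"
  obtain F where F: "smooth_near (grp_atlas T) \<one> F" "\<And>x. x \<in> p \<Longrightarrow> l (\<rho> x v) = left_inv_vf T x \<one> F"
    using inf_act_extension[OF l] by blast
  have "((\<lambda>t. l (\<rho> (Ad T (c t) y) v)) has_real_derivative l (\<rho> (br x y) v)) (at 0)"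
    using Ad_derivative_functional[OF c(1) d F(1)] by (simp add: F(2) Ad_p cP x y br_p)
  then have 1: "((\<lambda>t. l (R (c t) (\<rho> y (R (c (- t)) v)))) has_real_derivative l (\<rho> (br x y) v)) (at 0)"
    by (simp add: inf_act_Ad[OF cP y] one_paramD(4)[OF c(1)])
  obtain B :: "'v set" and r :: "'v \<Rightarrow> 'v \<Rightarrow> real" where B: "finite B" "\<And>b. linear (r b)" "\<And>w. (\<Sum>b\<in>B. r b w *\<^sub>R b) = w"
    using fin_dim_coordinates[OF fin_dim_V] by blast
  have expand: "(\<Sum>b\<in>B. r b w * m b) = m w" if "linear m" for w and m :: "'v \<Rightarrow> real"
    by (rule sum_coordinates_functional[OF B(3) that])
  have "((\<lambda>t. r b (R (c (- t)) v)) has_real_derivative - r b (\<rho> x v)) (at 0)" for b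
  proof -
    have "((\<lambda>t. r b (R (c t) v)) has_real_derivative r b (\<rho> x v)) (at (- 0))"
      using inf_act_derivative[OF x c B(2)] by simp
    moreover have "((\<lambda>t. - t) has_real_derivative - 1) (at (0::real))"
      by (auto intro!: derivative_eq_intros)
    ultimately have "((\<lambda>t. r b (R (c (- t)) v)) has_real_derivative r b (\<rho> x v) * - 1) (at 0)"
      by (rule DERIV_chain2[where f = "\<lambda>t. r b (R (c t) v)" and g = "\<lambda>t. - t"])
    then show ?thesis by simp
  qed
  from DERIV_sum[OF DERIV_mult[OF this inf_act_derivative[OF x c l]]]
  have "((\<lambda>t. \<Sum>b\<in>B. r b (R (c (- t)) v) * l (R (c t) (\<rho> y b))) has_real_derivative
      (\<Sum>b\<in>B. - r b (\<rho> x v) * l (R (c 0) (\<rho> y b)) + l (\<rho> x (\<rho> y b)) * r b (R (c (- 0)) v))) (at 0)" .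
  moreover have "(\<Sum>b\<in>B. r b (R (c (- t)) v) * l (R (c t) (\<rho> y b))) = l (R (c t) (\<rho> y (R (c (- t)) v)))" for t
    using linear_compose[OF linear_inf_act_right[OF y] linear_compose[OF linear_R[OF cP] l]]
    by (intro expand) (simp add: o_def)
  moreover have "(\<Sum>b\<in>B. - r b (\<rho> x v) * l (R (c 0) (\<rho> y b)) + l (\<rho> x (\<rho> y b)) * r b (R (c (- 0)) v)) =
      l (\<rho> x (\<rho> y v)) - l (\<rho> y (\<rho> x v))"
  proof -
    have "linear (\<lambda>w. l (\<rho> y w))" "linear (\<lambda>w. l (\<rho> x (\<rho> y w)))"
      using linear_compose[OF linear_inf_act_right[OF y] l]
        linear_compose[OF linear_inf_act_right[OF y] linear_compose[OF linear_inf_act_right[OF x] l]]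
      by (simp_all add: o_def)
    note e = this[THEN expand]
    have "(\<Sum>b\<in>B. - r b (\<rho> x v) * l (R (c 0) (\<rho> y b)) + l (\<rho> x (\<rho> y b)) * r b (R (c (- 0)) v)) =
        (\<Sum>b\<in>B. r b v * l (\<rho> x (\<rho> y b))) - (\<Sum>b\<in>B. r b (\<rho> x v) * l (\<rho> y b))"
      by (simp add: one_paramD(3)[OF c(1)] R_one sum_subtractf mult.commute)
    then show ?thesis
      unfolding e .
  qed
  ultimately have "((\<lambda>t. l (R (c t) (\<rho> y (R (c (- t)) v)))) has_real_derivative
      l (\<rho> x (\<rho> y v)) - l (\<rho> y (\<rho> x v))) (at 0)" by simp
  from DERIV_unique[OF 1 this] show "l (\<rho> (br x y) v) = l (\<rho> x (\<rho> y v) - \<rho> y (\<rho> x v))"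
    by (simp add: linear_diff[OF l])
qed

lemma act_quot_quot:
  assumes "x \<in> p"
  shows "act_quot T R (quot T x) v = \<rho> x v"
  unfolding act_quot_def
proof (rule descend_quot[OF assms])
  fix y assume y: "y \<in> p" "y - x \<in> big_nil T"
  have "\<rho> y v = \<rho> (1 *\<^sub>R (y - x) + 1 *\<^sub>R x) v" by simp
  also have "\<dots> = \<rho> x v"
    using inf_act_lincomb_left[of "y - x" x 1 1 v] y assms N_subset_p by (auto simp: inf_act_N)
  finally show "\<rho> y v = \<rho> x v" .
qed

end


section \<open>Constant fields and curvature\<close>

text \<open>In the Leibniz rule the mixed terms \<open>Y u g * X u f + Y u f * X u g\<close> are
  symmetric in the two fields and cancel. The derivation rules for the inner field hold only near
  \<open>u\<close>, so the outer derivative is moved across by \<open>tangent_local\<close>.\<close>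

lemma vf_bracket_tangent:
  fixes A :: "('a::{t2_space,second_countable_topology}, 'm::euclidean_space) atlas"
  assumes A: "smooth_manifold A" and X: "smooth_vector_field A UNIV X" and Y: "smooth_vector_field A UNIV Y"
  shows "vf_bracket A X Y u \<in> tangent_space A u"
  unfolding tangent_space_def
proof (intro CollectI conjI allI impI)
  have Xt: "X v \<in> tangent_space A v" and Yt: "Y v \<in> tangent_space A v" for v
    using X Y by (auto simp: smooth_vector_field_def)
  note nearX = smooth_vector_field_near[OF X open_UNIV UNIV_I]
  note nearY = smooth_vector_field_near[OF Y open_UNIV UNIV_I]
  note add = smooth_near_add[OF A] and mult = smooth_near_mult[OF A] and const = smooth_near_const[OF A]
  show "vf_bracket A X Y u f = 0" if "\<not> smooth_near A u f" for f
    using that by (simp add: vf_bracket_def)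
  have near_on: "\<exists>W. open W \<and> u \<in> W \<and> (\<forall>v\<in>W. smooth_near A v f \<and> smooth_near A v g)"
    if "smooth_near A u f" "smooth_near A u g" for f g
    using smooth_near_Int[OF that] unfolding smooth_near_def by metis
  fix f assume f: "smooth_near A u f"
  have cm: "X u (\<lambda>v. Y v (\<lambda>x. c * f x)) = c * X u (\<lambda>v. Y v f)"
    if Xt: "\<And>v. X v \<in> tangent_space A v" and Yt: "\<And>v. Y v \<in> tangent_space A v"
      and nearY: "\<And>u f. smooth_near A u f \<Longrightarrow> smooth_near A u (\<lambda>v. Y v f)"
    for c and X Y :: "'a \<Rightarrow> 'a tangent"
  proof -
    obtain W where W: "open W" "u \<in> W" "\<forall>v\<in>W. smooth_near A v f"
      using near_on[OF f f] by blast
    have "X u (\<lambda>v. c * Y v f) = X u (\<lambda>v. Y v (\<lambda>x. c * f x))"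
      using W by (intro tangent_local[OF A Xt mult[OF const nearY[OF f]] W(1,2)])
        (simp add: tangent_spaceD(2)[OF Yt])
    then show ?thesis
      using tangent_spaceD(2)[OF Xt nearY[OF f]] by simp
  qed
  show "vf_bracket A X Y u (\<lambda>x. c * f x) = c * vf_bracket A X Y u f" for c
    using f mult[OF const f] cm[OF Xt Yt nearY] cm[OF Yt Xt nearX]
    by (simp add: vf_bracket_def right_diff_distrib)
  fix g assume g: "smooth_near A u g"
  obtain W where W: "open W" "u \<in> W" "\<forall>v\<in>W. smooth_near A v f \<and> smooth_near A v g"
    using near_on[OF f g] by blast
  have ad: "X u (\<lambda>v. Y v (\<lambda>x. f x + g x)) = X u (\<lambda>v. Y v f) + X u (\<lambda>v. Y v g)"
    if Xt: "\<And>v. X v \<in> tangent_space A v" and Yt: "\<And>v. Y v \<in> tangent_space A v"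
      and nearY: "\<And>u f. smooth_near A u f \<Longrightarrow> smooth_near A u (\<lambda>v. Y v f)"
    for X Y :: "'a \<Rightarrow> 'a tangent"
  proof -
    have "X u (\<lambda>v. Y v f + Y v g) = X u (\<lambda>v. Y v (\<lambda>x. f x + g x))"
      using W by (intro tangent_local[OF A Xt add[OF nearY[OF f] nearY[OF g]] W(1,2)])
        (simp add: tangent_spaceD(3)[OF Yt])
    then show ?thesis
      using tangent_spaceD(3)[OF Xt nearY[OF f] nearY[OF g]] by simp
  qed
  show "vf_bracket A X Y u (\<lambda>x. f x + g x) = vf_bracket A X Y u f + vf_bracket A X Y u g"
    using f g add[OF f g] ad[OF Xt Yt nearY] ad[OF Yt Xt nearX]
    by (simp add: vf_bracket_def)
  have mu: "X u (\<lambda>v. Y v (\<lambda>x. f x * g x)) =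
      f u * X u (\<lambda>v. Y v g) + Y u g * X u f + g u * X u (\<lambda>v. Y v f) + Y u f * X u g"
    if Xt: "\<And>v. X v \<in> tangent_space A v" and Yt: "\<And>v. Y v \<in> tangent_space A v"
      and nearY: "\<And>u f. smooth_near A u f \<Longrightarrow> smooth_near A u (\<lambda>v. Y v f)"
    for X Y :: "'a \<Rightarrow> 'a tangent"
  proof -
    have "X u (\<lambda>v. f v * Y v g + g v * Y v f) = X u (\<lambda>v. Y v (\<lambda>x. f x * g x))"
      using W by (intro tangent_local[OF A Xt add[OF mult[OF f nearY[OF g]] mult[OF g nearY[OF f]]] W(1,2)])
        (simp add: tangent_spaceD(4)[OF Yt])
    then show ?thesis
      using tangent_spaceD(3)[OF Xt mult[OF f nearY[OF g]] mult[OF g nearY[OF f]]]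
        tangent_spaceD(4)[OF Xt f nearY[OF g]] tangent_spaceD(4)[OF Xt g nearY[OF f]] by simp
  qed
  show "vf_bracket A X Y u (\<lambda>x. f x * g x) = f u * vf_bracket A X Y u g + g u * vf_bracket A X Y u f"
    using f g mult[OF f g] mu[OF Xt Yt nearY] mu[OF Yt Xt nearX]
    by (simp add: vf_bracket_def algebra_simps)
qed

lemma vf_bracket_swap: "vf_bracket A Y X u = (\<lambda>f. - vf_bracket A X Y u f)"
  by (auto simp: vf_bracket_def)

locale geometry_loc = nested_type_loc T
  for T :: "('g::{t2_space,second_countable_topology}, 'l::euclidean_space, 'r::real_vector) nested_type" (structure) +
  fixes E :: "('u::{t2_space,second_countable_topology}, 'x::{t2_space,second_countable_topology},
    'g, 'l, 'b::real_normed_vector) geometry"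
  assumes geometry: "parabolic_geometry T E"
begin

abbreviation "M \<equiv> tot_atlas E"
abbreviation "\<omega> \<equiv> conn E"

lemma M_manifold: "smooth_manifold M"
  using geometry by (simp add: parabolic_geometry_def principal_bundle_def)

lemma M_charts: "chart_system M"
  by (rule smooth_manifold_chart_system[OF M_manifold])

lemma act_one [simp]: "act E u \<one> = u"
  using geometry by (simp add: parabolic_geometry_def principal_bundle_def)

lemma act_mult: "g \<in> Q \<Longrightarrow> h \<in> Q \<Longrightarrow> act E u (g \<otimes> h) = act E (act E u g) h"
  using geometry by (simp add: parabolic_geometry_def principal_bundle_def)

lemma act_inv [simp]: "g \<in> Q \<Longrightarrow> act E (act E u g) (inv g) = u" "g \<in> Q \<Longrightarrow> act E (act E u (inv g)) g = u"
  by (simp_all add: Q_inv flip: act_mult)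

lemma smooth_act: "smooth_map_on (prod_atlas M (grp_atlas T)) M (UNIV \<times> Q) (\<lambda>(u,g). act E u g)"
  using geometry by (simp add: parabolic_geometry_def principal_bundle_def)

lemma smooth_param_act:
  assumes F: "smooth_param M S F" and H: "smooth_param (grp_atlas T) S H" and Q: "H ` S \<subseteq> Q"
  shows "smooth_param M S (\<lambda>x. act E (F x) (H x))"
  using smooth_map_on_param[OF chart_system_prod[OF M_charts charts] M_charts smooth_act
      smooth_param_Pair[OF F H M_charts charts]] Q by auto

lemma smooth_map_act: "g \<in> Q \<Longrightarrow> smooth_map M M UNIV (\<lambda>u. act E u g)"
  by (intro smooth_mapI M_manifold M_charts smooth_param_act smooth_param_const charts
      chart_inverse_param[OF M_manifold] smooth_paramD(1)[OF chart_inverse_param[OF M_manifold]]) auto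

lemma smooth_near_act:
  assumes g: "g \<in> Q" and f: "smooth_near M (act E u g) f"
  shows "smooth_near M u (\<lambda>v. f (act E v g))"
proof -
  obtain W where W: "open W" "act E u g \<in> W" "smooth_fun_on M W f"
    using f unfolding smooth_near_def by blast
  have o: "open ((\<lambda>v. act E v g) -` W)"
    using smooth_map_act[OF g] W(1) by (auto simp: smooth_map_def intro: open_vimage)
  have "smooth_fun_on M ((\<lambda>v. act E v g) -` W) (\<lambda>v. f (act E v g))"
    by (rule smooth_fun_on_pullback[OF M_manifold M_charts smooth_map_act[OF g] W(3,1) o]) auto
  with o W(2) show ?thesis
    unfolding smooth_near_def by blast
qed

lemma smooth_near_act_iff:
  assumes g: "g \<in> Q"
  shows "smooth_near M (act E u g) f \<longleftrightarrow> smooth_near M u (\<lambda>v. f (act E v g))"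
proof
  assume "smooth_near M u (\<lambda>v. f (act E v g))"
  then have "smooth_near M (act E (act E u g) (inv g)) (\<lambda>v. f (act E v g))"
    using g by simp
  from smooth_near_act[OF Q_inv[OF g] this] show "smooth_near M (act E u g) f"
    using g by simp
qed (rule smooth_near_act[OF g])

lemma connection: "cartan_connection T Q q E"
  using geometry by (simp add: parabolic_geometry_def)

lemma omega_linear:
  "\<xi> \<in> tangent_space M u \<Longrightarrow> \<eta> \<in> tangent_space M u \<Longrightarrow>
    \<omega> u (\<lambda>f. a * \<xi> f + b * \<eta> f) = a *\<^sub>R \<omega> u \<xi> + b *\<^sub>R \<omega> u \<eta>"
  using connection by (simp add: cartan_connection_def smooth_one_form_def)

lemma omega_smooth: "open W \<Longrightarrow> smooth_vector_field M W X \<Longrightarrow> vsmooth_on M W (\<lambda>u. \<omega> u (X u))"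
  using connection by (simp add: cartan_connection_def smooth_one_form_def)

lemma omega_bij: "bij_betw (\<omega> u) (tangent_space M u) UNIV"
  using connection by (simp add: cartan_connection_def)

lemma omega_act: "g \<in> Q \<Longrightarrow> \<xi> \<in> tangent_space M u \<Longrightarrow>
    \<omega> (act E u g) (\<lambda>f. \<xi> (\<lambda>v. f (act E v g))) = Ad T (inv g) (\<omega> u \<xi>)"
  using connection by (simp add: cartan_connection_def)

lemma omega_generator: "x \<in> q \<Longrightarrow> one_param T c x \<Longrightarrow> range c \<subseteq> Q \<Longrightarrow>
    \<omega> u (velocity M (\<lambda>t. act E u (c t))) = x"
  using connection unfolding cartan_connection_def by blast

section \<open>Constant vector fields\<close>

definition cfield :: "'l \<Rightarrow> 'u \<Rightarrow> 'u tangent" where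
  "cfield x u = conn_inv E u x"

lemma cfield_tangent: "cfield x u \<in> tangent_space M u" and omega_cfield [simp]: "\<omega> u (cfield x u) = x"
proof -
  have "x \<in> \<omega> u ` tangent_space M u"
    using omega_bij[of u] by (simp add: bij_betw_def)
  then show "cfield x u \<in> tangent_space M u" "\<omega> u (cfield x u) = x"
    unfolding cfield_def conn_inv_def by (auto intro: inv_into_into simp: f_inv_into_f)
qed

lemma cfield_omega: "\<xi> \<in> tangent_space M u \<Longrightarrow> cfield (\<omega> u \<xi>) u = \<xi>"
  using omega_bij[of u] unfolding cfield_def conn_inv_def by (auto simp: bij_betw_def)

lemma cfield_eqI: "\<xi> \<in> tangent_space M u \<Longrightarrow> \<omega> u \<xi> = x \<Longrightarrow> cfield x u = \<xi>"
  using cfield_omega by auto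

lemma cfield_linear: "cfield (a *\<^sub>R x + b *\<^sub>R y) u = (\<lambda>f. a * cfield x u f + b * cfield y u f)"
  by (intro cfield_eqI tangent_lincomb[OF M_manifold] cfield_tangent) (simp add: omega_linear cfield_tangent)

lemma linear_cfield: "linear (\<lambda>x. cfield x u f)"
  by (rule linear_lincombI) (simp add: cfield_linear)

lemma cfield_expand: "cfield x u f = (\<Sum>b\<in>Basis. (x \<bullet> b) * cfield b u f)"
  using linear_euclidean_expansion[OF linear_cfield, of x u f] by simp

text \<open>Since \<open>\<omega>\<close> is an isomorphism, the tangent spaces have the dimension of the model
  space, so the coordinate vectors span them.\<close>
lemma omega_chart:
  assumes U: "(U, \<phi>) \<in> M" "u \<in> U"
  defines "m \<equiv> \<lambda>v. \<omega> u (push M (inv_into U \<phi>) (\<phi> u) v)"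
  shows "linear m" "m (inv_into UNIV m x) = x" "inv_into UNIV m (m v) = v" "linear (inv_into UNIV m)"
    "cfield x u = push M (inv_into U \<phi>) (\<phi> u) (inv_into UNIV m x)"
proof -
  note p = chart_inverse_param[OF M_manifold U(1)]
  have inv: "inv_into U \<phi> (\<phi> u) = u"
    using U(2) chart_systemD(2)[OF M_charts U(1)] by simp
  have x0: "\<phi> u \<in> \<phi> ` U" using U(2) by blast
  have t: "push M (inv_into U \<phi>) (\<phi> u) v \<in> tangent_space M u" for v
    using push_in_tangent_space[OF M_manifold p x0, of v] by (simp add: inv)
  have comb: "m (a *\<^sub>R v + b *\<^sub>R w) = a *\<^sub>R m v + b *\<^sub>R m w" for a b v w
    unfolding m_def push_linear[OF M_charts p x0] by (rule omega_linear[OF t t])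
  show lin: "linear m"
    using comb by (rule linear_lincombI)
  have "v = 0" if "m v = 0" for v
  proof (rule push_chart_eq_0[OF M_manifold U])
    have "\<omega> u (\<lambda>f. 0) = 0"
      using omega_linear[OF t t, of 0 v 0 v] by simp
    then have "cfield 0 u = (\<lambda>f. 0)"
      using tangent_lincomb[OF M_manifold t t, of 0 v 0 v] by (intro cfield_eqI) auto
    moreover have "cfield 0 u = push M (inv_into U \<phi>) (\<phi> u) v"
      using that t unfolding m_def by (intro cfield_eqI)
    ultimately show "push M (inv_into U \<phi>) (\<phi> u) v = (\<lambda>f. 0)" by simp
  qed
  then have inj: "inj m"
    by (simp add: linear_injective_0[OF lin])
  then have surj: "surj m"
    by (rule linear_inj_imp_surj[OF lin])
  show mi: "m (inv_into UNIV m x) = x" for x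
    using surj by (rule surj_f_inv_f)
  show im: "inv_into UNIV m (m v) = v" for v
    using inj by (rule inv_f_f)
  show "linear (inv_into UNIV m)"
  proof (rule linearI)
    show "inv_into UNIV m (x + y) = inv_into UNIV m x + inv_into UNIV m y" for x y
      by (metis linear_add[OF lin] mi im)
    show "inv_into UNIV m (c *\<^sub>R x) = c *\<^sub>R inv_into UNIV m x" for c x
      by (metis linear_scale[OF lin] mi im)
  qed
  show "cfield x u = push M (inv_into U \<phi>) (\<phi> u) (inv_into UNIV m x)"
    using mi[of x] t unfolding m_def by (intro cfield_eqI) auto
qed

text \<open>In a chart the Cartan connection is a family \<open>m\<close> of linear isomorphisms,
  smooth because it is evaluated on the coordinate fields. The components of a constant field are
  given by the inverse family \<open>n\<close>, smooth by
  \<open>smooth_on_inverse_family\<close>.\<close>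

lemma smooth_cfield: "smooth_vector_field M UNIV (cfield x)"
  unfolding smooth_vector_field_def
proof (intro conjI ballI allI impI)
  show "cfield x u \<in> tangent_space M u" for u
    by (rule cfield_tangent)
  fix V f assume V: "open V \<and> V \<subseteq> UNIV \<and> smooth_fun_on M V f"
  show "smooth_fun_on M V (\<lambda>u. cfield x u f)"
  proof (rule smooth_fun_on_local[OF M_manifold])
    fix u assume u: "u \<in> V"
    obtain U \<phi> where U: "(U, \<phi>) \<in> M" "u \<in> U"
      using chart_system_cover[OF M_charts] by metis
    note c = chart_systemD[OF M_charts U(1)] and p = chart_inverse_param[OF M_manifold U(1)]
    have inv: "inv_into U \<phi> (\<phi> v) = v" if "v \<in> U" for v
      using that c(2) by simp
    define m where "m = (\<lambda>y v. \<omega> (inv_into U \<phi> y) (push M (inv_into U \<phi>) y v))"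
    define n where "n = (\<lambda>y. inv_into UNIV (m y))"
    have m: "m (\<phi> v) = (\<lambda>w. \<omega> v (push M (inv_into U \<phi>) (\<phi> v) w))" if "v \<in> U" for v
      using inv[OF that] by (simp add: m_def)
    have o: "open (\<phi> ` U)" using c by blast
    have n: "smooth_on (\<phi> ` U) (\<lambda>y. n y x)"
    proof (rule smooth_on_inverse_family[OF o, where M = m])
      show "smooth_on (\<phi> ` U) (\<lambda>y. m y b)" for b
      proof (rule smooth_on_componentwise[OF o])
        fix e :: 'l assume "e \<in> Basis"
        have "linear (\<lambda>y. y \<bullet> e)"
          by (simp add: bounded_linear.linear bounded_linear_inner_left)
        with omega_smooth[OF c(1) smooth_vector_field_chart[OF M_manifold U(1), of b]]
        have "smooth_fun_on M U ((\<lambda>y. y \<bullet> e) \<circ> (\<lambda>u. \<omega> u (push M (inv_into U \<phi>) (\<phi> u) b)))"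
          unfolding vsmooth_on_def by blast
        then have "smooth_on (\<phi> ` (U \<inter> U)) (((\<lambda>y. y \<bullet> e) \<circ> (\<lambda>u. \<omega> u (push M (inv_into U \<phi>) (\<phi> u) b))) \<circ> inv_into U \<phi>)"
          using U(1) by (auto simp: smooth_fun_on_def)
        then have "smooth_on (\<phi> ` U) (((\<lambda>y. y \<bullet> e) \<circ> (\<lambda>u. \<omega> u (push M (inv_into U \<phi>) (\<phi> u) b))) \<circ> inv_into U \<phi>)"
          by simp
        then show "smooth_on (\<phi> ` U) (\<lambda>y. m y b \<bullet> e)"
          by (rule smooth_on_cong[OF _ o]) (auto simp: m_def f_inv_into_f)
      qed
      fix y assume "y \<in> \<phi> ` U"
      then obtain v where v: "v \<in> U" "y = \<phi> v" by blast
      then have my: "m y = (\<lambda>w. \<omega> v (push M (inv_into U \<phi>) y w))"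
        using m by simp
      show "linear (m y)" "linear (n y)" "m y (n y z) = z" "n y (m y z) = z" for z
        using omega_chart(1-4)[OF U(1) v(1), folded v(2)] unfolding n_def my by auto
    qed
    have vn: "cfield x v f = (\<Sum>b\<in>Basis. (n (\<phi> v) x \<bullet> b) * push M (inv_into U \<phi>) (\<phi> v) b f)" if "v \<in> U" for v
    proof -
      have "linear (\<lambda>w. push M (inv_into U \<phi>) (\<phi> v) w f)"
        using that by (intro linear_lincombI) (simp add: push_linear[OF M_charts p])
      from linear_euclidean_expansion[OF this, of "n (\<phi> v) x"]
      show ?thesis
        using omega_chart(5)[OF U(1) that, of x] by (simp add: m[OF that] n_def)
    qed
    have "smooth_fun_on M (U \<inter> V) (\<lambda>v. \<Sum>b\<in>Basis. (n (\<phi> v) x \<bullet> b) * push M (inv_into U \<phi>) (\<phi> v) b f)"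
    proof (intro smooth_fun_on_sum smooth_fun_on_mult M_manifold)
      show UV: "open (U \<inter> V)" using c V by auto
      then show "open (U \<inter> V)" .
      fix b :: 'l
      have "smooth_fun_on M U (\<lambda>v. n (\<phi> v) x \<bullet> b)"
        by (rule smooth_fun_on_chart[OF M_manifold U(1) c(1) order_refl
              smooth_on_bounded_linear_comp[OF bounded_linear_inner_left o n]])
      then show "smooth_fun_on M (U \<inter> V) (\<lambda>v. n (\<phi> v) x \<bullet> b)"
        by (rule smooth_fun_on_subset) simp
      show "smooth_fun_on M (U \<inter> V) (\<lambda>v. push M (inv_into U \<phi>) (\<phi> v) b f)"
        using smooth_vector_field_chart[OF M_manifold U(1), of b] UV V smooth_fun_on_subset[of M V f "U \<inter> V"]
        unfolding smooth_vector_field_def by simp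
    qed
    then have "smooth_fun_on M (U \<inter> V) (\<lambda>u. cfield x u f)"
      using c V vn by (elim smooth_fun_on_cong[OF M_manifold]) auto
    then show "\<exists>W. open W \<and> u \<in> W \<and> smooth_fun_on M W (\<lambda>u. cfield x u f)"
      using c V u U(2) by (intro exI[of _ "U \<inter> V"]) auto
  qed
qed

lemma cfield_near: "smooth_near M u f \<Longrightarrow> smooth_near M u (\<lambda>v. cfield x v f)"
  by (rule smooth_vector_field_near[OF smooth_cfield open_UNIV UNIV_I])

text \<open>Equivariance of the connection read for its inverse: a constant field at a translated
  point is the translate of the constant field of \<open>Ad T g x\<close>.\<close>

lemma cfield_act:
  assumes g: "g \<in> Q"
  shows "cfield x (act E u g) f = cfield (Ad T g x) u (\<lambda>v. f (act E v g))"
proof -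
  let ?\<eta> = "\<lambda>f. cfield (Ad T g x) u (\<lambda>v. f (act E v g))"
  note t = cfield_tangent[of "Ad T g x" u]
  have "?\<eta> \<in> tangent_space M (act E u g)"
    using tangent_spaceD[OF t] unfolding tangent_space_def by (auto simp: smooth_near_act_iff[OF g])
  then have "cfield x (act E u g) = ?\<eta>"
    by (rule cfield_eqI) (simp add: omega_act[OF g t])
  then show ?thesis by simp
qed

text \<open>For \<open>x\<close> in \<open>q\<close> the constant field is the fundamental vector
  field of the principal action, since the connection reproduces generators. Only these constant
  fields have known integral curves.\<close>

lemma cfield_generator:
  assumes x: "x \<in> q" and c: "one_param T c x" "range c \<subseteq> Q" and f: "smooth_near M u f"
  shows "((\<lambda>t. f (act E u (c t))) has_real_derivative cfield x u f) (at 0)"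
proof -
  have p: "smooth_param M UNIV (\<lambda>t. act E u (c t))"
    using c(2) by (intro smooth_param_act smooth_param_const M_charts one_paramD(1)[OF c(1)]) auto
  note v = velocity_eq_push[OF M_charts p UNIV_I]
  have near: "smooth_near M (act E u (c 0)) f"
    using f by (simp add: one_paramD(3)[OF c(1)])
  have "velocity M (\<lambda>t. act E u (c t)) \<in> tangent_space M u"
    using push_in_tangent_space[OF M_manifold p UNIV_I, of 0 1] unfolding v by (simp add: one_paramD(3)[OF c(1)])
  then have "cfield x u = push M (\<lambda>t. act E u (c t)) 0 1"
    unfolding v[symmetric] by (rule cfield_eqI) (rule omega_generator[OF x c])
  with has_real_derivative_of_has_derivative[OF push_has_derivative[OF M_charts p UNIV_I near]]
  show ?thesis by simp
qed

text \<open>Along the orbit of \<open>c\<close>, \<open>cfield_act\<close> writes the derivative of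
  \<open>f\<close> along the constant field of \<open>y\<close> as that of the translate of
  \<open>f\<close> by \<open>c t\<close> along the constant field of \<open>Ad T (c t) y\<close> at
  the fixed point \<open>u\<close>. The product rule at time 0 then has two terms. Differentiating
  Ad yields the bracket \<open>br x y\<close>. Differentiating the translate yields a mixed second
  derivative of \<open>?H\<close>, a function of a chart point and a time, and by symmetry this is
  the iterated derivative in the opposite order.\<close>

lemma cfield_bracket_vertical:
  assumes x: "x \<in> q" and y: "y \<in> p" and f: "smooth_near M u f"
  shows "cfield x u (\<lambda>v. cfield y v f) - cfield y u (\<lambda>v. cfield x v f) = cfield (br x y) u f"
proof -
  obtain c where c: "one_param T c x" "range c \<subseteq> P"
    using p_one_param x q_subset_p by blast
  have cQ: "range c \<subseteq> Q" by (rule one_param_Q[OF x c])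
  then have cQ': "c t \<in> Q" for t by blast
  note c' = one_paramD[OF c(1)]
  obtain d where d: "one_param T d y"
    using p_one_param[OF y] by blast
  obtain U \<phi> where U: "(U, \<phi>) \<in> M" "u \<in> U"
    using chart_system_cover[OF M_charts] by metis
  note ch = chart_systemD[OF M_charts U(1)] and p = chart_inverse_param[OF M_manifold U(1)]
  let ?\<iota> = "inv_into U \<phi>"
  define z where "z = \<phi> u"
  have z: "z \<in> \<phi> ` U" "?\<iota> z = u"
    using U(2) ch(2) by (auto simp: z_def)
  \<comment> \<open>The model vector whose image under the chart is a constant field at
    \<open>u\<close>. It is linear in its argument, so \<open>n (Ad T (c t) y)\<close> can be
    differentiated in \<open>t\<close>.\<close>
  define n where "n = inv_into UNIV (\<lambda>v. \<omega> u (push M ?\<iota> (\<phi> u) v))"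
  have n: "linear n" "cfield w u = push M ?\<iota> z (n w)" for w
    using omega_chart(4,5)[OF U] by (simp_all add: n_def z_def)
  let ?S = "\<phi> ` U \<times> (UNIV :: real set)"
  let ?K = "\<lambda>s. act E (?\<iota> (fst s)) (c (snd s))"
  let ?H = "\<lambda>s. f (?K s)"
  let ?D = "\<lambda>h s. frechet_derivative h (at (s :: 'l \<times> real))"
  have oS: "open ?S" using ch by (simp add: open_Times)
  have K: "smooth_param M ?S ?K"
    using cQ oS by (intro smooth_param_act smooth_param_compose[OF p] smooth_param_compose[OF c'(1)]
        smooth_on_bounded_linear_comp[OF bounded_linear_fst] smooth_on_bounded_linear_comp[OF bounded_linear_snd]
        smooth_on_id M_charts charts) auto
  have K0: "?K (z, 0) = u" by (simp add: z c'(3))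
  obtain S where S: "open S" "(z, 0) \<in> S" "S \<subseteq> ?S" "smooth_on S ?H"
    using smooth_near_param[OF M_charts K, of "(z, 0)" f] f z(1) K0 by auto
  note H = smooth_onD[OF S(4)]
  note H' = smooth_onD[OF smooth_onD(2)[OF S(4)]]
  obtain W where W: "open W" "u \<in> W" "smooth_fun_on M W f"
    using f unfolding smooth_near_def by blast
  have Wnear: "smooth_near M v f" if "v \<in> W" for v
    using that W unfolding smooth_near_def by blast
  have curve: "((\<lambda>t. h (y, t)) has_real_derivative ?D h (y, t) (0, 1)) (at t)"
    if "(h has_derivative ?D h (y, t)) (at (y, t))" for h :: "'l \<times> real \<Rightarrow> real" and y t
    using has_real_derivative_along_line[of h "?D h (y, t)" "(y, 0)" t "(0, 1)"] that by simp
  have slice: "((\<lambda>y. h (y, t)) has_derivative (\<lambda>w. ?D h (y0, t) (w, 0))) (at y0)"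
    if "(h has_derivative ?D h (y0, t)) (at (y0, t))" for h :: "'l \<times> real \<Rightarrow> real" and t y0
  proof -
    have 1: "((\<lambda>y. (y, t)) has_derivative (\<lambda>h. (h, 0))) (at y0)"
      by (auto intro!: derivative_eq_intros)
    show ?thesis
      by (rule has_derivative_compose[OF 1]) (use that in simp)
  qed
  have oz: "open {t. (z, t) \<in> S \<and> ?K (z, t) \<in> W}"
  proof -
    have "open (S \<inter> ?K -` W)"
      using smooth_paramD(4)[OF smooth_param_subset[OF K S(1,3)] W(1)] .
    then have "open ((\<lambda>t. (z, t)) -` (S \<inter> ?K -` W))"
      by (intro open_vimage continuous_intros)
    then show ?thesis
      by (simp add: vimage_def Int_def)
  qed
  have A: "\<forall>\<^sub>F t in nhds 0. cfield y (act E u (c t)) f = (\<Sum>b\<in>Basis. (n (Ad T (c t) y) \<bullet> b) * ?D ?H (z, t) (b, 0))"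
  proof -
    have "\<forall>\<^sub>F t in nhds 0. t \<in> {t. (z, t) \<in> S \<and> ?K (z, t) \<in> W}"
      using S(2) W(2) K0 by (intro eventually_nhds_in_open oz) auto
    then show ?thesis
    proof eventually_elim
      case (elim t)
      then have t: "(z, t) \<in> S" "act E u (c t) \<in> W" by (auto simp: z)
      have near: "smooth_near M (?\<iota> z) (\<lambda>v. f (act E v (c t)))"
        unfolding z(2) by (rule smooth_near_act[OF cQ' Wnear[OF t(2)]])
      have "cfield y (act E u (c t)) f = push M ?\<iota> z (n (Ad T (c t) y)) (\<lambda>v. f (act E v (c t)))"
        by (simp add: cfield_act[OF cQ'] n(2))
      also have "\<dots> = ?D ?H (z, t) (n (Ad T (c t) y), 0)"
        using slice[OF H(1)[OF t(1)]] by (intro push_eqI[OF M_charts p z(1) near, where D = "\<lambda>w. ?D ?H (z, t) (w, 0)"]) simp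
      also have "\<dots> = (\<Sum>b\<in>Basis. (n (Ad T (c t) y) \<bullet> b) * ?D ?H (z, t) (b, 0))"
        using linear_euclidean_expansion[OF has_derivative_linear[OF slice[OF H(1)[OF t(1)]]], of "n (Ad T (c t) y)"]
        by simp
      finally show ?case .
    qed
  qed
  have "((\<lambda>t. n (Ad T (c t) y) \<bullet> b) has_real_derivative n (br x y) \<bullet> b) (at 0)" for b
  proof -
    have "bounded_linear (\<lambda>w. n w \<bullet> b)"
      using n(1) by (intro bounded_linear_inner_left_comp) (simp add: linear_conv_bounded_linear)
    from bounded_linear.has_vector_derivative[OF this Ad_has_derivative[OF c(1) d, of 0]]
    show ?thesis
      by (simp add: c'(3) Ad_one has_real_derivative_iff_has_vector_derivative)
  qed
  from DERIV_sum[OF DERIV_mult[OF this curve[OF H'(1)[OF S(2)]]]]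
  have "((\<lambda>t. \<Sum>b\<in>Basis. (n (Ad T (c t) y) \<bullet> b) * ?D ?H (z, t) (b, 0)) has_real_derivative
      (\<Sum>b\<in>Basis. (n (br x y) \<bullet> b) * ?D ?H (z, 0) (b, 0) +
        ?D (\<lambda>s. ?D ?H s (b, 0)) (z, 0) (0, 1) * (n (Ad T (c 0) y) \<bullet> b))) (at 0)" .
  then have "((\<lambda>t. cfield y (act E u (c t)) f) has_real_derivative
      (\<Sum>b\<in>Basis. (n (br x y) \<bullet> b) * ?D ?H (z, 0) (b, 0) +
        ?D (\<lambda>s. ?D ?H s (b, 0)) (z, 0) (0, 1) * (n (Ad T (c 0) y) \<bullet> b))) (at 0)"
    by (rule DERIV_cong_ev[OF refl A refl, THEN iffD2])
  moreover have "((\<lambda>t. cfield y (act E u (c t)) f) has_real_derivative cfield x u (\<lambda>v. cfield y v f)) (at 0)"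
    by (rule cfield_generator[OF x c(1) cQ cfield_near[OF f]])
  ultimately have "cfield x u (\<lambda>v. cfield y v f) = (\<Sum>b\<in>Basis. (n (br x y) \<bullet> b) * ?D ?H (z, 0) (b, 0) +
        ?D (\<lambda>s. ?D ?H s (b, 0)) (z, 0) (0, 1) * (n (Ad T (c 0) y) \<bullet> b))"
    using DERIV_unique by blast
  also have "\<dots> = (\<Sum>b\<in>Basis. (n (br x y) \<bullet> b) * ?D ?H (z, 0) (b, 0)) +
      (\<Sum>b\<in>Basis. (n y \<bullet> b) * ?D (\<lambda>s. ?D ?H s (b, 0)) (z, 0) (0, 1))"
    by (simp add: sum.distrib c'(3) Ad_one mult.commute)
  also have "(\<Sum>b\<in>Basis. (n (br x y) \<bullet> b) * ?D ?H (z, 0) (b, 0)) = cfield (br x y) u f"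
  proof -
    have near: "smooth_near M (?\<iota> z) f" using f by (simp add: z)
    have "cfield (br x y) u f = ?D ?H (z, 0) (n (br x y), 0)"
      unfolding n(2) using slice[OF H(1)[OF S(2)]]
      by (intro push_eqI[OF M_charts p z(1) near, where D = "\<lambda>w. ?D ?H (z, 0) (w, 0)"]) (simp add: c'(3))
    also have "\<dots> = (\<Sum>b\<in>Basis. (n (br x y) \<bullet> b) * ?D ?H (z, 0) (b, 0))"
      using linear_euclidean_expansion[OF has_derivative_linear[OF slice[OF H(1)[OF S(2)]]], of "n (br x y)"] by simp
    finally show ?thesis by simp
  qed
  also have "(\<Sum>b\<in>Basis. (n y \<bullet> b) * ?D (\<lambda>s. ?D ?H s (b, 0)) (z, 0) (0, 1)) = cfield y u (\<lambda>v. cfield x v f)"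
  proof -
    have near: "smooth_near M (?\<iota> z) (\<lambda>v. cfield x v f)"
      using cfield_near[OF f] by (simp add: z)
    have "((\<lambda>y. ?D ?H (y, 0) (0, 1)) has_derivative (\<lambda>w. ?D (\<lambda>s. ?D ?H s (0, 1)) (z, 0) (w, 0))) (at z)"
      by (rule slice[OF H'(1)[OF S(2)]])
    then have der: "((\<lambda>y. cfield x (?\<iota> y) f) has_derivative (\<lambda>w. ?D (\<lambda>s. ?D ?H s (0, 1)) (z, 0) (w, 0))) (at z)"
    proof (rule has_derivative_transform_within_open)
      have "open (S \<inter> ?K -` W)"
        using smooth_paramD(4)[OF smooth_param_subset[OF K S(1,3)] W(1)] .
      then show "open ((\<lambda>y. (y, 0)) -` (S \<inter> ?K -` W))"
        by (intro open_vimage continuous_intros)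
      show "z \<in> (\<lambda>y. (y, 0)) -` (S \<inter> ?K -` W)"
        using S(2) W(2) K0 by simp
      fix y assume "y \<in> (\<lambda>y. (y, 0)) -` (S \<inter> ?K -` W)"
      then have y: "(y, 0) \<in> S" "?\<iota> y \<in> W" by (auto simp: c'(3))
      have "((\<lambda>t. f (act E (?\<iota> y) (c t))) has_real_derivative cfield x (?\<iota> y) f) (at 0)"
        by (rule cfield_generator[OF x c(1) cQ Wnear[OF y(2)]])
      moreover have "((\<lambda>t. ?H (y, t)) has_real_derivative ?D ?H (y, 0) (0, 1)) (at 0)"
        by (rule curve[OF H(1)[OF y(1)]])
      ultimately show "?D ?H (y, 0) (0, 1) = cfield x (?\<iota> y) f"
        using DERIV_unique by simp
    qed
    have "cfield y u (\<lambda>v. cfield x v f) = ?D (\<lambda>s. ?D ?H s (0, 1)) (z, 0) (n y, 0)"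
      unfolding n(2) by (rule push_eqI[OF M_charts p z(1) near der])
    also have "\<dots> = (\<Sum>b\<in>Basis. (n y \<bullet> b) * ?D (\<lambda>s. ?D ?H s (0, 1)) (z, 0) (b, 0))"
      using linear_euclidean_expansion[OF has_derivative_linear[OF der], of "n y"] by simp
    also have "\<dots> = (\<Sum>b\<in>Basis. (n y \<bullet> b) * ?D (\<lambda>s. ?D ?H s (b, 0)) (z, 0) (0, 1))"
      using frechet_derivative_commute[OF S(4,1,2)] by simp
    finally show ?thesis by simp
  qed
  finally show ?thesis by simp
qed

section \<open>Structure functions of the constant frame and curvature\<close>

text \<open>The value of the connection on the bracket of the two constant fields, extended
  bilinearly from the basis. Defined in this way it is bilinear at once;
  \<open>vf_bracket_cfield\<close> identifies it for all arguments.\<close>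

definition frame_bracket :: "'u \<Rightarrow> 'l \<Rightarrow> 'l \<Rightarrow> 'l" where
  "frame_bracket u x y = (\<Sum>b\<in>Basis. \<Sum>c\<in>Basis. ((x \<bullet> b) * (y \<bullet> c)) *\<^sub>R \<omega> u (vf_bracket M (cfield b) (cfield c) u))"

lemma bilinear_frame_bracket: "bilinear (frame_bracket u)"
  unfolding bilinear_def frame_bracket_def
  by (auto intro!: linearI simp: inner_add_left distrib_left distrib_right scaleR_add_left sum.distrib scaleR_sum_right mult_ac)

text \<open>Expand both fields in the frame of constant fields. Besides the brackets of the frame,
  only the derivatives of the coefficients remain, and they are exactly the derivative terms in the
  formula for the exterior derivative.\<close>

lemma vf_bracket_frame:
  assumes X: "smooth_vector_field M UNIV X" and Y: "smooth_vector_field M UNIV Y"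
  shows "\<omega> u (vf_bracket M X Y u) = frame_bracket u (\<omega> u (X u)) (\<omega> u (Y u)) +
    vderiv (X u) (\<lambda>v. \<omega> v (Y v)) - vderiv (Y u) (\<lambda>v. \<omega> v (X v))"
proof -
  define a where "a = (\<lambda>Z :: 'u \<Rightarrow> 'u tangent. \<lambda>b v. \<omega> v (Z v) \<bullet> b)"
  have exp: "Z v f = (\<Sum>b\<in>Basis. a Z b v * cfield b v f)" if "smooth_vector_field M UNIV Z" for Z v f
    using cfield_expand[of "\<omega> v (Z v)" v f] cfield_omega[of "Z v" v] that
    by (simp add: smooth_vector_field_def a_def)
  have lin: "linear (\<lambda>w. w \<bullet> (b :: 'l))" for b
    by (simp add: bounded_linear.linear bounded_linear_inner_left)
  have vsm: "vsmooth_on M UNIV (\<lambda>v. \<omega> v (Z v))" if "smooth_vector_field M UNIV Z" for Z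
    by (rule omega_smooth[OF open_UNIV that])
  have near_a: "smooth_near M u (a Z b)" if "smooth_vector_field M UNIV Z" for Z b
    using vnear_vsmooth_on[OF vsm[OF that] open_UNIV UNIV_I, of u, unfolded vnear_def, rule_format, OF lin[of b]]
    by (simp add: a_def)
  have vd: "vderiv (Z' u) (\<lambda>v. \<omega> v (Z v)) \<bullet> b = Z' u (a Z b)"
    if "smooth_vector_field M UNIV Z" "smooth_vector_field M UNIV Z'" for Z Z' b
    using linear_vderiv[OF fin_dim_euclidean M_manifold _ vnear_vsmooth_on[OF vsm[OF that(1)] open_UNIV UNIV_I] lin[of b], of "Z' u" u]
      that(2) by (simp add: smooth_vector_field_def a_def)
  have comp: "Z' u (\<lambda>v. Z v f) = (\<Sum>c\<in>Basis. a Z c u * Z' u (\<lambda>v. cfield c v f) + cfield c u f * Z' u (a Z c))"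
    if Z: "smooth_vector_field M UNIV Z" and Z': "smooth_vector_field M UNIV Z'" and f: "smooth_near M u f" for Z Z' f
  proof -
    have t: "Z' u \<in> tangent_space M u" using Z' by (simp add: smooth_vector_field_def)
    have "Z' u (\<lambda>v. Z v f) = Z' u (\<lambda>v. \<Sum>c\<in>Basis. a Z c v * cfield c v f)"
      by (simp add: exp[OF Z])
    also have "\<dots> = (\<Sum>c\<in>Basis. Z' u (\<lambda>v. a Z c v * cfield c v f))"
      by (intro tangent_sum[OF M_manifold t] smooth_near_mult[OF M_manifold] near_a Z cfield_near f)
    also have "\<dots> = (\<Sum>c\<in>Basis. a Z c u * Z' u (\<lambda>v. cfield c v f) + cfield c u f * Z' u (a Z c))"
      by (simp add: tangent_spaceD(4)[OF t near_a[OF Z] cfield_near[OF f]])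
    finally show ?thesis .
  qed
  define w where "w = frame_bracket u (\<omega> u (X u)) (\<omega> u (Y u)) +
    vderiv (X u) (\<lambda>v. \<omega> v (Y v)) - vderiv (Y u) (\<lambda>v. \<omega> v (X v))"
  have tb: "vf_bracket M (cfield b) (cfield c) u \<in> tangent_space M u" for b c
    by (rule vf_bracket_tangent[OF M_manifold smooth_cfield smooth_cfield])
  have "vf_bracket M X Y u f = cfield w u f" for f
  proof (cases "smooth_near M u f")
    case True
    have dist: "cfield (vderiv (Z' u) (\<lambda>v. \<omega> v (Z v))) u f = (\<Sum>c\<in>Basis. cfield c u f * Z' u (a Z c))"
      if "smooth_vector_field M UNIV Z" "smooth_vector_field M UNIV Z'" for Z Z'
      by (subst cfield_expand) (simp add: vd[OF that] mult.commute)
    have fr: "cfield (frame_bracket u (\<omega> u (X u)) (\<omega> u (Y u))) u f =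
        (\<Sum>b\<in>Basis. \<Sum>c\<in>Basis. a X b u * a Y c u * (cfield b u (\<lambda>v. cfield c v f) - cfield c u (\<lambda>v. cfield b v f)))"
      unfolding frame_bracket_def linear_sum[OF linear_cfield] linear_scale[OF linear_cfield] cfield_omega[OF tb]
      using True by (simp add: a_def vf_bracket_def)
    have "X u (\<lambda>v. Y v f) = (\<Sum>c\<in>Basis. \<Sum>b\<in>Basis. a X b u * a Y c u * cfield b u (\<lambda>v. cfield c v f)) +
        (\<Sum>c\<in>Basis. cfield c u f * X u (a Y c))"
      unfolding comp[OF Y X True] sum.distrib by (subst exp[OF X]) (simp add: sum_distrib_left mult_ac)
    moreover have "Y u (\<lambda>v. X v f) = (\<Sum>b\<in>Basis. \<Sum>c\<in>Basis. a X b u * a Y c u * cfield c u (\<lambda>v. cfield b v f)) +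
        (\<Sum>c\<in>Basis. cfield c u f * Y u (a X c))"
      unfolding comp[OF X Y True] sum.distrib by (subst exp[OF Y]) (simp add: sum_distrib_left mult_ac)
    ultimately show ?thesis
      using True sum.swap[of "\<lambda>c b. a X b u * a Y c u * cfield b u (\<lambda>v. cfield c v f)" Basis Basis]
      unfolding w_def linear_diff[OF linear_cfield] linear_add[OF linear_cfield] dist[OF X Y] dist[OF Y X] fr
      by (simp add: vf_bracket_def right_diff_distrib sum_subtractf)
  next
    case False
    then show ?thesis
      using tangent_spaceD(1)[OF cfield_tangent] by (simp add: vf_bracket_def)
  qed
  then have "vf_bracket M X Y u = cfield w u" by (rule ext)
  then show ?thesis by (simp add: w_def)
qed

lemma vderiv_const: "\<xi> \<in> tangent_space M u \<Longrightarrow> fin_dim (UNIV :: 'w::real_vector set) \<Longrightarrow> vderiv \<xi> (\<lambda>v. w :: 'w) = 0"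
  by (rule vderiv_eqI[OF _ M_manifold])
    (auto simp: vnear_def smooth_near_const[OF M_manifold] tangent_const[OF M_manifold] linear_0)

lemma vf_bracket_cfield: "vf_bracket M (cfield x) (cfield y) u = cfield (frame_bracket u x y) u"
proof -
  have "\<omega> u (vf_bracket M (cfield x) (cfield y) u) = frame_bracket u x y"
    using vf_bracket_frame[OF smooth_cfield smooth_cfield]
    by (simp add: vderiv_const[OF cfield_tangent fin_dim_euclidean])
  then show ?thesis
    using cfield_omega[OF vf_bracket_tangent[OF M_manifold smooth_cfield smooth_cfield]] by metis
qed

text \<open>By \<open>vf_bracket_frame\<close> the derivative terms cancel, so the value does not
  depend on the extending fields. Constant fields show that extensions exist, which makes the
  description unique.\<close>

lemma ext_deriv_omega:
  assumes "\<xi> \<in> tangent_space M u" "\<eta> \<in> tangent_space M u"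
  shows "ext_deriv M \<omega> u \<xi> \<eta> = - frame_bracket u (\<omega> u \<xi>) (\<omega> u \<eta>)"
  unfolding ext_deriv_def
proof (rule the_equality)
  show *: "\<forall>X Y. smooth_vector_field M UNIV X \<and> smooth_vector_field M UNIV Y \<and> X u = \<xi> \<and> Y u = \<eta> \<longrightarrow>
     - frame_bracket u (\<omega> u \<xi>) (\<omega> u \<eta>) = vderiv \<xi> (\<lambda>v. \<omega> v (Y v)) - vderiv \<eta> (\<lambda>v. \<omega> v (X v)) - \<omega> u (vf_bracket M X Y u)"
    by (auto simp: vf_bracket_frame)
  fix w assume w: "\<forall>X Y. smooth_vector_field M UNIV X \<and> smooth_vector_field M UNIV Y \<and> X u = \<xi> \<and> Y u = \<eta> \<longrightarrow>
     w = vderiv \<xi> (\<lambda>v. \<omega> v (Y v)) - vderiv \<eta> (\<lambda>v. \<omega> v (X v)) - \<omega> u (vf_bracket M X Y u)"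
  have fields: "smooth_vector_field M UNIV (cfield (\<omega> u \<xi>)) \<and> smooth_vector_field M UNIV (cfield (\<omega> u \<eta>)) \<and>
      cfield (\<omega> u \<xi>) u = \<xi> \<and> cfield (\<omega> u \<eta>) u = \<eta>"
    using assms by (simp add: smooth_cfield cfield_omega)
  show "w = - frame_bracket u (\<omega> u \<xi>) (\<omega> u \<eta>)"
    unfolding w[rule_format, OF fields] *[rule_format, OF fields] by (rule refl)
qed

text \<open>The curvature function on pairs of Lie algebra elements: on constant fields the exterior
  derivative of the connection reduces to minus \<open>frame_bracket\<close>.\<close>

definition curv_fun :: "'u \<Rightarrow> 'l \<Rightarrow> 'l \<Rightarrow> 'l" where
  "curv_fun u x y = br x y - frame_bracket u x y"

lemma curv_form_eq:
  "\<xi> \<in> tangent_space M u \<Longrightarrow> \<eta> \<in> tangent_space M u \<Longrightarrow> curv_form T E u \<xi> \<eta> = curv_fun u (\<omega> u \<xi>) (\<omega> u \<eta>)"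
  by (simp add: curv_form_def ext_deriv_omega curv_fun_def)

lemma bilinear_curv_fun: "bilinear (curv_fun u)"
  using bilinear_br bilinear_frame_bracket[of u] unfolding bilinear_def curv_fun_def
  by (auto intro!: linear_compose_sub)

text \<open>By \<open>cfield_bracket_vertical\<close> the constant fields bracket like the Lie
  algebra if one argument is in \<open>q\<close>; the second equation follows by skew symmetry. The
  other argument is taken in \<open>p\<close>, where the cosets given by \<open>Pi_rho\<close>
  lie.\<close>

lemma curv_fun_horizontal:
  assumes "x \<in> q" "y \<in> p"
  shows "curv_fun u x y = 0" "curv_fun u y x = 0"
proof -
  have "vf_bracket M (cfield x) (cfield y) u = cfield (br x y) u"
  proof
    show "vf_bracket M (cfield x) (cfield y) u f = cfield (br x y) u f" for f
      using cfield_bracket_vertical[OF assms, of u f] tangent_spaceD(1)[OF cfield_tangent]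
      by (auto simp: vf_bracket_def)
  qed
  then have "cfield (frame_bracket u x y) u = cfield (br x y) u"
    by (simp add: vf_bracket_cfield)
  then have eq: "frame_bracket u x y = br x y"
    by (metis omega_cfield)
  then show "curv_fun u x y = 0"
    by (simp add: curv_fun_def)
  have "cfield (frame_bracket u y x) u f = cfield (- frame_bracket u x y) u f" for f
    using vf_bracket_swap[of M "cfield y" "cfield x" u] linear_neg[OF linear_cfield]
    by (simp add: vf_bracket_cfield fun_eq_iff)
  then have "cfield (frame_bracket u y x) u = cfield (- frame_bracket u x y) u"
    by (rule ext)
  then have "frame_bracket u y x = - frame_bracket u x y"
    by (metis omega_cfield)
  then show "curv_fun u y x = 0"
    using br_minus[of y x] by (simp add: curv_fun_def eq)
qed

text \<open>Every representative of the coset \<open>Pi_rho T a\<close> differs from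
  \<open>lift a\<close> by an element of \<open>q\<close>, because the nilradical of
  \<open>p\<close> lies in \<open>q\<close>. Horizontality makes the value independent of the
  representatives, which is what the description in \<open>kappa\<close> requires.\<close>

lemma kappa_lift: "kappa T E u (Pi_rho T a) (Pi_rho T b) = curv_fun u (lift a) (lift b)"
  unfolding kappa_def
proof (rule the_equality)
  have mem: "lift a \<in> Pi_rho T a" for a
    unfolding Pi_rho_def using lift subspace_0[OF subspace_q]
    by (intro CollectI exI[of _ "lift a"] exI[of _ 0]) auto
  have Pi: "w - lift a \<in> q \<and> w \<in> p" if "w \<in> Pi_rho T a" for w a
  proof -
    from that obtain x y where xy: "w = x + y" "x \<in> p" "quot T x = a" "y \<in> q"
      by (auto simp: Pi_rho_def)
    then have "x - lift a \<in> q"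
      using quot_eq_iff[OF xy(2) lift(2), of a] lift(3) N_subset_q by auto
    then have "(x - lift a) + y \<in> q"
      using xy(4) by (intro subspace_add[OF subspace_q])
    then show ?thesis
      using xy q_subset_p subspace_add[OF subspace_p, of x y] by (auto simp: algebra_simps)
  qed
  have eq: "curv_fun u w w' = curv_fun u (lift a) (lift b)" if w: "w \<in> Pi_rho T a" and w': "w' \<in> Pi_rho T b" for w w'
  proof -
    have "curv_fun u (w - lift a) w' = 0" "curv_fun u (lift a) (w' - lift b) = 0"
      using Pi[OF w] Pi[OF w'] lift(2) curv_fun_horizontal by blast+
    then show ?thesis
      by (simp add: bilinear_lsub[OF bilinear_curv_fun] bilinear_rsub[OF bilinear_curv_fun])
  qed
  show "\<forall>\<xi>\<in>tangent_space M u. \<forall>\<eta>\<in>tangent_space M u. \<omega> u \<xi> \<in> Pi_rho T a \<and> \<omega> u \<eta> \<in> Pi_rho T b \<longrightarrow>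
      curv_fun u (lift a) (lift b) = curv_form T E u \<xi> \<eta>"
    by (auto simp: curv_form_eq eq)
  fix w assume "\<forall>\<xi>\<in>tangent_space M u. \<forall>\<eta>\<in>tangent_space M u. \<omega> u \<xi> \<in> Pi_rho T a \<and> \<omega> u \<eta> \<in> Pi_rho T b \<longrightarrow>
      w = curv_form T E u \<xi> \<eta>"
  then have "w = curv_form T E u (cfield (lift a) u) (cfield (lift b) u)"
    using cfield_tangent mem by simp
  then show "w = curv_fun u (lift a) (lift b)"
    by (simp add: curv_form_eq cfield_tangent)
qed

end


section \<open>Relative forms\<close>

text \<open>Functions on the total space with values in the representation form the vector space of
  values for the abstract Cartan calculus.\<close>

instantiation "fun" :: (type, real_vector) real_vector
begin

definition scaleR_fun_def: "c *\<^sub>R f = (\<lambda>x. c *\<^sub>R f x)"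

instance
  by standard (simp_all add: scaleR_fun_def fun_eq_iff scaleR_add_right scaleR_add_left)

end

lemma scaleR_fun_apply [simp]: "(c *\<^sub>R f) x = c *\<^sub>R f x"
  by (simp add: scaleR_fun_def)

lemma sum_fun_apply: "(\<Sum>i\<in>I. f i) x = (\<Sum>i\<in>I. f i x)"
  by (induction I rule: infinite_finite_induct) auto

lemma linear_fun_iff: "linear f \<longleftrightarrow> (\<forall>u. linear (\<lambda>x. f x u))"
  by (auto simp: linear_iff fun_eq_iff)

text \<open>A relative form takes the point first and the tuple second, an abstract cochain with
  function values the reverse; alternation can be checked pointwise.\<close>

lemma alternating_multilinear_fun_iff:
  "alternating_multilinear k \<alpha> \<longleftrightarrow> (\<forall>u. alternating_multilinear k (\<lambda>a. \<alpha> a u))"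
proof (intro iffI allI)
  fix u assume \<alpha>: "alternating_multilinear k \<alpha>"
  show "alternating_multilinear k (\<lambda>a. \<alpha> a u)"
    unfolding alternating_multilinear_def
  proof (intro conjI allI impI)
    show "\<alpha> a u = \<alpha> b u" if "\<forall>i<k. a i = b i" for a b
      using alternating_multilinear_cong[OF \<alpha>, of a b] that by simp
    show "linear (\<lambda>x. \<alpha> (a(i := x)) u)" if "i < k" for a i
      using alternating_multilinear_linear[OF \<alpha> that, of a] by (simp only: linear_fun_iff)
    show "\<alpha> a u = 0" if "i < k" "j < k" "i \<noteq> j \<and> a i = a j" for a i j
      using alternating_multilinear_zero[OF \<alpha>, of i j a] that by simp
  qed
next
  assume \<alpha>: "\<forall>u. alternating_multilinear k (\<lambda>a. \<alpha> a u)"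
  show "alternating_multilinear k \<alpha>"
    unfolding alternating_multilinear_def
  proof (intro conjI allI impI)
    show "\<alpha> a = \<alpha> b" if "\<forall>i<k. a i = b i" for a b
      using alternating_multilinear_cong[OF \<alpha>[rule_format], of a b] that by (simp add: fun_eq_iff)
    show "linear (\<lambda>x. \<alpha> (a(i := x)))" if "i < k" for a i
      using alternating_multilinear_linear[OF \<alpha>[rule_format] that, of a] by (simp only: linear_fun_iff simp_thms)
    show "\<alpha> a = 0" if "i < k" "j < k" "i \<noteq> j \<and> a i = a j" for a i j
      using alternating_multilinear_zero[OF \<alpha>[rule_format], of i j a] that by (simp add: fun_eq_iff)
  qed
qed

locale tractor_loc = geometry_loc T E + rep_loc T R
  for T :: "('g::{t2_space,second_countable_topology}, 'l::euclidean_space, 'r::real_vector) nested_type" (structure)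
    and E :: "('u::{t2_space,second_countable_topology}, 'x::{t2_space,second_countable_topology},
      'g, 'l, 'b::real_normed_vector) geometry"
    and R :: "'g \<Rightarrow> 'v::real_vector \<Rightarrow> 'v"
begin

text \<open>Equivariance is deliberately left out: fixing the arguments of an equivariant form
  destroys it in general, while smoothness survives.\<close>

definition smooth_funs :: "('u \<Rightarrow> 'v) set" where
  "smooth_funs = {f. vsmooth_on M UNIV f}"

definition deriv_along :: "'l \<Rightarrow> ('u \<Rightarrow> 'v) \<Rightarrow> 'u \<Rightarrow> 'v" where
  "deriv_along x f u = vderiv (cfield x u) f"

definition nabla :: "'r \<Rightarrow> ('u \<Rightarrow> 'v) \<Rightarrow> 'u \<Rightarrow> 'v" where
  "nabla a f u = deriv_along (lift a) f u + \<rho> (lift a) (f u)"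

lemma smooth_funsD: "f \<in> smooth_funs \<Longrightarrow> linear (l :: 'v \<Rightarrow> real) \<Longrightarrow> smooth_fun_on M UNIV (\<lambda>u. l (f u))"
  by (simp add: smooth_funs_def vsmooth_on_def o_def)

lemma smooth_funsI: "(\<And>l :: 'v \<Rightarrow> real. linear l \<Longrightarrow> smooth_fun_on M UNIV (\<lambda>u. l (f u))) \<Longrightarrow> f \<in> smooth_funs"
  by (simp add: smooth_funs_def vsmooth_on_def o_def)

lemma smooth_funs_near: "f \<in> smooth_funs \<Longrightarrow> linear (l :: 'v \<Rightarrow> real) \<Longrightarrow> smooth_near M u (\<lambda>u. l (f u))"
  unfolding smooth_near_def using smooth_funsD by blast

lemma linear_deriv_along:
  assumes "f \<in> smooth_funs" "linear (l :: 'v \<Rightarrow> real)"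
  shows "l (deriv_along x f u) = cfield x u (\<lambda>v. l (f v))"
  unfolding deriv_along_def
  by (rule linear_vderiv[OF fin_dim_V M_manifold cfield_tangent _ assms(2)])
    (use smooth_funs_near[OF assms(1)] in \<open>simp add: vnear_def\<close>)

lemma eq_by_functionals: "(\<And>l :: 'v \<Rightarrow> real. linear l \<Longrightarrow> l v = l w) \<Longrightarrow> v = w"
  by (rule linear_functionals_separate[OF fin_dim_V])

lemma smooth_deriv_along:
  assumes "f \<in> smooth_funs"
  shows "deriv_along x f \<in> smooth_funs"
proof (rule smooth_funsI)
  fix l :: "'v \<Rightarrow> real" assume l: "linear l"
  show "smooth_fun_on M UNIV (\<lambda>u. l (deriv_along x f u))"
    unfolding linear_deriv_along[OF assms l]
    using smooth_cfield[of x] smooth_funsD[OF assms l] by (simp add: smooth_vector_field_def)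
qed

lemma smooth_linear_comp:
  assumes "f \<in> smooth_funs" "linear L"
  shows "(\<lambda>u. L (f u)) \<in> smooth_funs"
  using smooth_funsD[OF assms(1) linear_compose[OF assms(2)]] by (intro smooth_funsI) (simp add: o_def)

lemma deriv_along_linear_comp:
  assumes f: "f \<in> smooth_funs" and L: "linear L"
  shows "deriv_along x (\<lambda>u. L (f u)) u = L (deriv_along x f u)"
proof (rule eq_by_functionals)
  fix l :: "'v \<Rightarrow> real" assume l: "linear l"
  have "linear (\<lambda>w. l (L w))"
    using linear_compose[OF L l] by (simp add: o_def)
  from linear_deriv_along[OF f this, of x u]
  show "l (deriv_along x (\<lambda>u. L (f u)) u) = l (L (deriv_along x f u))"
    using linear_deriv_along[OF smooth_linear_comp[OF f L] l, of x u] by simp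
qed

lemma subspace_smooth_funs: "subspace smooth_funs"
  unfolding subspace_def
proof (intro conjI ballI allI)
  show "0 \<in> smooth_funs"
    by (intro smooth_funsI) (simp add: smooth_fun_on_const[OF M_manifold])
  show "f + g \<in> smooth_funs" if "f \<in> smooth_funs" "g \<in> smooth_funs" for f g
    using that by (intro smooth_funsI) (simp add: linear_add smooth_fun_on_add[OF M_manifold] smooth_funsD)
  show "c *\<^sub>R f \<in> smooth_funs" if "f \<in> smooth_funs" for c f
    using that by (intro smooth_funsI)
      (simp add: linear_scale smooth_fun_on_mult[OF M_manifold] smooth_fun_on_const[OF M_manifold] smooth_funsD)
qed

lemma deriv_along_add:
  assumes f: "f \<in> smooth_funs" and g: "g \<in> smooth_funs"
  shows "deriv_along x (f + g) u = deriv_along x f u + deriv_along x g u"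
proof (rule eq_by_functionals)
  fix l :: "'v \<Rightarrow> real" assume l: "linear l"
  show "l (deriv_along x (f + g) u) = l (deriv_along x f u + deriv_along x g u)"
    using tangent_spaceD(3)[OF cfield_tangent smooth_funs_near[OF f l] smooth_funs_near[OF g l]]
    by (simp add: linear_add[OF l] linear_deriv_along[OF _ l] f g subspace_add[OF subspace_smooth_funs])
qed

lemma deriv_along_scale: "f \<in> smooth_funs \<Longrightarrow> deriv_along x (c *\<^sub>R f) u = c *\<^sub>R deriv_along x f u"
  using deriv_along_linear_comp[of f "\<lambda>v. c *\<^sub>R v" x u] by (simp add: scaleR_fun_def linear_iff scaleR_add_right)

lemma linear_deriv_along_direction:
  assumes f: "f \<in> smooth_funs"
  shows "linear (\<lambda>x. deriv_along x f u)"
proof -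
  have "deriv_along (a *\<^sub>R x + b *\<^sub>R y) f u = a *\<^sub>R deriv_along x f u + b *\<^sub>R deriv_along y f u" for a b x y
  proof (rule eq_by_functionals)
    fix l :: "'v \<Rightarrow> real" assume l: "linear l"
    show "l (deriv_along (a *\<^sub>R x + b *\<^sub>R y) f u) = l (a *\<^sub>R deriv_along x f u + b *\<^sub>R deriv_along y f u)"
      by (simp add: linear_add[OF l] linear_scale[OF l] linear_deriv_along[OF f l] cfield_linear)
  qed
  then show ?thesis
    by (rule linear_lincombI)
qed

lemma bilinear_br_quot: "bilinear (br_quot T)"
  unfolding bilinear_def br_quot_lift
  by (auto intro!: linearI simp: linear_add[OF lift(1)] linear_scale[OF lift(1)] linear_add[OF linear_quot]
      linear_scale[OF linear_quot] bilinear_ladd[OF bilinear_br] bilinear_radd[OF bilinear_br]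
      bilinear_lmul[OF bilinear_br] bilinear_rmul[OF bilinear_br])

lemma jacobi_br_quot: "br_quot T a (br_quot T b c) + br_quot T b (br_quot T c a) + br_quot T c (br_quot T a b) = 0"
proof -
  have *: "br_quot T a (br_quot T b c) = quot T (br (lift a) (br (lift b) (lift c)))" for a b c
    using br_quot_quot[OF lift(2) br_p[OF lift(2) lift(2)], of a b c] by (simp add: br_quot_lift[of b c] lift)
  show ?thesis
    unfolding * using lie_algebra_br
    by (simp add: lie_algebra_def linear_0[OF linear_quot] flip: linear_add[OF linear_quot])
qed

lemma linear_rho_lift: "linear (\<lambda>a. \<rho> (lift a) v)"
proof -
  have "\<rho> (lift (s *\<^sub>R a + t *\<^sub>R b)) v = s *\<^sub>R \<rho> (lift a) v + t *\<^sub>R \<rho> (lift b) v" for s t a b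
    using inf_act_lincomb_left[OF lift(2) lift(2)] by (simp add: linear_add[OF lift(1)] linear_scale[OF lift(1)])
  then show ?thesis
    by (rule linear_lincombI)
qed

sublocale ce: ce_connection "br_quot T" smooth_funs nabla
proof
  note lin = linear_inf_act_right[OF lift(2)]
  show "bilinear (br_quot T)" by (rule bilinear_br_quot)
  show "br_quot T x x = 0" for x
    by (simp add: br_quot_lift br_self linear_0[OF linear_quot])
  show "br_quot T x (br_quot T y z) + br_quot T y (br_quot T z x) + br_quot T z (br_quot T x y) = 0" for x y z
    by (rule jacobi_br_quot)
  show "subspace smooth_funs" by (rule subspace_smooth_funs)
  show "nabla x f \<in> smooth_funs" if "f \<in> smooth_funs" for x f
  proof -
    have "deriv_along (lift x) f + (\<lambda>u. \<rho> (lift x) (f u)) \<in> smooth_funs"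
      by (rule subspace_add[OF subspace_smooth_funs smooth_deriv_along[OF that] smooth_linear_comp[OF that lin]])
    then show ?thesis
      by (simp add: nabla_def[abs_def] plus_fun_def)
  qed
  show "nabla x (f + g) = nabla x f + nabla x g" if "f \<in> smooth_funs" "g \<in> smooth_funs" for x f g
    using that by (simp add: fun_eq_iff nabla_def deriv_along_add linear_add[OF lin])
  show "nabla x (c *\<^sub>R f) = c *\<^sub>R nabla x f" if "f \<in> smooth_funs" for x c f
    using that by (simp add: fun_eq_iff nabla_def deriv_along_scale linear_scale[OF lin] scaleR_add_right)
  have "linear (\<lambda>x. nabla x f)" if "f \<in> smooth_funs" for f
    unfolding linear_fun_iff nabla_def
    using linear_compose[OF lift(1) linear_deriv_along_direction[OF that]] linear_rho_lift
    by (auto simp: o_def intro: linear_compose_add)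
  note nab = linear_add[OF this] linear_scale[OF this]
  show "nabla (x + y) f = nabla x f + nabla y f" "nabla (c *\<^sub>R x) f = c *\<^sub>R nabla x f"
    if "f \<in> smooth_funs" for f c x y
    by (rule nab[OF that])+
qed

section \<open>Relative forms as cochains of the connection\<close>

lemma form_sectionsD:
  assumes "\<phi> \<in> form_sections T E R k"
  shows "alternating_multilinear k (\<phi> u)" "(\<lambda>u. \<phi> u a) \<in> smooth_funs"
    "g \<in> Q \<Longrightarrow> \<phi> (act E u g) a = R (inv g) (\<phi> u (\<lambda>i. Ad_quot T g (a i)))"
  using assms by (auto simp: form_sections_def smooth_funs_def)

lemma form_iff: "ce.form k (\<lambda>a u. \<phi> u a) \<longleftrightarrow> (\<forall>u. alternating_multilinear k (\<phi> u)) \<and> (\<forall>a. (\<lambda>u. \<phi> u a) \<in> smooth_funs)"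
  by (simp add: ce.form_def alternating_multilinear_fun_iff[of k "\<lambda>a u. \<phi> u a"])

lemma form_sections_form: "\<phi> \<in> form_sections T E R k \<Longrightarrow> ce.form k (\<lambda>a u. \<phi> u a)"
  by (simp add: form_iff form_sectionsD)

text \<open>On one-parameter subgroups of the nilradical, \<open>R\<close> is the identity and
  \<open>Ad_quot\<close> too, since Ad changes a lift only within the nilradical. Equivariance thus
  makes \<open>\<phi>\<close> constant along the orbit for each fixed tuple, and
  \<open>cfield_generator\<close> identifies the derivative.\<close>

lemma deriv_along_N:
  assumes \<phi>: "\<phi> \<in> form_sections T E R k" and x: "x \<in> big_nil T"
  shows "deriv_along x (\<lambda>u. \<phi> u a) u = 0"
proof (rule eq_by_functionals)
  fix l :: "'v \<Rightarrow> real" assume l: "linear l"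
  have xq: "x \<in> q" "x \<in> p" using x N_subset_q N_subset_p by auto
  obtain c where c: "one_param T c x" "range c \<subseteq> P"
    using p_one_param[OF xq(2)] by blast
  have cQ: "range c \<subseteq> Q" by (rule one_param_Q[OF xq(1) c])
  have "\<phi> (act E u (c t)) a = \<phi> u a" for t
  proof -
    have "Ad_quot T (c t) b = b" for b
    proof -
      have "c t \<in> P" using c(2) by blast
      then have "Ad_quot T (c t) b = quot T (Ad T (c t) (lift b))" "Ad T (c t) (lift b) \<in> p"
        using Ad_quot_lift Ad_p lift(2) by auto
      then show ?thesis
        using Ad_one_param_N[OF x c(1) lift(2), of t b] quot_eq_iff[of "Ad T (c t) (lift b)" "lift b"] lift by simp
    qed
    moreover have "R (inv (c t)) v = v" for v
      using R_one_param_N[OF x c(1), of "- t"] by (simp add: one_paramD(4)[OF c(1)])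
    moreover have "c t \<in> Q" using cQ by blast
    ultimately show ?thesis
      using form_sectionsD(3)[OF \<phi>] by simp
  qed
  then have "((\<lambda>t. l (\<phi> u a)) has_real_derivative cfield x u (\<lambda>v. l (\<phi> v a))) (at 0)"
    using cfield_generator[OF xq(1) c(1) cQ smooth_funs_near[OF form_sectionsD(2)[OF \<phi>, of a] l, of u]] by simp
  from DERIV_unique[OF this DERIV_const]
  show "l (deriv_along x (\<lambda>u. \<phi> u a) u) = l 0"
    by (simp add: linear_deriv_along[OF form_sectionsD(2)[OF \<phi>] l] linear_0[OF l])
qed

lemma deriv_along_mod_N:
  assumes \<phi>: "\<phi> \<in> form_sections T E R k" and "x - y \<in> big_nil T"
  shows "deriv_along x (\<lambda>u. \<phi> u a) u = deriv_along y (\<lambda>u. \<phi> u a) u"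
  using deriv_along_N[OF assms, of a u] linear_diff[OF linear_deriv_along_direction[OF form_sectionsD(2)[OF \<phi>, of a], of u], of x y]
  by simp

lemma rel_fund_deriv_lift:
  assumes \<phi>: "\<phi> \<in> form_sections T E R k"
  shows "rel_fund_deriv T E s \<phi> u a = deriv_along (lift (s u)) (\<lambda>u. \<phi> u a) u"
proof -
  have fd: "fund_deriv E (\<lambda>_. x) \<phi> u a = deriv_along x (\<lambda>u. \<phi> u a) u" for x
    by (simp add: fund_deriv_def deriv_along_def cfield_def)
  have "descend T (\<lambda>x. deriv_along x (\<lambda>u. \<phi> u a) u) (quot T (lift (s u))) = deriv_along (lift (s u)) (\<lambda>u. \<phi> u a) u"
    by (rule descend_quot[OF lift(2) deriv_along_mod_N[OF \<phi>]])
  then show ?thesis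
    by (simp add: rel_fund_deriv_def fd lift)
qed

lemma act_quot_lift: "act_quot T R a v = \<rho> (lift a) v"
  using act_quot_quot[OF lift(2), of a v] by (simp add: lift)

lemma twisted_d_eq_d:
  assumes \<phi>: "\<phi> \<in> form_sections T E R k"
  shows "twisted_d T E R k \<phi> u a = ce.d k (\<lambda>a u. \<phi> u a) a u"
proof -
  have om: "(\<lambda>m. omit i (\<lambda>i (_ :: 'u). a i) m u) = omit i a" for i
    by (auto simp: omit_def)
  have om2: "(\<lambda>m. omit i (omit j (\<lambda>i (_ :: 'u). a i)) m u) = omit i (omit j a)" for i j
    by (auto simp: omit_def)
  show ?thesis
    unfolding twisted_d_def twisted_d_formula_def ce.d_def rel_fund_deriv_lift[OF \<phi>] act_quot_lift om om2
    by (simp add: sum_fun_apply nabla_def scaleR_add_right sum.distrib)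
qed

lemma deriv_along_act:
  assumes \<phi>: "\<phi> \<in> form_sections T E R k" and g: "g \<in> Q"
  shows "deriv_along x (\<lambda>u. \<phi> u a) (act E u g) =
    R (inv g) (deriv_along (Ad T g x) (\<lambda>u. \<phi> u (\<lambda>i. Ad_quot T g (a i))) u)"
proof (rule eq_by_functionals)
  fix l :: "'v \<Rightarrow> real" assume l: "linear l"
  have Rg: "linear (R (inv g))"
    by (rule linear_R[OF P_closed(2)[OF Q_subset_P[OF g]]])
  have lR: "linear (\<lambda>v. l (R (inv g) v))"
    using linear_compose[OF Rg l] by (simp add: o_def)
  show "l (deriv_along x (\<lambda>u. \<phi> u a) (act E u g)) =
      l (R (inv g) (deriv_along (Ad T g x) (\<lambda>u. \<phi> u (\<lambda>i. Ad_quot T g (a i))) u))"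
    by (simp add: linear_deriv_along[OF form_sectionsD(2)[OF \<phi>] l] linear_deriv_along[OF form_sectionsD(2)[OF \<phi>] lR]
        cfield_act[OF g] form_sectionsD(3)[OF \<phi> g])
qed

text \<open>Alternation and smoothness come from the abstract differential; equivariance is checked
  for each of its building blocks. Although \<open>lift\<close> does not commute with the action of
  \<open>g\<close>, the discrepancy \<open>lift_Ad\<close> lies in the nilradical, which contributes
  neither to derivatives of \<open>\<phi>\<close> nor to \<open>\<rho>\<close>.\<close>

lemma twisted_d_form_sections:
  assumes \<phi>: "\<phi> \<in> form_sections T E R k"
  shows "twisted_d T E R k \<phi> \<in> form_sections T E R (Suc k)"
proof -
  have "ce.form (Suc k) (\<lambda>a u. twisted_d T E R k \<phi> u a)"
    using ce.form_d[OF form_sections_form[OF \<phi>]] by (simp add: twisted_d_eq_d[OF \<phi>])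
  moreover have "twisted_d T E R k \<phi> (act E u g) a = R (inv g) (twisted_d T E R k \<phi> u (\<lambda>i. Ad_quot T g (a i)))"
    if g: "g \<in> Q" for u a g
  proof -
    have gP: "g \<in> P" by (rule Q_subset_P[OF g])
    have Rg: "linear (R (inv g))"
      by (rule linear_R[OF P_closed(2)[OF gP]])
    let ?A = "Ad_quot T g"
    have om: "(\<lambda>m. ?A (omit i b m)) = omit i (\<lambda>m. ?A (b m))" for i b
      by (auto simp: omit_def)
    have lift_Ad: "Ad T g (lift b) - lift (?A b) \<in> big_nil T" for b
      using quot_eq_iff[OF Ad_p[OF gP lift(2)[of b]] lift(2)[of "?A b"]] by (simp add: Ad_quot_lift[OF gP] lift)
    have nab: "nabla b (\<lambda>u. \<phi> u a) (act E u g) = R (inv g) (nabla (?A b) (\<lambda>u. \<phi> u (\<lambda>m. ?A (a m))) u)" for b a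
    proof -
      have "deriv_along (lift b) (\<lambda>u. \<phi> u a) (act E u g) = R (inv g) (deriv_along (lift (?A b)) (\<lambda>u. \<phi> u (\<lambda>m. ?A (a m))) u)"
        unfolding deriv_along_act[OF \<phi> g] deriv_along_mod_N[OF \<phi> lift_Ad] by (rule refl)
      moreover have "\<rho> (lift b) (\<phi> (act E u g) a) = R (inv g) (\<rho> (lift (?A b)) (\<phi> u (\<lambda>m. ?A (a m))))"
      proof -
        have "R g (\<rho> (lift b) (R (inv g) v)) = \<rho> (lift (?A b)) v" for v
        proof -
          have "\<rho> (Ad T g (lift b)) v = act_quot T R (?A b) v"
            using act_quot_quot[OF Ad_p[OF gP lift(2)[of b]], of v] by (simp add: Ad_quot_lift[OF gP])
          then show ?thesis
            by (simp add: inf_act_Ad[OF gP lift(2)] act_quot_lift)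
        qed
        note this[symmetric]
        then show ?thesis
          by (simp add: form_sectionsD(3)[OF \<phi> g] R_inv(2)[OF gP])
      qed
      ultimately show ?thesis
        by (simp add: nabla_def linear_add[OF Rg])
    qed
    have brA: "?A (br_quot T b c) = br_quot T (?A b) (?A c)" for b c
    proof -
      have "?A (br_quot T b c) = quot T (Ad T g (br (lift b) (lift c)))"
        using Ad_quot_quot[OF gP br_p[OF lift(2) lift(2)]] by (simp add: br_quot_lift)
      also have "\<dots> = br_quot T (quot T (Ad T g (lift b))) (quot T (Ad T g (lift c)))"
        by (simp add: Ad_bracket br_quot_quot Ad_p gP lift(2))
      also have "\<dots> = br_quot T (?A b) (?A c)"
        by (simp add: Ad_quot_lift[OF gP])
      finally show ?thesis .
    qed
    have cn: "(\<lambda>m. ?A (case_nat b c m)) = case_nat (?A b) (\<lambda>m. ?A (c m))" for b c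
      by (auto simp: fun_eq_iff split: nat.split)
    show ?thesis
      unfolding twisted_d_eq_d[OF \<phi>] ce.d_def
      by (simp add: sum_fun_apply nab om form_sectionsD(3)[OF \<phi> g] cn brA
          linear_add[OF Rg] linear_sum[OF Rg] linear_scale[OF Rg])
  qed
  ultimately show ?thesis
    unfolding form_iff form_sections_def by (simp add: smooth_funs_def)
qed

text \<open>\<open>\<rho> (lift c)\<close> is a fixed linear map and passes through derivatives, so
  the mixed terms are symmetric and cancel. The lift of a bracket differs from the bracket of the
  lifts by an element of the nilradical, invisible to both parts of \<open>nabla\<close>. What is
  left compares the bracket of two constant fields with the constant field of the bracket.\<close>

lemma curv_form_section:
  assumes \<phi>: "\<phi> \<in> form_sections T E R k"
  shows "ce.curv b c (\<lambda>u. \<phi> u a) u = - deriv_along (curv_fun u (lift b) (lift c)) (\<lambda>u. \<phi> u a) u"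
proof -
  let ?f = "\<lambda>u. \<phi> u a"
  note f = form_sectionsD(2)[OF \<phi>, of a]
  note lin = linear_inf_act_right[OF lift(2)]
  have nn: "nabla b (nabla c ?f) u = deriv_along (lift b) (deriv_along (lift c) ?f) u + \<rho> (lift c) (deriv_along (lift b) ?f u) +
      (\<rho> (lift b) (deriv_along (lift c) ?f u) + \<rho> (lift b) (\<rho> (lift c) (?f u)))" for b c
  proof -
    have "nabla c ?f = deriv_along (lift c) ?f + (\<lambda>u. \<rho> (lift c) (?f u))"
      by (simp add: fun_eq_iff nabla_def)
    then have "deriv_along (lift b) (nabla c ?f) u =
        deriv_along (lift b) (deriv_along (lift c) ?f) u + \<rho> (lift c) (deriv_along (lift b) ?f u)"
      using deriv_along_add[OF smooth_deriv_along[OF f] smooth_linear_comp[OF f lin]] deriv_along_linear_comp[OF f lin]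
      by simp
    then show ?thesis
      by (simp add: nabla_def linear_add[OF lin])
  qed
  have brN: "lift (br_quot T b c) - br (lift b) (lift c) \<in> big_nil T"
    using quot_eq_iff[OF lift(2) br_p[OF lift(2) lift(2)], of "br_quot T b c" b c] by (simp add: lift br_quot_lift)
  have "\<rho> (lift (br_quot T b c)) v = \<rho> (br (lift b) (lift c)) v" for v
    using act_quot_quot[OF br_p[OF lift(2) lift(2)], of b c v] by (simp add: act_quot_lift flip: br_quot_lift)
  then have "nabla (br_quot T b c) ?f u = deriv_along (br (lift b) (lift c)) ?f u +
      (\<rho> (lift b) (\<rho> (lift c) (?f u)) - \<rho> (lift c) (\<rho> (lift b) (?f u)))"
    using deriv_along_mod_N[OF \<phi> brN, of a u] inf_act_bracket[OF lift(2) lift(2)] by (simp add: nabla_def)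
  moreover have "deriv_along (lift b) (deriv_along (lift c) ?f) u - deriv_along (lift c) (deriv_along (lift b) ?f) u =
      deriv_along (frame_bracket u (lift b) (lift c)) ?f u"
  proof (rule eq_by_functionals)
    fix l :: "'v \<Rightarrow> real" assume l: "linear l"
    show "l (deriv_along (lift b) (deriv_along (lift c) ?f) u - deriv_along (lift c) (deriv_along (lift b) ?f) u) =
        l (deriv_along (frame_bracket u (lift b) (lift c)) ?f u)"
      using smooth_funs_near[OF f l, of u]
      by (simp add: linear_diff[OF l] linear_deriv_along[OF _ l] f smooth_deriv_along flip: vf_bracket_cfield)
        (simp add: vf_bracket_def)
  qed
  ultimately have "ce.curv b c ?f u = deriv_along (frame_bracket u (lift b) (lift c)) ?f u - deriv_along (br (lift b) (lift c)) ?f u"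
    by (simp add: ce.curv_def nn algebra_simps)
  then show ?thesis
    by (simp add: curv_fun_def linear_diff[OF linear_deriv_along_direction[OF f]])
qed

text \<open>The minus sign in \<open>curv_form_section\<close> cancels the extra \<open>Suc\<close>
  in the exponent of \<open>ce.d_d\<close>.\<close>

lemma twisted_d_twisted_d:
  assumes \<phi>: "\<phi> \<in> form_sections T E R k"
  shows "twisted_d T E R (Suc k) (twisted_d T E R k \<phi>) u a =
    (\<Sum>j\<le>Suc k. \<Sum>i<j. (-1) ^ (i + j) *\<^sub>R
      deriv_along (curv_fun u (lift (a i)) (lift (a j))) (\<lambda>u. \<phi> u (omit i (omit j a))) u)"
proof -
  have "twisted_d T E R (Suc k) (twisted_d T E R k \<phi>) u a = ce.d (Suc k) (ce.d k (\<lambda>a u. \<phi> u a)) a u"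
    by (simp add: twisted_d_eq_d[OF twisted_d_form_sections[OF \<phi>]] twisted_d_eq_d[OF \<phi>])
  then show ?thesis
    by (simp add: ce.d_d[OF form_sections_form[OF \<phi>]] sum_fun_apply curv_form_section[OF \<phi>] del: sum.atMost_Suc)
qed

text \<open>Read off from the formula for the square. In each term the argument coming from
  \<open>q\<close> is either inserted into the curvature, which is horizontal, or remains an
  argument of \<open>\<phi>\<close>; then the function being differentiated vanishes
  identically.\<close>

lemma twisted_d_twisted_d_horizontal:
  assumes \<phi>: "\<phi> \<in> Omega_rho T E R k" and i: "i < Suc (Suc k)" "a i \<in> quot T ` q"
  shows "twisted_d T E R (Suc k) (twisted_d T E R k \<phi>) u a = 0"
proof -
  note \<phi>_props = \<phi>[unfolded Omega_rho_def mem_Collect_eq]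
  note \<phi>' = conjunct1[OF \<phi>_props] and all = conjunct2[OF \<phi>_props]
  have van: "\<phi> u a = 0" if "i < k" "a i \<in> quot T ` q" for u a i
    by (rule all[rule_format]) (intro exI[of _ i] conjI that)
  have lift_q: "lift b \<in> q" if b: "b \<in> quot T ` q" for b
  proof -
    obtain x where x: "x \<in> q" "b = quot T x" using b by blast
    then have "lift b - x \<in> q"
      using quot_eq_iff[OF lift(2) subsetD[OF q_subset_p x(1)], of b] lift(3) N_subset_q by auto
    from subspace_add[OF subspace_q this x(1)] show ?thesis by simp
  qed
  have "deriv_along (curv_fun u (lift (a m)) (lift (a n))) (\<lambda>u. \<phi> u (omit m (omit n a))) u = 0"
    if mn: "m < n" "n \<le> Suc k" for m n
  proof (cases "i = m \<or> i = n")
    case True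
    then have "curv_fun u (lift (a m)) (lift (a n)) = 0"
      using curv_fun_horizontal lift_q i(2) lift(2) by blast
    then show ?thesis
      using linear_0[OF linear_deriv_along_direction[OF form_sectionsD(2)[OF \<phi>']]] by simp
  next
    case False
    \<comment> \<open>The position of entry \<open>i\<close> after entries \<open>m\<close> and
      \<open>n\<close> have been removed: it drops by the number of removed positions below
      \<open>i\<close>.\<close>
    define i' where "i' = (if i < m then i else if i < n then i - 1 else i - 2)"
    have i'_less: "i' < k"
      using False mn i(1) by (auto simp: i'_def)
    have i'_omit: "omit m (omit n a) i' = a i"
    proof (cases "n < i")
      case True
      then obtain r where "i = Suc (Suc r)"
        using mn by (metis Suc_lessE gr_implies_not0 not0_implies_Suc)
      with True mn show ?thesis
        by (simp add: i'_def omit_def)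
    qed (use False mn in \<open>auto simp: i'_def omit_def\<close>)
    then have zero: "(\<lambda>u. \<phi> u (omit m (omit n a))) = 0"
      using van[OF i'_less, of "omit m (omit n a)"] i(2) by (simp add: i'_omit fun_eq_iff)
    show ?thesis
      unfolding zero using deriv_along_scale[of 0 _ 0 u] subspace_0[OF subspace_smooth_funs] by simp
  qed
  then show ?thesis
    unfolding twisted_d_twisted_d[OF \<phi>'] by (intro sum.neutral ballI) simp
qed

end

theorem theorem4p3:
  fixes T :: "('g::{t2_space,second_countable_topology}, 'l::euclidean_space, 'r::real_vector) nested_type"
    and E :: "('u::{t2_space,second_countable_topology}, 'x::{t2_space,second_countable_topology},
               'g, 'l, 'b::real_normed_vector) geometry"
    and R :: "'g \<Rightarrow> 'v::real_vector \<Rightarrow> 'v"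
    and k :: nat
    and \<phi> :: "('u, 'r, 'v) rel_form"
  assumes "nested_parabolic_type T"
    and "parabolic_geometry T E"
    and "rel_tractor_rep T R"
    and "k \<ge> 1"
    and "\<phi> \<in> Omega_rho T E R (k - 1)"
  defines "dd\<phi> \<equiv> twisted_d T E R k (twisted_d T E R (k - 1) \<phi>)"
  shows "dd\<phi> \<in> Omega_rho T E R (k + 1) \<and>
    (\<forall>s. (\<forall>i\<le>k. s i \<in> sections_A_rho T E) \<longrightarrow>
      (\<forall>u. dd\<phi> u (\<lambda>i. s i u) =
        (\<Sum>j\<le>k. \<Sum>i<j. (-1) ^ (i + j) *\<^sub>R
           fund_deriv E (\<lambda>w. kappa T E w (Pi_rho T (s i w)) (Pi_rho T (s j w))) \<phi> u
             (\<lambda>m. omit i (omit j s) m u))))"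
proof -
  interpret tractor_loc T E R
    by unfold_locales (use assms in auto)
  obtain n where k: "k = Suc n"
    using \<open>k \<ge> 1\<close> by (cases k) auto
  have \<phi>: "\<phi> \<in> form_sections T E R n" "\<phi> \<in> Omega_rho T E R n"
    using assms(5) by (auto simp: k Omega_rho_def)
  have dd: "dd\<phi> = twisted_d T E R (Suc n) (twisted_d T E R n \<phi>)"
    by (simp add: dd\<phi>_def k)
  have "dd\<phi> \<in> Omega_rho T E R (k + 1)"
    unfolding Omega_rho_def dd
    using twisted_d_form_sections[OF twisted_d_form_sections[OF \<phi>(1)]] twisted_d_twisted_d_horizontal[OF \<phi>(2)]
    by (auto simp: k)
  moreover have "dd\<phi> u (\<lambda>i. s i u) =
      (\<Sum>j\<le>k. \<Sum>i<j. (-1) ^ (i + j) *\<^sub>R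
         fund_deriv E (\<lambda>w. kappa T E w (Pi_rho T (s i w)) (Pi_rho T (s j w))) \<phi> u (\<lambda>m. omit i (omit j s) m u))" for s u
  proof -
    \<comment> \<open>Both sides depend only on the values of the sections at \<open>u\<close>:
      \<open>fund_deriv\<close> evaluates its direction, here the curvature, at the base point and
      differentiates \<open>\<phi>\<close> on a fixed tuple.\<close>
    have "omit i (omit j (\<lambda>i. s i u)) = (\<lambda>m. omit i (omit j s) m u)" for i j
      by (auto simp: omit_def)
    then show ?thesis
      unfolding dd twisted_d_twisted_d[OF \<phi>(1)]
      by (simp add: k fund_deriv_def kappa_lift deriv_along_def cfield_def del: sum.atMost_Suc)
  qed
  ultimately show ?thesis by blast
qed

end
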